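(* Let $A\in\mathbb{R}^{n\times d}$ have singular values $\sigma_1\ge\dots\ge\sigma_d>0$. Assume that $A$ is $(k,\Delta)$-separated for some $\Delta>0$, i.e. $\sigma_k^2-\sigma_{k+1}^2\ge\Delta\sigma_1^2$, and approximately rank-$k$, i.e. $\sum_{i=1}^k\sigma_i^2\ge\frac1{10}\sum_{i=1}^d\sigma_i^2$. For $\varepsilon$ sufficiently small, there exists $\ell=k^3\cdot\mathrm{poly}(\varepsilon^{-1},\Delta^{-1})$ such that the two-pass row-streaming random projection algorithm described in the context, run with projection dimension $\ell$, produces in its second pass estimates $\tilde L^k(i)$ and $\tilde T^k(i)$ such that, with high probability, $$\sum_{i=1}^n|T^k(i)-\tilde T^k(i)|\le\varepsilon\|A\|_F^2,\qquad \sum_{i=1}^n|L^k(i)-\tilde L^k(i)|\le\varepsilon\sum_{i=1}^nL^k(i).$$ The algorithm uses space $O(\ell^2+\log(d)\log(k))$ and has running time $O(nd\ell)$.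
   Context: Let $a_{(i)}\in\mathbb{R}^d$ be the $i$-th row of $A$ (as a column vector), $A=U\Sigma V^T$ the SVD with $\Sigma=\mathrm{diag}(\sigma_1,\dots,\sigma_d)$, and $v^{(j)}$ the $j$-th column of $V$. $\|A\|_F$ is the Frobenius norm. The rank-$k$ leverage score and rank-$k$ projection distance of row $i$ are $$L^k(i)=\sum_{j=1}^k\frac{(a_{(i)}^Tv^{(j)})^2}{\sigma_j^2},\qquad T^k(i)=\sum_{j=k+1}^d(a_{(i)}^Tv^{(j)})^2.$$ Row-streaming model: the rows of $A$ appear one after the other, and the algorithm makes two passes over them. Algorithm: let $R\in\mathbb{R}^{d\times\ell}$ be a pseudorandom projection matrix with entries $\pm1/\sqrt{\ell}$ drawn from a $\log(\mathrm{sr}(A)/\delta)$-wise independent family, where $\mathrm{sr}(A)=\|A\|_F^2/\sigma_1^2$ is the stable rank (which is $O(k)$ under the approximate rank-$k$ assumption) and $\delta$ is the failure probability. $R$ is not stored explicitly: it is described by a short random seed of $O(\log(d)\log(\mathrm{sr}(A)/\delta))$ bits, from which each entry can be efficiently computed on the fly. First pass: as the rows $a_{(i)}$ arrive, compute $R^Ta_{(i)}$ and accumulate the $\ell\times\ell$ matrix $\tilde A^T\tilde A=\sum_i(R^Ta_{(i)})(R^Ta_{(i)})^T$, where $\tilde A=AR\in\mathbb{R}^{n\times\ell}$. Then, from the SVD of this matrix, compute the top $k$ singular values $\tilde\sigma_1\ge\dots\ge\tilde\sigma_k$ of $\tilde A$ and the matrix $\tilde V_k\in\mathbb{R}^{\ell\times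 k}$ of the corresponding right singular vectors, and set $\tilde\Sigma_k=\mathrm{diag}(\tilde\sigma_1,\dots,\tilde\sigma_k)$. Second pass: as each row $a_{(i)}$ arrives, compute $R^Ta_{(i)}$ and output $$\tilde L^k(i)=\|\tilde\Sigma_k^{-1}\tilde V_k^T(R^Ta_{(i)})\|_2^2,\qquad \tilde T^k(i)=\|a_{(i)}\|_2^2-\|\tilde V_k^T(R^Ta_{(i)})\|_2^2.$$
   Formalization: The running time O(ndℓ) is claimed only for ℓ ≤ d, since accumulating the ℓ×ℓ matrix costs nℓ² and breaks the bound when ℓ is much larger than d; in the space bound log(d)log(k) is read as log(d+1)log(k+1), since it vanishes at k=1. *)

theory Defs
  imports "HOL-Probability.Probability" "HOL-Library.Monad_Syntax" "Jordan_Normal_Form.Matrix"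
begin

hide_const (open) Finite_Cartesian_Product.mat Finite_Cartesian_Product.vec
  Finite_Cartesian_Product.row

section \<open>Singular values, leverage scores, projection distances\<close>

text \<open>
  Indices start at 0: \<^term>\<open>\<sigma> j\<close> is the singular value number \<open>j + 1\<close>. Singular values past the
  number of columns are 0. The left factor is thin (one column per column of \<open>A\<close>).
\<close>

definition is_svd :: "real mat \<Rightarrow> real mat \<Rightarrow> (nat \<Rightarrow> real) \<Rightarrow> real mat \<Rightarrow> bool" where
  "is_svd A U \<sigma> V \<longleftrightarrow>
     U \<in> carrier_mat (dim_row A) (dim_col A) \<and>
     V \<in> carrier_mat (dim_col A) (dim_col A) \<and>
     transpose_mat U * U = 1\<^sub>m (dim_col A) \<and>
     transpose_mat V * V = 1\<^sub>m (dim_col A) \<and>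
     antimono \<sigma> \<and> (\<forall>j \<ge> dim_col A. \<sigma> j = 0) \<and>
     A = U * mat_diag (dim_col A) \<sigma> * transpose_mat V"

definition frob_norm :: "real mat \<Rightarrow> real" where
  "frob_norm A = sqrt (\<Sum>i<dim_row A. \<Sum>j<dim_col A. (A $$ (i, j))\<^sup>2)"

definition stable_rank :: "real mat \<Rightarrow> (nat \<Rightarrow> real) \<Rightarrow> real" where
  "stable_rank A \<sigma> = (frob_norm A)\<^sup>2 / (\<sigma> 0)\<^sup>2"

definition separated :: "(nat \<Rightarrow> real) \<Rightarrow> nat \<Rightarrow> real \<Rightarrow> bool" where
  "separated \<sigma> k \<Delta> \<longleftrightarrow> (\<sigma> (k - 1))\<^sup>2 - (\<sigma> k)\<^sup>2 \<ge> \<Delta> * (\<sigma> 0)\<^sup>2"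

definition approx_rank :: "(nat \<Rightarrow> real) \<Rightarrow> nat \<Rightarrow> nat \<Rightarrow> bool" where
  "approx_rank \<sigma> d k \<longleftrightarrow> (\<Sum>j<k. (\<sigma> j)\<^sup>2) \<ge> 1 / 10 * (\<Sum>j<d. (\<sigma> j)\<^sup>2)"

definition lev_score :: "real mat \<Rightarrow> (nat \<Rightarrow> real) \<Rightarrow> real mat \<Rightarrow> nat \<Rightarrow> nat \<Rightarrow> real" where
  "lev_score A \<sigma> V k i = (\<Sum>j<k. (scalar_prod (row A i) (col V j))\<^sup>2 / (\<sigma> j)\<^sup>2)"

definition proj_dist :: "real mat \<Rightarrow> real mat \<Rightarrow> nat \<Rightarrow> nat \<Rightarrow> real" where
  "proj_dist A V k i = (\<Sum>j=k..<dim_col A. (scalar_prod (row A i) (col V j))\<^sup>2)"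


section \<open>Pseudorandom projection matrices\<close>

definition seeds :: "nat \<Rightarrow> bool list set" where
  "seeds m = {s. length s = m}"

text \<open>
  \<^term>\<open>g s r j\<close> is the sign at position \<open>(r, j)\<close> of a \<open>d \<times> l\<close> matrix, computed from the seed \<open>s\<close>.
  For a uniformly random seed of \<open>m\<close> bits the signs are uniform on \<open>{-1, 1}\<close> and \<open>t\<close>-wise
  independent.
\<close>

definition sign_family ::
    "nat \<Rightarrow> nat \<Rightarrow> nat \<Rightarrow> nat \<Rightarrow> (bool list \<Rightarrow> nat \<Rightarrow> nat \<Rightarrow> real) \<Rightarrow> bool" where
  "sign_family t d l m g \<longleftrightarrow>
     (\<forall>r<d. \<forall>j<l. map_pmf (\<lambda>s. g s r j) (pmf_of_set (seeds m)) = pmf_of_set {-1, 1}) \<and>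
     (\<forall>J \<subseteq> {..<d} \<times> {..<l}. card J \<le> t \<longrightarrow>
        prob_space.indep_vars (measure_pmf (pmf_of_set (seeds m))) (\<lambda>_. borel)
          (\<lambda>(r, j) s. g s r j) J)"

definition proj_entry ::
    "nat \<Rightarrow> (bool list \<Rightarrow> nat \<Rightarrow> nat \<Rightarrow> real) \<Rightarrow> bool list \<Rightarrow> nat \<Rightarrow> nat \<Rightarrow> real" where
  "proj_entry l g s r j = g s r j / sqrt (real l)"

definition proj_mat ::
    "nat \<Rightarrow> nat \<Rightarrow> (bool list \<Rightarrow> nat \<Rightarrow> nat \<Rightarrow> real) \<Rightarrow> bool list \<Rightarrow> real mat" where
  "proj_mat d l g s = mat d l (\<lambda>(r, j). proj_entry l g s r j)"


section \<open>The estimates in closed form\<close>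

text \<open>
  The SVD subroutine is arbitrary: any map that returns an SVD of every square matrix.
\<close>

type_synonym svd_routine = "real mat \<Rightarrow> real mat \<times> (nat \<Rightarrow> real) \<times> real mat"

definition valid_svd_routine :: "svd_routine \<Rightarrow> bool" where
  "valid_svd_routine svd \<longleftrightarrow>
     (\<forall>l. \<forall>B \<in> carrier_mat l l. case svd B of (U, D, W) \<Rightarrow> is_svd B U D W)"

text \<open>
  For \<open>M = A * R\<close>, the singular values of \<open>M\<close> are the square roots of those of \<open>M\<^sup>T * M\<close>, and the
  right singular vectors of \<open>M\<^sup>T * M\<close> are right singular vectors of \<open>M\<close>.
\<close>

definition sketch_sv :: "svd_routine \<Rightarrow> real mat \<Rightarrow> nat \<Rightarrow> real" where
  "sketch_sv svd M j = (case svd (transpose_mat M * M) of (U, D, W) \<Rightarrow> sqrt (D j))"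

definition sketch_vecs :: "svd_routine \<Rightarrow> nat \<Rightarrow> real mat \<Rightarrow> real mat" where
  "sketch_vecs svd k M =
     (case svd (transpose_mat M * M) of (U, D, W) \<Rightarrow> mat (dim_col M) k (\<lambda>(i, j). W $$ (i, j)))"

definition sq_norm2 :: "real vec \<Rightarrow> real" where
  "sq_norm2 v = scalar_prod v v"

definition est_lev :: "svd_routine \<Rightarrow> nat \<Rightarrow> real mat \<Rightarrow> real mat \<Rightarrow> nat \<Rightarrow> real" where
  "est_lev svd k A R i =
     sq_norm2 (mat_diag k (\<lambda>j. 1 / sketch_sv svd (A * R) j) *\<^sub>v
       (transpose_mat (sketch_vecs svd k (A * R)) *\<^sub>v (transpose_mat R *\<^sub>v row A i)))"

definition est_dist :: "svd_routine \<Rightarrow> nat \<Rightarrow> real mat \<Rightarrow> real mat \<Rightarrow> nat \<Rightarrow> real" where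
  "est_dist svd k A R i = sq_norm2 (row A i) -
     sq_norm2 (transpose_mat (sketch_vecs svd k (A * R)) *\<^sub>v (transpose_mat R *\<^sub>v row A i))"


section \<open>Programs with time and space accounting\<close>

text \<open>
  A program carries its result, the number of elementary steps it executes and the peak number of
  cells it uses. A cell holds one real number; a bit of the random seed also counts as one cell.
  \<open>hold c p\<close> runs \<open>p\<close> while \<open>c\<close> further cells are occupied.
\<close>

datatype 'a prog = Prog (result_of: 'a) (time_of: nat) (space_of: nat)

definition ret :: "'a \<Rightarrow> 'a prog" where
  "ret x = Prog x 0 0"

definition bind_prog :: "'a prog \<Rightarrow> ('a \<Rightarrow> 'b prog) \<Rightarrow> 'b prog" where
  "bind_prog p f = (let q = f (result_of p) in
     Prog (result_of q) (time_of p + time_of q) (max (space_of p) (space_of q)))"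

adhoc_overloading Monad_Syntax.bind \<rightleftharpoons> bind_prog

definition hold :: "nat \<Rightarrow> 'a prog \<Rightarrow> 'a prog" where
  "hold c p = Prog (result_of p) (time_of p) (c + space_of p)"

definition tick :: "unit prog" where
  "tick = Prog () 1 0"

text \<open>\<open>elem x\<close> is always applied to a single arithmetic operation, square root or copy.\<close>

definition elem :: "real \<Rightarrow> real prog" where
  "elem x = Prog x 1 1"

text \<open>
  Computing one entry of the projection matrix from the seed takes \<open>\<tau>\<close> steps and \<open>\<tau>\<close> cells. An exact
  SVD is not a finite sequence of arithmetic operations, so it is a primitive: for a square matrix
  of size \<open>l\<close> it takes \<open>\<kappa> * l ^ 3\<close> steps and \<open>\<kappa> * l ^ 2\<close> cells.
\<close>

definition query :: "nat \<Rightarrow> real \<Rightarrow> real prog" where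
  "query \<tau> x = Prog x \<tau> \<tau>"

definition call_svd :: "nat \<Rightarrow> svd_routine \<Rightarrow> real mat \<Rightarrow> ((nat \<Rightarrow> real) \<times> real mat) prog" where
  "call_svd \<kappa> svd B = (case svd B of (U, D, W) \<Rightarrow>
     Prog (D, W) (\<kappa> * dim_row B ^ 3) (\<kappa> * dim_row B ^ 2))"

definition zeros :: "nat \<Rightarrow> real list prog" where
  "zeros c = Prog (replicate c 0) c c"

text \<open>\<open>sz\<close> gives the number of cells of the loop state.\<close>

primrec loop :: "('s \<Rightarrow> nat) \<Rightarrow> ('x \<Rightarrow> 's \<Rightarrow> 's prog) \<Rightarrow> 'x list \<Rightarrow> 's \<Rightarrow> 's prog" where
  "loop sz f [] s = ret s"
| "loop sz f (x # xs) s = do { tick; s' \<leftarrow> hold (sz s) (f x s); loop sz f xs s' }"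

text \<open>
  Every collected result occupies \<open>c\<close> cells; \<open>c = 0\<close> is for results that are written to the output
  and not stored.
\<close>

primrec collect :: "nat \<Rightarrow> ('x \<Rightarrow> 'y prog) \<Rightarrow> 'x list \<Rightarrow> 'y list prog" where
  "collect c f [] = ret []"
| "collect c f (x # xs) = do { tick; y \<leftarrow> f x; ys \<leftarrow> hold c (collect c f xs); ret (y # ys) }"


section \<open>The two-pass algorithm\<close>

text \<open>
  A pass reads the entries of the current row \<open>a\<close> one after the other; the row is not stored.
  \<open>E r j\<close> is the entry \<open>(r, j)\<close> of the projection matrix.
\<close>

definition add_entry ::
    "nat \<Rightarrow> (nat \<Rightarrow> nat \<Rightarrow> real) \<Rightarrow> nat \<Rightarrow> real \<Rightarrow> real list \<Rightarrow> real list prog" where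
  "add_entry \<tau> E r x y = collect 1 (\<lambda>(j, u). do {
      e \<leftarrow> query \<tau> (E r j);
      z \<leftarrow> hold 1 (elem (e * x));
      hold 1 (elem (u + z)) }) (List.enumerate 0 y)"

definition sketch_row ::
    "nat \<Rightarrow> nat \<Rightarrow> (nat \<Rightarrow> nat \<Rightarrow> real) \<Rightarrow> real list \<Rightarrow> real list prog" where
  "sketch_row \<tau> l E a = do {
      y \<leftarrow> zeros l;
      loop length (\<lambda>(r, x) y. hold 1 (add_entry \<tau> E r x y)) (List.enumerate 0 a) y }"

definition sketch_row_norm ::
    "nat \<Rightarrow> nat \<Rightarrow> (nat \<Rightarrow> nat \<Rightarrow> real) \<Rightarrow> real list \<Rightarrow> (real list \<times> real) prog" where
  "sketch_row_norm \<tau> l E a = do {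
      y \<leftarrow> zeros l;
      loop (\<lambda>(y, q). length y + 1) (\<lambda>(r, x) (y, q). hold 1 (do {
          y' \<leftarrow> add_entry \<tau> E r x y;
          hold (length y') (do {
            z \<leftarrow> elem (x * x);
            q' \<leftarrow> hold 1 (elem (q + z));
            ret (y', q') }) })) (List.enumerate 0 a) (y, 0) }"

text \<open>The \<open>l \<times> l\<close> matrix is stored as a list in row-major order.\<close>

definition rank_one_update :: "real list \<Rightarrow> real list \<Rightarrow> real list prog" where
  "rank_one_update y G = collect 1 (\<lambda>((u, v), h). do {
      z \<leftarrow> elem (u * v);
      hold 1 (elem (h + z)) }) (zip (List.product y y) G)"

definition first_pass ::
    "nat \<Rightarrow> nat \<Rightarrow> (nat \<Rightarrow> nat \<Rightarrow> real) \<Rightarrow> real list list \<Rightarrow> real list prog" where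
  "first_pass \<tau> l E As = do {
      G \<leftarrow> zeros (l * l);
      loop length (\<lambda>a G. do {
          y \<leftarrow> sketch_row \<tau> l E a;
          hold (length y) (rank_one_update y G) }) As G }"

definition top_singular ::
    "nat \<Rightarrow> svd_routine \<Rightarrow> nat \<Rightarrow> nat \<Rightarrow> real list \<Rightarrow> (real \<times> real list) list prog" where
  "top_singular \<kappa> svd k l G = do {
      (D, W) \<leftarrow> call_svd \<kappa> svd (mat l l (\<lambda>(i, j). G ! (i * l + j)));
      hold (l + l * l) (collect (l + 1) (\<lambda>j. do {
          \<sigma> \<leftarrow> elem (sqrt (D j));
          w \<leftarrow> hold 1 (collect 1 (\<lambda>i. elem (W $$ (i, j))) [0..<l]);
          ret (\<sigma>, w) }) [0..<k]) }"

definition dot :: "real list \<Rightarrow> real list \<Rightarrow> real prog" where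
  "dot w y = loop (\<lambda>_. 1) (\<lambda>(u, v) q. hold 1 (do {
      z \<leftarrow> elem (u * v);
      hold 1 (elem (q + z)) })) (zip w y) 0"

definition estimate_row ::
    "nat \<Rightarrow> nat \<Rightarrow> (nat \<Rightarrow> nat \<Rightarrow> real) \<Rightarrow> (real \<times> real list) list \<Rightarrow> real list \<Rightarrow> (real \<times> real) prog" where
  "estimate_row \<tau> l E tops a = do {
      (y, q) \<leftarrow> sketch_row_norm \<tau> l E a;
      hold (length y + 1) (do {
        (L, S) \<leftarrow> loop (\<lambda>_. 2) (\<lambda>(\<sigma>, w) (L, S). do {
            z \<leftarrow> dot w y;
            hold 4 (do {
              x \<leftarrow> elem (z / \<sigma>);
              x2 \<leftarrow> elem (x * x);
              L' \<leftarrow> elem (L + x2);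
              z2 \<leftarrow> elem (z * z);
              S' \<leftarrow> elem (S + z2);
              ret (L', S') }) }) tops (0, 0);
        T \<leftarrow> hold 2 (elem (q - S));
        ret (L, T) }) }"

definition second_pass ::
    "nat \<Rightarrow> nat \<Rightarrow> (nat \<Rightarrow> nat \<Rightarrow> real) \<Rightarrow> (real \<times> real list) list \<Rightarrow> real list list \<Rightarrow>
      (real \<times> real) list prog" where
  "second_pass \<tau> l E tops As = collect 0 (estimate_row \<tau> l E tops) As"

definition two_pass ::
    "nat \<Rightarrow> nat \<Rightarrow> svd_routine \<Rightarrow> (bool list \<Rightarrow> nat \<Rightarrow> nat \<Rightarrow> real) \<Rightarrow> nat \<Rightarrow> nat \<Rightarrow>
      bool list \<Rightarrow> real list list \<Rightarrow> (real \<times> real) list prog" where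
  "two_pass \<tau> \<kappa> svd g k l s As = hold (length s) (do {
      G \<leftarrow> first_pass \<tau> l (proj_entry l g s) As;
      tops \<leftarrow> hold (length G) (top_singular \<kappa> svd k l G);
      hold (\<Sum>(\<sigma>, w)\<leftarrow>tops. 1 + length w)
        (second_pass \<tau> l (proj_entry l g s) tops As) })"

end

theory Submission
  imports Defs "Jordan_Normal_Form.Determinant"
begin

text \<open>
  Write \<open>B = A A\<^sup>T = \<Sum>\<^sub>j \<sigma>\<^sub>j\<^sup>2 u\<^sub>j u\<^sub>j\<^sup>T\<close> and \<open>B' = (A R) (A R)\<^sup>T\<close>, with spectral projections \<open>P\<close>, \<open>P'\<close> onto the
  top \<open>k\<close> eigenvectors. Then \<open>L\<^sup>k(i)\<close> is the diagonal entry \<open>P(i, i)\<close> and \<open>T\<^sup>k(i)\<close> is \<open>\<parallel>a\<^sub>i\<parallel>\<^sup>2 - (P B)(i, i)\<close>;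
  the estimates are the same expressions in \<open>P'\<close> and \<open>B'\<close>. By the Frobenius \<open>sin \<Theta>\<close> argument
  \<open>\<parallel>P - P'\<parallel> \<le> 2 \<parallel>B - B'\<parallel> / gap\<close>, and as \<open>P\<close> and \<open>P'\<close> have Frobenius norm at most \<open>\<surd>k\<close>, Cauchy--Schwarz
  bounds both sums of errors as soon as \<open>\<parallel>B - B'\<parallel> \<le> \<epsilon> \<Delta> \<sigma>\<^sub>1\<^sup>2 / 8\<close>.

  The entries of \<open>B - B'\<close> are quadratic forms in the signs, so hypercontractivity gives
  \<open>E \<parallel>B - B'\<parallel>\<^sup>2\<^sup>p \<le> (8 p\<^sup>2 \<parallel>A\<parallel>\<^sub>F\<^sup>4 / l)\<^sup>p\<close>, a moment that only sees products of \<open>4 p\<close> signs. With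
  \<open>p\<close> about \<open>ln (1 / \<delta>)\<close> the failure probability is at most \<open>exp (- p) \<le> \<delta>\<close>: here \<open>\<parallel>A\<parallel>\<^sub>F\<^sup>4\<close> costs
  \<open>k\<^sup>2\<close> and \<open>p\<^sup>2 = O(k)\<close> because \<open>\<delta>\<close> is polynomial in \<open>1 / k\<close>, which is where \<open>k\<^sup>3\<close> comes from.

  Sign families with logarithmic seeds come from binary linear codes of large dual distance.
\<close>

text \<open>Measuring B - B' in Frobenius norm rather than in operator norm keeps everything at the
  level of explicit quadratic forms. Minkowski's inequality for moments of order \<open>p\<close>
  adds up the entrywise bounds, so neither a net of directions nor a union bound over the n^2
  entries occurs. The obstacle is that the signs are only t-wise independent, while
  hypercontractivity is proved by induction over independent coordinates. Even powers of a
  low-degree form are again polynomials of bounded degree, and their means are the same for both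
  kinds of signs, so the induction takes place on the full cube and the result is transferred. The
  factor sqrt k lost in Cauchy--Schwarz is harmless because both targets carry a factor k: the
  leverage scores sum to k, and separation makes the squared Frobenius norm at least k * \<Delta> *
  \<sigma>_1^2. A spectral gap is used for B only; for B' the plain Ky Fan maximum principle
  suffices, so the spectrum of the sketch need not be controlled beforehand.\<close>

lemma finite_seeds [simp]: "finite (seeds m)" "seeds m \<noteq> {}"
proof -
  show "finite (seeds m)" using finite_lists_length_eq[of "UNIV :: bool set" m]
    by (simp add: seeds_def)
  show "seeds m \<noteq> {}" unfolding seeds_def by (auto intro: exI[of _ "replicate m True"])
qed

text \<open>The sign-reversing involution argument: reindexing by \<open>h\<close> makes the sum
  equal to its own negative. It kills the nontrivial characters, both over seeds and over
  subsets.\<close>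

lemma sum_odd_involution:
  fixes f :: "'a \<Rightarrow> real"
  assumes "\<And>s. s \<in> A \<Longrightarrow> h s \<in> A" "\<And>s. s \<in> A \<Longrightarrow> h (h s) = s"
    and "\<And>s. s \<in> A \<Longrightarrow> f (h s) = - f s"
  shows "sum f A = 0"
proof -
  have "sum f A = (\<Sum>s\<in>A. f (h s))"
    by (rule sum.reindex_bij_witness[of _ h h]) (use assms in auto)
  also have "\<dots> = - sum f A"
    using assms(3) by (simp add: sum_negf)
  finally show ?thesis by simp
qed

section \<open>Small-bias characterisation of uniform independent signs\<close>

text \<open>For a sign \<open>X s\<close> and x = 1 or -1, the indicator of X = x is
  \<open>1 / 2 + x / 2 * X s\<close>, so the mean alone decides the law.\<close>

lemma uniform_sign_iff:
  fixes X :: "'s \<Rightarrow> real"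
  assumes X: "\<And>s. s \<in> set_pmf p \<Longrightarrow> X s = 1 \<or> X s = -1"
    and E: "measure_pmf.expectation p X = 0"
  shows "map_pmf X p = pmf_of_set {-1, 1}"
proof -
  have int: "integrable (measure_pmf p) X"
  proof (rule measure_pmf.integrable_const_bound[where B = 1])
    have "\<bar>X s\<bar> \<le> 1" if "s \<in> set_pmf p" for s using X[OF that] by auto
    then show "AE s in measure_pmf p. norm (X s) \<le> 1" by (simp add: AE_measure_pmf_iff)
  qed simp
  have val: "measure_pmf.prob p (X -` {x}) = 1 / 2" if "x = 1 \<or> x = -1" for x
  proof -
    have "measure_pmf.prob p (X -` {x}) = measure_pmf.expectation p (indicator (X -` {x}))"
      by simp
    also have "\<dots> = measure_pmf.expectation p (\<lambda>s. 1 / 2 + x / 2 * X s)"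
    proof (rule integral_cong_AE)
      have "indicator (X -` {x}) s = 1 / 2 + x / 2 * X s" if "s \<in> set_pmf p" for s
        using X[OF that] \<open>x = 1 \<or> x = -1\<close> by (auto simp: indicator_def)
      then show "AE s in measure_pmf p. indicator (X -` {x}) s = 1 / 2 + x / 2 * X s"
        by (simp add: AE_measure_pmf_iff)
    qed simp_all
    also have "\<dots> = 1 / 2" using int E by simp
    finally show ?thesis .
  qed
  have "pmf (map_pmf X p) x = pmf (pmf_of_set {-1, 1}) x" for x
  proof (cases "x = 1 \<or> x = -1")
    case True
    then show ?thesis using val[of x] by (auto simp: pmf_map)
  next
    case False
    then have "x \<notin> set_pmf (map_pmf X p)" using X by fastforce
    then show ?thesis using False by (simp add: pmf_eq_0_set_pmf)
  qed
  then show ?thesis by (rule pmf_eqI)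
qed

text \<open>
  On \<open>{-1, 1}\<close> every indicator is affine, so the mixed moments of signs determine their joint law.
\<close>

lemma indep_signs:
  fixes X :: "'u \<Rightarrow> 's \<Rightarrow> real"
  assumes fin: "finite J"
    and X: "\<And>u s. u \<in> J \<Longrightarrow> s \<in> set_pmf p \<Longrightarrow> X u s = 1 \<or> X u s = -1"
    and E: "\<And>S. S \<subseteq> J \<Longrightarrow> S \<noteq> {} \<Longrightarrow> measure_pmf.expectation p (\<lambda>s. \<Prod>u\<in>S. X u s) = 0"
  shows "prob_space.indep_vars (measure_pmf p) (\<lambda>_. borel) X J"
proof -
  have int: "integrable (measure_pmf p) (\<lambda>s. \<Prod>u\<in>S. X u s)" if "S \<subseteq> J" for S
  proof (rule measure_pmf.integrable_const_bound[where B = 1])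
    have "\<bar>X u s\<bar> = 1" if "s \<in> set_pmf p" "u \<in> S" for s u
    proof -
      have "u \<in> J" using that \<open>S \<subseteq> J\<close> by blast
      then show ?thesis using X[of u s] that(1) by auto
    qed
    then have "\<bar>\<Prod>u\<in>S. X u s\<bar> = 1" if "s \<in> set_pmf p" for s
      unfolding abs_prod using that by simp
    then show "AE s in measure_pmf p. norm (\<Prod>u\<in>S. X u s) \<le> 1"
      by (auto simp: AE_measure_pmf_iff)
  qed simp
  show ?thesis
    unfolding prob_space.indep_vars_def2[OF measure_pmf.prob_space_axioms]
  proof (intro conjI ballI prob_space.indep_setsI[OF measure_pmf.prob_space_axioms])
    fix A K assume K: "K \<noteq> {}" "K \<subseteq> J" "finite K"
      and A: "\<forall>j\<in>K. A j \<in> {X j -` A \<inter> space (measure_pmf p) |A. A \<in> sets borel}"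
    from A have "\<forall>j\<in>K. \<exists>B. A j = X j -` B" by fastforce
    then obtain B where B: "\<And>j. j \<in> K \<Longrightarrow> A j = X j -` B j" by metis
    \<comment> \<open>At a sign \<open>z\<close> the indicator of \<open>B j\<close> is
      \<open>\<beta> j * z + \<alpha> j\<close>: half sum and half difference of its values at 1 and
      -1.\<close>
    define \<alpha> where "\<alpha> j = (indicator (B j) 1 + indicator (B j) (-1)) / (2 :: real)" for j
    define \<beta> where "\<beta> j = (indicator (B j) 1 - indicator (B j) (-1)) / (2 :: real)" for j
    have moment: "measure_pmf.prob p (\<Inter>j\<in>L. A j) = (\<Prod>j\<in>L. \<alpha> j)" if L: "L \<subseteq> K" "L \<noteq> {}" for L
    proof -
      have finL: "finite L" using L K(3) finite_subset by blast
      have "measure_pmf.prob p (\<Inter>j\<in>L. A j) = measure_pmf.expectation p (indicator (\<Inter>j\<in>L. A j))" by simp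
      also have "\<dots> = measure_pmf.expectation p (\<lambda>s. \<Prod>j\<in>L. \<beta> j * X j s + \<alpha> j)"
      proof (rule integral_cong_AE)
        have "indicator (\<Inter>j\<in>L. A j) s = (\<Prod>j\<in>L. \<beta> j * X j s + \<alpha> j)" if s: "s \<in> set_pmf p" for s
        proof -
          have "indicator (\<Inter>j\<in>L. A j) s = (\<Prod>j\<in>L. indicator (A j) s :: real)"
            using finL by (induction L rule: finite_induct) (auto simp: indicator_def)
          also have "\<dots> = (\<Prod>j\<in>L. \<beta> j * X j s + \<alpha> j)"
          proof (rule prod.cong[OF refl])
            fix j assume j: "j \<in> L"
            then have "X j s = 1 \<or> X j s = -1" using X L K s by blast
            then show "indicator (A j) s = \<beta> j * X j s + \<alpha> j"
              using B j L unfolding \<alpha>_def \<beta>_def by (auto simp: indicator_def)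
          qed
          finally show ?thesis .
        qed
        then show "AE s in measure_pmf p. indicator (\<Inter>j\<in>L. A j) s = (\<Prod>j\<in>L. \<beta> j * X j s + \<alpha> j)"
          by (auto simp: AE_measure_pmf_iff)
      qed simp_all
      \<comment> \<open>Multiplying out over the subsets \<open>S\<close> of \<open>L\<close>: every
        nonempty \<open>S\<close> has mean zero, so only the product of the
        \<open>\<alpha> j\<close> survives.\<close>
      also have "\<dots> = measure_pmf.expectation p (\<lambda>s. \<Sum>S\<in>Pow L. ((\<Prod>j\<in>S. \<beta> j) * (\<Prod>j\<in>L - S. \<alpha> j)) * (\<Prod>j\<in>S. X j s))"
        using finL by (simp add: prod_add prod.distrib mult_ac)
      also have "\<dots> = (\<Sum>S\<in>Pow L. ((\<Prod>j\<in>S. \<beta> j) * (\<Prod>j\<in>L - S. \<alpha> j)) * measure_pmf.expectation p (\<lambda>s. \<Prod>j\<in>S. X j s))"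
      proof (subst Bochner_Integration.integral_sum)
        fix S assume "S \<in> Pow L"
        then show "integrable (measure_pmf p)
            (\<lambda>s. ((\<Prod>j\<in>S. \<beta> j) * (\<Prod>j\<in>L - S. \<alpha> j)) * (\<Prod>j\<in>S. X j s))"
          using int[of S] L(1) K(2) by auto
      qed simp
      also have "\<dots> = (\<Sum>S\<in>Pow L. if S = {} then (\<Prod>j\<in>L. \<alpha> j) else 0)"
      proof (rule sum.cong[OF refl])
        fix S assume "S \<in> Pow L"
        then have "S \<noteq> {} \<Longrightarrow> measure_pmf.expectation p (\<lambda>s. \<Prod>j\<in>S. X j s) = 0" using E[of S] L(1) K(2) by blast
        then show "((\<Prod>j\<in>S. \<beta> j) * (\<Prod>j\<in>L - S. \<alpha> j)) * measure_pmf.expectation p (\<lambda>s. \<Prod>j\<in>S. X j s) =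
            (if S = {} then (\<Prod>j\<in>L. \<alpha> j) else 0)" by (cases "S = {}") simp_all
      qed
      also have "\<dots> = (\<Prod>j\<in>L. \<alpha> j)" using finL by simp
      finally show ?thesis .
    qed
    \<comment> \<open>Applied to singletons, \<open>moment\<close> identifies
      \<open>\<alpha> j\<close> as the probability of \<open>A j\<close>, which turns it into the
      product rule.\<close>
    have "measure_pmf.prob p (A j) = \<alpha> j" if "j \<in> K" for j using moment[of "{j}"] that by auto
    then have "(\<Prod>j\<in>K. measure_pmf.prob p (A j)) = (\<Prod>j\<in>K. \<alpha> j)" by (intro prod.cong) auto
    then show "measure_pmf.prob p (\<Inter>j\<in>K. A j) = (\<Prod>j\<in>K. measure_pmf.prob p (A j))"
      using moment[OF subset_refl K(1)] by simp
  qed auto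
qed

section \<open>Sign families from linear codes\<close>

lemma card_small_subsets:
  "card {S. S \<subseteq> {..<N} \<and> card S \<le> q} \<le> (N + 1) ^ q"
proof (induction q)
  case 0
  have "{S. S \<subseteq> {..<N} \<and> card S \<le> 0} \<subseteq> {{}}"
    by (auto simp: finite_subset[OF _ finite_lessThan])
  then have "card {S. S \<subseteq> {..<N} \<and> card S \<le> 0} \<le> card {{} :: nat set}"
    by (intro card_mono) auto
  then show ?case by simp
next
  case (Suc q)
  let ?F = "\<lambda>q. {S. S \<subseteq> {..<N} \<and> card S \<le> q}"
  \<comment> \<open>The index \<open>N\<close> adds no element: it covers the empty set, from which
    nothing can be removed, and makes the base \<open>N + 1\<close>.\<close>
  let ?h = "\<lambda>(x, S). if x < N then insert x S else S"
  have fin: "finite (?F q)" for q by (rule finite_subset[of _ "Pow {..<N}"]) auto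
  have "?F (Suc q) \<subseteq> ?h ` ({..N} \<times> ?F q)"
  proof
    fix S assume S: "S \<in> ?F (Suc q)"
    show "S \<in> ?h ` ({..N} \<times> ?F q)"
    proof (cases "S = {}")
      case True
      then show ?thesis by (intro image_eqI[of _ _ "(N, {})"]) auto
    next
      case False
      then obtain x where x: "x \<in> S" by auto
      have "finite S" using S finite_subset by blast
      then have "card (S - {x}) \<le> q" using S x card_Diff_singleton[of x S] by auto
      then show ?thesis using S x by (intro image_eqI[of _ _ "(x, S - {x})"]) auto
    qed
  qed
  then have "card (?F (Suc q)) \<le> card ({..N} \<times> ?F q)"
    by (rule surj_card_le[rotated]) (simp add: fin)
  also have "\<dots> \<le> (N + 1) ^ Suc q" 
    using mult_le_mono2[OF Suc, of "N + 1"]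
    by (simp only: card_cartesian_product power_Suc card_atMost add.commute[of N] plus_1_eq_Suc)
  finally show ?case .
qed

text \<open>
  The greedy Gilbert--Varshamov construction: a new column only has to avoid the sums modulo 2 of
  fewer than \<open>t\<close> earlier columns.
\<close>

lemma ex_code:
  assumes t: "t > 0" and m: "(N + 1) ^ (t - 1) < 2 ^ m"
  shows "\<exists>v :: nat \<Rightarrow> nat \<Rightarrow> nat. \<forall>S \<subseteq> {..<N}. S \<noteq> {} \<longrightarrow> card S \<le> t \<longrightarrow>
           (\<exists>i<m. odd (\<Sum>u\<in>S. v u i))"
  using m
proof (induction N)
  case 0
  then show ?case by auto
next
  case (Suc N)
  have "(N + 1) ^ (t - 1) \<le> (Suc N + 1) ^ (t - 1)" by (rule power_mono) auto
  then have "(N + 1) ^ (t - 1) < 2 ^ m" using Suc.prems by simp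
  then obtain v :: "nat \<Rightarrow> nat \<Rightarrow> nat" where
    v: "\<And>S. S \<subseteq> {..<N} \<Longrightarrow> S \<noteq> {} \<Longrightarrow> card S \<le> t \<Longrightarrow> \<exists>i<m. odd (\<Sum>u\<in>S. v u i)"
    using Suc.IH by blast
  let ?F = "{S. S \<subseteq> {..<N} \<and> card S \<le> t - 1}"
  \<comment> \<open>Restriction to \<open>{..<m}\<close> makes the sums extensional, so that they
    can be counted inside the \<open>2 ^ m\<close> bit vectors of \<open>PiE\<close>.\<close>
  let ?w = "\<lambda>S. \<lambda>i\<in>{..<m}. (\<Sum>u\<in>S. v u i) mod 2"
  have finF: "finite ?F" by (rule finite_subset[of _ "Pow {..<N}"]) auto
  have "card (?w ` ?F) \<le> (N + 1) ^ (t - 1)"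
    using card_small_subsets[of N "t - 1"] card_image_le[OF finF, of ?w] by linarith
  also have "\<dots> < card (PiE {..<m} (\<lambda>_. {0, 1 :: nat}))"
    using \<open>(N + 1) ^ (t - 1) < 2 ^ m\<close> by (subst card_PiE) (auto simp: eval_nat_numeral)
  \<comment> \<open>There are fewer sums of at most \<open>t - 1\<close> old columns than bit
    vectors; any missed vector can serve as the new column.\<close>
  finally have "\<not> PiE {..<m} (\<lambda>_. {0, 1 :: nat}) \<subseteq> ?w ` ?F"
    using card_mono[OF finite_imageI[OF finF, of ?w]] by (meson not_le)
  then obtain w where w: "w \<in> PiE {..<m} (\<lambda>_. {0, 1 :: nat})" "w \<notin> ?w ` ?F" by blast
  have new: "\<exists>i<m. odd (w i + (\<Sum>u\<in>S. v u i))" if S: "S \<in> ?F" for S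
  proof (rule ccontr)
    \<comment> \<open>If all coordinates were even, \<open>w\<close> would agree modulo 2 with the
      sum over \<open>S\<close>, which it was chosen to avoid.\<close>
    assume "\<not> ?thesis"
    then have ev: "even (w i + (\<Sum>u\<in>S. v u i))" if "i < m" for i using that by blast
    have "w = ?w S"
    proof
      fix i
      show "w i = ?w S i"
      proof (cases "i < m")
        case True
        then have "w i \<in> {0, 1}" using w(1) by auto
        then show ?thesis using ev[OF True] True by (auto simp: mod2_eq_if)
      next
        case False
        then show ?thesis using PiE_arb[OF w(1), of i] by simp
      qed
    qed
    then show False using w(2) S by blast
  qed
  show ?case
  proof (intro exI[of _ "v(N := w)"] allI impI)
    fix S assume S: "S \<subseteq> {..<Suc N}" "S \<noteq> {}" "card S \<le> t"
    have fin: "finite S" using S(1) finite_subset by blast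
    show "\<exists>i<m. odd (\<Sum>u\<in>S. (v(N := w)) u i)"
    proof (cases "N \<in> S")
      case True
      define S' where "S' = S - {N}"
      have S': "S' \<subseteq> {..<N}" "N \<notin> S'" "finite S'" using S fin unfolding S'_def
        by (auto simp: less_Suc_eq)
      have "card S' \<le> t - 1" using S(3) True fin unfolding S'_def by simp
      then obtain i where "i < m" "odd (w i + (\<Sum>u\<in>S'. v u i))" using new[of S'] S' by blast
      moreover have "(\<Sum>u\<in>S. (v(N := w)) u i) = w i + (\<Sum>u\<in>S'. v u i)" for i
      proof -
        have "(\<Sum>u\<in>S. (v(N := w)) u i) = (v(N := w)) N i + (\<Sum>u\<in>S'. (v(N := w)) u i)"
          unfolding S'_def using True fin by (rule sum.remove[rotated])
        also have "(\<Sum>u\<in>S'. (v(N := w)) u i) = (\<Sum>u\<in>S'. v u i)"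
          by (rule sum.cong) (use S'(2) in auto)
        finally show ?thesis by simp
      qed
      ultimately show ?thesis by auto
    next
      case False
      then have "S \<subseteq> {..<N}" using S(1) by (auto simp: less_Suc_eq)
      moreover have "(\<Sum>u\<in>S. (v(N := w)) u i) = (\<Sum>u\<in>S. v u i)" for i
        by (rule sum.cong) (use False in auto)
      ultimately show ?thesis using v[OF _ S(2,3)] by auto
    qed
  qed
qed

text \<open>Flipping bit \<open>i\<close> of the seed changes the sign of exactly the factor
  \<open>i\<close>, because \<open>e i\<close> is odd.\<close>

lemma sum_character_seeds:
  assumes "i < m" "odd (e i)"
  shows "(\<Sum>s\<in>seeds m. \<Prod>i<m. (if s ! i then -1 else 1 :: real) ^ e i) = 0"
proof (rule sum_odd_involution[where h = "\<lambda>s. s[i := \<not> s ! i]"])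
  fix s assume s: "s \<in> seeds m"
  have *: "(\<Prod>i<m. f i) = f i * (\<Prod>i\<in>{..<m} - {i}. f i)" for f :: "nat \<Rightarrow> real"
    using assms(1) by (intro prod.remove) auto
  have "(\<Prod>j\<in>{..<m} - {i}. (if s[i := \<not> s ! i] ! j then -1 else 1 :: real) ^ e j) =
        (\<Prod>j\<in>{..<m} - {i}. (if s ! j then -1 else 1) ^ e j)"
    by (rule prod.cong) auto
  then show "(\<Prod>j<m. (if s[i := \<not> s ! i] ! j then -1 else 1 :: real) ^ e j) =
    - (\<Prod>j<m. (if s ! j then -1 else 1) ^ e j)"
    unfolding * using s assms by (simp add: seeds_def)
qed (auto simp: seeds_def nth_list_update assms list_update_beyond)

text \<open>The sign at a position is (-1) to the inner product of the seed with the code column of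
  that position. A product of at most \<open>t\<close> distinct signs is then the character of a sum
  of columns, which has an odd coordinate by \<open>ex_code\<close> and hence mean zero.\<close>

lemma ex_sign_family:
  assumes t: "t > 0" and m: "(d * l + 1) ^ (t - 1) < 2 ^ m"
  shows "\<exists>g. sign_family t d l m g"
proof -
  obtain v :: "nat \<Rightarrow> nat \<Rightarrow> nat" where
    v: "\<And>S. S \<subseteq> {..<d * l} \<Longrightarrow> S \<noteq> {} \<Longrightarrow> card S \<le> t \<Longrightarrow> \<exists>i<m. odd (\<Sum>u\<in>S. v u i)"
    using ex_code[OF assms] by blast
  define ix where "ix = (\<lambda>(r, j). r * l + j)"
  define X where "X s w = (\<Prod>i<m. (if s ! i then -1 else 1 :: real) ^ v (ix w) i)" for s w
  define D where "D = {..<d} \<times> {..<l}"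
  have inj: "inj_on ix D"
  proof (rule inj_onI, clarsimp simp: D_def ix_def)
    fix a b a' b' assume *: "b < l" "b' < l" "a * l + b = a' * l + b'"
    have "(a * l + b) div l = a" "(a' * l + b') div l = a'" using *(1,2) by auto
    then show "a = a' \<and> b = b'" using * by auto
  qed
  have img: "ix ` D \<subseteq> {..<d * l}"
  proof (clarsimp simp: D_def ix_def)
    fix a b assume "a < d" "b < l"
    then have "a * l + b < (a + 1) * l" "(a + 1) * l \<le> d * l" by (simp, intro mult_right_mono) auto
    then show "a * l + b < d * l" by linarith
  qed
  have sgn: "X s w = 1 \<or> X s w = -1" for s w
  proof -
    have "\<bar>X s w\<bar> = 1" unfolding X_def abs_prod by (rule prod.neutral) (auto simp: power_abs)
    then show ?thesis by linarith
  qed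
  have E: "measure_pmf.expectation (pmf_of_set (seeds m)) (\<lambda>s. \<Prod>w\<in>S. X s w) = 0"
    if S: "S \<subseteq> D" "S \<noteq> {}" "card S \<le> t" for S
  proof -
    have injS: "inj_on ix S" using inj S(1) inj_on_subset by blast
    have "ix ` S \<subseteq> {..<d * l}" using img S by blast
    moreover have "card (ix ` S) \<le> t" using card_image[OF injS] S(3) by simp
    ultimately obtain i where i: "i < m" "odd (\<Sum>u\<in>ix ` S. v u i)" using v[of "ix ` S"] S(2) by auto
    then have i': "odd (\<Sum>w\<in>S. v (ix w) i)" using sum.reindex[OF injS, of "\<lambda>u. v u i"] by simp
    have "(\<Prod>w\<in>S. X s w) = (\<Prod>i<m. (if s ! i then -1 else 1) ^ (\<Sum>w\<in>S. v (ix w) i))" for s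
      unfolding X_def by (subst prod.swap) (simp add: power_sum)
    then show ?thesis
      using sum_character_seeds[OF i(1), of "\<lambda>i. \<Sum>w\<in>S. v (ix w) i"] i'
      by (simp add: integral_pmf_of_set)
  qed
  have "sign_family t d l m (\<lambda>s r j. X s (r, j))"
    unfolding sign_family_def
  proof (intro conjI allI impI)
    fix r j assume "r < d" "j < l"
    then show "map_pmf (\<lambda>s. X s (r, j)) (pmf_of_set (seeds m)) = pmf_of_set {-1, 1}"
      using E[of "{(r, j)}"] sgn t by (intro uniform_sign_iff) (auto simp: D_def)
  next
    fix J assume J: "J \<subseteq> {..<d} \<times> {..<l}" "card J \<le> t"
    have fin: "finite J" using J(1) finite_subset by blast
    have "card S \<le> t" if "S \<subseteq> J" for S using card_mono[OF fin that] J(2) by simp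
    then have "prob_space.indep_vars (measure_pmf (pmf_of_set (seeds m))) (\<lambda>_. borel) (\<lambda>w s. X s w) J"
      using E J sgn fin by (intro indep_signs) (auto simp: D_def)
    then show "prob_space.indep_vars (measure_pmf (pmf_of_set (seeds m))) (\<lambda>_. borel)
        (\<lambda>(r, j) s. X s (r, j)) J"
      by (simp add: case_prod_beta')
  qed
  then show ?thesis by blast
qed

lemma ex_sign_family_log_seed:
  assumes t: "t > 0" and "d > 0" "l > 0"
  shows "\<exists>m g. sign_family t d l m g \<and> real m \<le> 2 / ln 2 * real t * ln (real (d * l + 1))"
proof -
  define N where "N = d * l + 1"
  have N: "N \<ge> 2" using assms by (auto simp: N_def Suc_le_eq)
  \<comment> \<open>As \<open>real t * log 2 (real N)\<close> is at least 1, rounding up costs at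
    most a factor 2; together with the change of base this is the \<open>2 / ln 2\<close>.\<close>
  define m where "m = nat \<lceil>real t * log 2 (real N)\<rceil>"
  have log1: "log 2 (real N) \<ge> 1" using N by (simp add: le_log_iff)
  have pos: "real t * log 2 (real N) \<ge> 1" using t log1
    using mult_mono[of 1 "real t" 1 "log 2 (real N)"] t by simp
  have m1: "real m \<le> real t * log 2 (real N) + 1" unfolding m_def using pos by linarith
  have m2: "real m \<ge> real t * log 2 (real N)" unfolding m_def using pos by linarith
  have "real (N ^ (t - 1)) < real (N ^ t)" using N t by simp
  also have "\<dots> = 2 powr (real t * log 2 (real N))"
    using N by (subst mult.commute, subst powr_powr[symmetric]) (simp add: powr_realpow)
  also have "\<dots> \<le> 2 powr real m" using m2 by simp
  also have "\<dots> = real (2 ^ m)" by (simp add: powr_realpow)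
  finally have "N ^ (t - 1) < 2 ^ m" by (simp only: of_nat_less_iff)
  then obtain g where "sign_family t d l m g" using ex_sign_family[OF t] N_def by metis
  moreover have "real m \<le> 2 * (real t * log 2 (real N))" using m1 pos by linarith
  then have "real m \<le> 2 / ln 2 * real t * ln (real (d * l + 1))"
    by (simp add: log_def N_def mult_ac)
  ultimately show ?thesis by blast
qed

section \<open>Hypercontractivity\<close>

text \<open>Induction on ratios: passing from \<open>i\<close> to \<open>i + 1\<close> multiplies
  the left binomial by the ratio of the right one times (2p - 2i - 1) / (2i + 1), which is at most
  2p - 1. Equality at i = 1 shows that the base 2p - 1 cannot be lowered.\<close>

lemma binomial_even_le:
  assumes "i \<le> p" "p \<ge> 1"
  shows "real ((2 * p) choose (2 * i)) \<le> real (2 * p - 1) ^ i * real (p choose i)"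
  using assms(1)
proof (induction i)
  case 0
  then show ?case by simp
next
  case (Suc i)
  define c where "c = real ((2 * p) choose (2 * i))"
  define c1 where "c1 = real ((2 * p) choose Suc (2 * i))"
  define c2 where "c2 = real ((2 * p) choose (2 * Suc i))"
  define b where "b = real (p choose i)"
  define b1 where "b1 = real (p choose Suc i)"
  define x where "x = real p"
  define y where "y = real i"
  define K where "K = real (2 * p - 1)"
  have xy: "y + 1 \<le> x" "0 \<le> y" using Suc.prems by (auto simp: x_def y_def)
  have K: "K = 2 * x - 1" using assms(2) by (simp add: K_def x_def of_nat_diff)
  have absorb: "real (n choose Suc k) * (real k + 1) = real (n choose k) * (real n - real k)"
    if "k \<le> n" for n k
  proof -
    have "Suc k * (n choose Suc k) = (n choose k) * (n - k)"
      by (metis binomial_absorb_comp binomial_absorption mult.commute)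
    then have "real (Suc k * (n choose Suc k)) = real ((n choose k) * (n - k))" by simp
    then show ?thesis using that by (simp add: of_nat_diff algebra_simps)
  qed
  have 1: "c1 * (2 * y + 1) = c * (2 * x - 2 * y)"
    using absorb[of "2 * i" "2 * p"] Suc.prems by (simp add: c1_def c_def x_def y_def)
  have 2: "c2 * (2 * y + 2) = c1 * (2 * x - 2 * y - 1)"
    using absorb[of "Suc (2 * i)" "2 * p"] Suc.prems
    by (simp add: c1_def c2_def x_def y_def algebra_simps)
  have 3: "b1 * (y + 1) = b * (x - y)"
    using absorb[of i p] Suc.prems by (simp add: b_def b1_def x_def y_def)
  have IH: "c \<le> K ^ i * b" using Suc by (simp add: c_def K_def b_def)
  have K0: "K \<ge> 0" "K ^ i \<ge> 0" by (auto simp: K_def)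
  have b1: "b1 \<ge> 0" "c2 \<ge> 0" by (auto simp: b1_def c2_def)
  have "c2 * (2 * y + 2) * (2 * y + 1) = c * (2 * x - 2 * y) * (2 * x - 2 * y - 1)"
    using 1 2 by (metis mult.assoc mult.commute)
  also have "\<dots> \<le> K ^ i * b * (2 * x - 2 * y) * (2 * x - 2 * y - 1)"
    using IH xy by (intro mult_right_mono) auto
  also have "\<dots> = K ^ i * (b * (x - y)) * 2 * (2 * x - 2 * y - 1)"
    by (simp add: algebra_simps)
  also have "\<dots> = K ^ i * b1 * (2 * y + 2) * (2 * x - 2 * y - 1)"
    unfolding 3[symmetric] by (simp add: algebra_simps)
  also have "\<dots> \<le> K ^ i * b1 * (2 * y + 2) * (K * (2 * y + 1))"
  proof (rule mult_left_mono)
    have "K * 1 \<le> K * (2 * y + 1)" using K0 xy by (intro mult_left_mono) auto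
    then show "2 * x - 2 * y - 1 \<le> K * (2 * y + 1)" using K xy by linarith
  qed (use K0 b1 xy in auto)
  finally have "c2 * ((2 * y + 2) * (2 * y + 1)) \<le> (K ^ Suc i * b1) * ((2 * y + 2) * (2 * y + 1))"
    by (simp add: mult_ac)
  then have "c2 \<le> K ^ Suc i * b1"
    using xy by (subst (asm) mult_le_cancel_right_pos) auto
  then show ?case by (simp only: c2_def K_def b1_def)
qed

lemma sum_atMost_double_even:
  fixes f :: "nat \<Rightarrow> real"
  assumes "\<And>i. odd i \<Longrightarrow> f i = 0"
  shows "(\<Sum>i\<le>2 * p. f i) = (\<Sum>i\<le>p. f (2 * i))"
proof (induction p)
  case (Suc p)
  have "(\<Sum>i\<le>2 * Suc p. f i) = (\<Sum>i\<le>2 * p. f i) + f (Suc (2 * p)) + f (2 * Suc p)"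
    by simp
  then show ?case using Suc assms by simp
qed simp

text \<open>Bonami's two-point inequality: the odd powers of \<open>h\<close> cancel between the two
  signs, and the even ones are compared term by term with the binomial expansion on the right by
  \<open>binomial_even_le\<close>.\<close>

lemma two_point_inequality:
  fixes g h :: real
  assumes p: "p \<ge> 1"
  shows "(g + h) ^ (2 * p) + (g - h) ^ (2 * p) \<le> 2 * (g\<^sup>2 + real (2 * p - 1) * h\<^sup>2) ^ p"
proof -
  define f where "f i = real ((2 * p) choose i) * (h ^ i + (- h) ^ i) * g ^ (2 * p - i)" for i
  have "(g + h) ^ (2 * p) + (g - h) ^ (2 * p) = (h + g) ^ (2 * p) + (- h + g) ^ (2 * p)"
    by (simp add: add.commute)
  also have "\<dots> = (\<Sum>i\<le>2 * p. f i)"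
    unfolding binomial_ring f_def sum.distrib[symmetric] by (simp add: algebra_simps)
  also have "\<dots> = (\<Sum>i\<le>p. f (2 * i))"
    by (rule sum_atMost_double_even) (auto simp: f_def power_minus_odd)
  also have "\<dots> \<le> (\<Sum>i\<le>p. 2 * (real (p choose i) * (real (2 * p - 1) * h\<^sup>2) ^ i * (g\<^sup>2) ^ (p - i)))"
  proof (rule sum_mono)
    fix i assume "i \<in> {..p}"
    then have i: "i \<le> p" by simp
    have "f (2 * i) = 2 * (real ((2 * p) choose (2 * i)) * ((h\<^sup>2) ^ i * (g\<^sup>2) ^ (p - i)))"
      using i by (simp add: f_def power_mult[symmetric] right_diff_distrib')
    also have "\<dots> \<le> 2 * ((real (2 * p - 1) ^ i * real (p choose i)) * ((h\<^sup>2) ^ i * (g\<^sup>2) ^ (p - i)))"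
      using binomial_even_le[OF i p] by (intro mult_left_mono mult_right_mono) auto
    finally show "f (2 * i) \<le> 2 * (real (p choose i) * (real (2 * p - 1) * h\<^sup>2) ^ i * (g\<^sup>2) ^ (p - i))"
      by (simp add: power_mult_distrib mult_ac)
  qed
  also have "\<dots> = 2 * (g\<^sup>2 + real (2 * p - 1) * h\<^sup>2) ^ p"
    unfolding add.commute[of "g\<^sup>2"] binomial_ring by (simp add: sum_distrib_left mult_ac)
  finally show ?thesis .
qed

section \<open>Minkowski's inequality for sums of \<open>p\<close>-th powers\<close>

lemma convex_power_nonneg: "convex_on {0::real..} (\<lambda>x. x ^ n)"
  using convex_power_even[of n] convex_power_odd[of n]
  by (cases "even n") (auto intro: convex_on_subset)

text \<open>Root-free form: the hypotheses say that the L^p norms, normalised by the mass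
  \<open>W\<close>, are at most \<open>b1\<close> and \<open>b2\<close>. After division by
  \<open>b1 + b2\<close> the sum is a convex combination of q1 / b1 and q2 / b2, and convexity of
  the power is applied pointwise.\<close>

lemma minkowski2_power:
  fixes q1 q2 :: "'a \<Rightarrow> real"
  assumes fin: "finite A" and p: "p \<ge> 1"
    and q: "\<And>x. x \<in> A \<Longrightarrow> q1 x \<ge> 0" "\<And>x. x \<in> A \<Longrightarrow> q2 x \<ge> 0"
    and b: "b1 \<ge> 0" "b2 \<ge> 0"
    and W1: "(\<Sum>x\<in>A. q1 x ^ p) \<le> W * b1 ^ p" and W2: "(\<Sum>x\<in>A. q2 x ^ p) \<le> W * b2 ^ p"
  shows "(\<Sum>x\<in>A. (q1 x + q2 x) ^ p) \<le> W * (b1 + b2) ^ p"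
proof -
  \<comment> \<open>A zero bound cannot be divided by; it forces the function to vanish on
    \<open>A\<close>, and the other hypothesis is then the claim.\<close>
  have vanish: "q x = 0" if "(\<Sum>x\<in>A. q x ^ p) \<le> W * 0 ^ p" "\<And>x. x \<in> A \<Longrightarrow> q x \<ge> 0" "x \<in> A"
    for q :: "'a \<Rightarrow> real" and x
  proof -
    have "(\<Sum>x\<in>A. q x ^ p) = 0"
      using that(1,2) p by (intro antisym sum_nonneg) (auto simp: power_0_left)
    then have "q x ^ p = 0" using fin that(2,3) by (subst (asm) sum_nonneg_eq_0_iff) auto
    then show ?thesis by simp
  qed
  consider "b1 = 0" | "b2 = 0" | "b1 > 0" "b2 > 0" using b by linarith
  then show ?thesis
  proof cases
    case 1
    then show ?thesis using W2 vanish[of q1] W1 q(1) by simp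
  next
    case 2
    then show ?thesis using W1 vanish[of q2] W2 q(2) by simp
  next
    case 3
    define B where "B = b1 + b2"
    have B: "B > 0" using 3 by (simp add: B_def)
    have "(q1 x + q2 x) ^ p \<le> B ^ p * (b1 / B * (q1 x ^ p / b1 ^ p) + b2 / B * (q2 x ^ p / b2 ^ p))"
      if x: "x \<in> A" for x
    proof -
      have "(q1 x + q2 x) / B = b2 / B * (q2 x / b2) + b1 / B * (q1 x / b1)"
        using 3 by (simp add: add_divide_distrib)
      moreover have "b2 / B = 1 - b1 / B" using B by (simp add: B_def field_simps)
      ultimately have "((q1 x + q2 x) / B) ^ p = ((1 - b1 / B) *\<^sub>R (q2 x / b2) + (b1 / B) *\<^sub>R (q1 x / b1)) ^ p"
        by simp
      also have "\<dots> \<le> (1 - b1 / B) * (q2 x / b2) ^ p + b1 / B * (q1 x / b1) ^ p"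
        using 3 B q x b by (intro convex_onD[OF convex_power_nonneg]) (auto simp: B_def)
      finally have "((q1 x + q2 x) / B) ^ p \<le> b2 / B * (q2 x / b2) ^ p + b1 / B * (q1 x / b1) ^ p"
        using \<open>b2 / B = 1 - b1 / B\<close> by simp
      then have "B ^ p * ((q1 x + q2 x) / B) ^ p \<le> B ^ p * (b2 / B * (q2 x / b2) ^ p + b1 / B * (q1 x / b1) ^ p)"
        using B by (intro mult_left_mono) auto
      moreover have "B ^ p * ((q1 x + q2 x) / B) ^ p = (q1 x + q2 x) ^ p"
        using B by (simp add: power_divide)
      ultimately show ?thesis by (simp add: power_divide add.commute)
    qed
    then have "(\<Sum>x\<in>A. (q1 x + q2 x) ^ p) \<le>
        (\<Sum>x\<in>A. B ^ p * (b1 / B * (q1 x ^ p / b1 ^ p) + b2 / B * (q2 x ^ p / b2 ^ p)))"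
      by (rule sum_mono)
    also have "\<dots> = B ^ p * (b1 / B * ((\<Sum>x\<in>A. q1 x ^ p) / b1 ^ p) + b2 / B * ((\<Sum>x\<in>A. q2 x ^ p) / b2 ^ p))"
      by (simp add: sum_distrib_left[symmetric] sum.distrib sum_divide_distrib[symmetric])
    also have "\<dots> \<le> B ^ p * (b1 / B * W + b2 / B * W)"
      using W1 W2 3 B by (intro mult_left_mono add_mono) (auto simp: field_simps)
    also have "b1 / B * W + b2 / B * W = W"
      using B by (simp add: B_def add_divide_distrib[symmetric] distrib_right[symmetric])
    finally show ?thesis by (simp add: B_def mult.commute)
  qed
qed

lemma minkowski_power:
  fixes q :: "'i \<Rightarrow> 'a \<Rightarrow> real"
  assumes fin: "finite A" "finite I" and p: "p \<ge> 1"
    and q: "\<And>i x. i \<in> I \<Longrightarrow> x \<in> A \<Longrightarrow> q i x \<ge> 0"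
    and b: "\<And>i. i \<in> I \<Longrightarrow> b i \<ge> 0"
    and W: "\<And>i. i \<in> I \<Longrightarrow> (\<Sum>x\<in>A. q i x ^ p) \<le> W * b i ^ p"
  shows "(\<Sum>x\<in>A. (\<Sum>i\<in>I. q i x) ^ p) \<le> W * (\<Sum>i\<in>I. b i) ^ p"
  using fin(2) q b W
proof (induction I rule: finite_induct)
  case empty
  then show ?case using p by (simp add: power_0_left)
next
  case (insert i I)
  have "(\<Sum>x\<in>A. (q i x + (\<Sum>i\<in>I. q i x)) ^ p) \<le> W * (b i + (\<Sum>i\<in>I. b i)) ^ p"
    using insert by (intro minkowski2_power fin p) (auto intro!: sum_nonneg)
  then show ?case using insert by simp
qed

text \<open>Walsh function on the discrete cube; a point of the cube is encoded by the set
  \<open>X\<close> of coordinates that equal -1.\<close>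

definition character :: "'u set \<Rightarrow> 'u set \<Rightarrow> real" where
  "character S X = (\<Prod>u\<in>S. if u \<in> X then -1 else 1)"

lemma character_empty [simp]: "character {} X = 1"
  by (simp add: character_def)

lemma character_insert:
  assumes "finite S" "u \<notin> S"
  shows "character (insert u S) X = (if u \<in> X then -1 else 1) * character S X"
  using assms by (simp add: character_def)

lemma character_insert_right:
  assumes "u \<notin> S"
  shows "character S (insert u X) = character S X"
  unfolding character_def by (rule prod.cong) (use assms in auto)

lemma character_square [simp]: "character S X * character S X = 1"
  unfolding character_def prod.distrib[symmetric] by (rule prod.neutral) auto

lemma character_mult:
  assumes "finite S" "finite T"
  shows "character S X * character T X = character (sym_diff S T) X"
proof -
  have "character S X = character (S - T) X * character (S \<inter> T) X"
    unfolding character_def using prod.Int_Diff[OF assms(1), of _ T] by (simp add: mult.commute)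
  moreover have "character T X = character (T - S) X * character (S \<inter> T) X"
    unfolding character_def using prod.Int_Diff[OF assms(2), of _ S]
    by (simp add: mult.commute Int_commute)
  moreover have "character (sym_diff S T) X = character (S - T) X * character (T - S) X"
    unfolding character_def using assms by (intro prod.union_disjoint) auto
  moreover have "character (S - T) X * character (S \<inter> T) X * (character (T - S) X * character (S \<inter> T) X)
      = character (S - T) X * character (T - S) X * (character (S \<inter> T) X * character (S \<inter> T) X)"
    by (simp only: mult_ac)
  ultimately show ?thesis by simp
qed

lemma sum_Pow_insert:
  fixes f :: "'u set \<Rightarrow> real"
  assumes "finite N" "u \<notin> N"
  shows "(\<Sum>S\<in>Pow (insert u N). f S) = (\<Sum>S\<in>Pow N. f S + f (insert u S))"
proof -
  have inj: "inj_on (insert u) (Pow N)" using assms(2) by (auto simp: inj_on_def)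
  have "(\<Sum>S\<in>Pow (insert u N). f S) = (\<Sum>S\<in>Pow N. f S) + (\<Sum>S\<in>insert u ` Pow N. f S)"
    unfolding Pow_insert using assms by (intro sum.union_disjoint) auto
  then show ?thesis by (simp add: sum.reindex[OF inj] sum.distrib)
qed

text \<open>
  The weight \<open>(2 p - 1)\<close> per variable, instead of a bound on the degree, is what lets the induction on
  the number of variables close.
\<close>

lemma bonami:
  fixes c :: "'u set \<Rightarrow> real"
  assumes "finite N" and p: "p \<ge> 1"
  shows "(\<Sum>X\<in>Pow N. (\<Sum>S\<in>Pow N. c S * character S X) ^ (2 * p)) \<le>
    2 ^ card N * (\<Sum>S\<in>Pow N. real (2 * p - 1) ^ card S * (c S)\<^sup>2) ^ p"
  using assms(1)
proof (induction N arbitrary: c rule: finite_induct)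
  case empty
  then show ?case by (simp add: power_mult[symmetric])
next
  case (insert u N)
  define K where "K = real (2 * p - 1)"
  have K: "K \<ge> 0" by (simp add: K_def)
  \<comment> \<open>Split off the variable \<open>u\<close>: the polynomial equals
    \<open>g + h\<close> where its sign is 1 and \<open>g - h\<close> where it is -1, with
    \<open>g\<close> and \<open>h\<close> free of \<open>u\<close>.\<close>
  define g where "g X = (\<Sum>S\<in>Pow N. c S * character S X)" for X
  define h where "h X = (\<Sum>S\<in>Pow N. c (insert u S) * character S X)" for X
  define G where "G = (\<Sum>S\<in>Pow N. K ^ card S * (c S)\<^sup>2)"
  define H where "H = (\<Sum>S\<in>Pow N. K ^ card S * (c (insert u S))\<^sup>2)"
  have GH: "G \<ge> 0" "H \<ge> 0" unfolding G_def H_def using K by (auto intro!: sum_nonneg)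
  have fin: "finite S" "u \<notin> S" if "S \<in> Pow N" for S
    using that insert.hyps finite_subset by auto
  have plus: "(\<Sum>S\<in>Pow (insert u N). c S * character S X) = g X + h X" if "X \<in> Pow N" for X
  proof -
    have "u \<notin> X" using that insert.hyps by auto
    then show ?thesis
      unfolding g_def h_def sum_Pow_insert[OF insert.hyps] sum.distrib[symmetric]
      using fin by (intro sum.cong) (auto simp: character_insert)
  qed
  have minus: "(\<Sum>S\<in>Pow (insert u N). c S * character S (insert u X)) = g X - h X" if "X \<in> Pow N" for X
    unfolding g_def h_def sum_Pow_insert[OF insert.hyps] sum_subtractf[symmetric]
    using fin by (intro sum.cong) (auto simp: character_insert character_insert_right)
  have "(\<Sum>X\<in>Pow (insert u N). (\<Sum>S\<in>Pow (insert u N). c S * character S X) ^ (2 * p)) =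
      (\<Sum>X\<in>Pow N. (g X + h X) ^ (2 * p) + (g X - h X) ^ (2 * p))"
    unfolding sum_Pow_insert[OF insert.hyps, of "\<lambda>X. (\<Sum>S\<in>Pow (insert u N). c S * character S X) ^ (2 * p)"]
    by (intro sum.cong refl) (simp only: plus minus)
  also have "\<dots> \<le> (\<Sum>X\<in>Pow N. 2 * ((g X)\<^sup>2 + K * (h X)\<^sup>2) ^ p)"
    unfolding K_def by (intro sum_mono two_point_inequality p)
  also have "\<dots> = 2 * (\<Sum>X\<in>Pow N. ((g X)\<^sup>2 + K * (h X)\<^sup>2) ^ p)" by (simp add: sum_distrib_left)
  \<comment> \<open>Minkowski with exponent \<open>p\<close> for the two squares combines the
    induction hypotheses of \<open>g\<close> and \<open>h\<close>; the factor \<open>K\<close> of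
    \<open>h\<close> becomes the additional weight of the sets that contain
    \<open>u\<close>.\<close>
  also have "(\<Sum>X\<in>Pow N. ((g X)\<^sup>2 + K * (h X)\<^sup>2) ^ p) \<le> 2 ^ card N * (G + K * H) ^ p"
  proof (rule minkowski2_power)
    show "(\<Sum>X\<in>Pow N. ((g X)\<^sup>2) ^ p) \<le> 2 ^ card N * G ^ p"
      using insert.IH[of c] by (simp add: g_def G_def K_def power_mult)
    have "(\<Sum>X\<in>Pow N. ((h X)\<^sup>2) ^ p) \<le> 2 ^ card N * H ^ p"
      using insert.IH[of "\<lambda>S. c (insert u S)"] by (simp add: h_def H_def K_def power_mult)
    then have "K ^ p * (\<Sum>X\<in>Pow N. ((h X)\<^sup>2) ^ p) \<le> K ^ p * (2 ^ card N * H ^ p)"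
      using K by (intro mult_left_mono) auto
    then show "(\<Sum>X\<in>Pow N. (K * (h X)\<^sup>2) ^ p) \<le> 2 ^ card N * (K * H) ^ p"
      by (simp add: power_mult_distrib sum_distrib_left mult_ac)
  qed (use insert.hyps p K GH in auto)
  also have "G + K * H = (\<Sum>S\<in>Pow (insert u N). K ^ card S * (c S)\<^sup>2)"
    unfolding G_def H_def sum_Pow_insert[OF insert.hyps] sum_distrib_left sum.distrib[symmetric]
    using fin by (intro sum.cong) auto
  finally show ?case using insert.hyps by (simp add: K_def)
qed

section \<open>Limited independence suffices for low-degree moments\<close>

text \<open>Walsh polynomials of degree at most \<open>D\<close>, generated as functions: products
  and powers follow by rule induction, without tracking coefficients through cancellations.\<close>

inductive low_degree :: "'u set \<Rightarrow> nat \<Rightarrow> ('u set \<Rightarrow> real) \<Rightarrow> bool" for N where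
  monomial: "S \<subseteq> N \<Longrightarrow> card S \<le> D \<Longrightarrow> low_degree N D (\<lambda>X. a * character S X)"
| add: "low_degree N D f \<Longrightarrow> low_degree N D g \<Longrightarrow> low_degree N D (\<lambda>X. f X + g X)"

lemma low_degree_sum:
  assumes "finite I" "\<And>i. i \<in> I \<Longrightarrow> low_degree N D (f i)"
  shows "low_degree N D (\<lambda>X. \<Sum>i\<in>I. f i X)"
  using assms
proof (induction I rule: finite_induct)
  case empty
  then show ?case using low_degree.monomial[of "{}" N D 0] by simp
next
  case (insert i I)
  then show ?case using low_degree.add[of N D "f i"] by simp
qed

text \<open>Characters multiply by taking the symmetric difference of their index sets, whose size
  is at most the sum of the two sizes.\<close>

lemma low_degree_mult:
  assumes "finite N" "low_degree N D f" "low_degree N E g"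
  shows "low_degree N (D + E) (\<lambda>X. f X * g X)"
  using assms(2)
proof (induction D f rule: low_degree.induct)
  case (monomial S D a)
  note S = monomial
  from assms(3) show ?case
  proof (induction E g rule: low_degree.induct)
    case (monomial T E b)
    have fin: "finite S" "finite T" using S monomial assms(1) finite_subset by auto
    have "card (sym_diff S T) \<le> card (S - T) + card (T - S)" by (rule card_Un_le)
    also have "\<dots> \<le> D + E"
      using S monomial fin by (intro add_mono) (meson card_mono Diff_subset le_trans)+
    finally have "low_degree N (D + E) (\<lambda>X. (a * b) * character (sym_diff S T) X)"
      using S monomial by (intro low_degree.monomial) auto
    then show ?case using fin by (simp add: character_mult[symmetric] mult_ac)
  next
    case (add E f g)
    then show ?case using low_degree.add by (fastforce simp: distrib_left)
  qed
next
  case (add D f g)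
  then show ?case using low_degree.add by (fastforce simp: distrib_right)
qed

lemma low_degree_power:
  assumes "finite N" "low_degree N D f"
  shows "low_degree N (D * n) (\<lambda>X. f X ^ n)"
proof (induction n)
  case 0
  then show ?case using low_degree.monomial[of "{}" N 0 1] by simp
next
  case (Suc n)
  then show ?case using low_degree_mult[OF assms(1,2) Suc] by simp
qed

text \<open>Toggling a fixed point \<open>u\<close> of \<open>S\<close> in \<open>X\<close> reverses
  the sign.\<close>

lemma sum_character_Pow:
  assumes "finite N" "S \<subseteq> N" "S \<noteq> {}"
  shows "(\<Sum>X\<in>Pow N. character S X) = 0"
proof -
  obtain u where u: "u \<in> S" using assms(3) by auto
  have S: "S = insert u (S - {u})" "finite (S - {u})" "u \<notin> S - {u}"
    using u assms finite_subset by auto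
  have c: "character S X = (if u \<in> X then -1 else 1) * character (S - {u}) X" for X
    using character_insert[OF S(2,3), of X] S(1) by simp
  show ?thesis
  proof (rule sum_odd_involution[where h = "\<lambda>X. if u \<in> X then X - {u} else insert u X"])
    fix X assume "X \<in> Pow N"
    have "character (S - {u}) (X - {u}) = character (S - {u}) X" if "u \<in> X"
      using character_insert_right[OF S(3), of "X - {u}"] that by (simp add: insert_absorb)
    moreover have "character (S - {u}) (insert u X) = character (S - {u}) X"
      by (rule character_insert_right[OF S(3)])
    ultimately show "character S (if u \<in> X then X - {u} else insert u X) = - character S X"
      unfolding c by auto
  qed (use u assms(2) in auto)
qed

text \<open>\<open>Y\<close> stands for a \<open>t\<close>-wise independent random point of the
  cube. By linearity it suffices to compare characters: the nonempty ones of size at most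
  \<open>t\<close> sum to zero on both sides, and the empty one counts points. The equality of the
  two means is multiplied out.\<close>

lemma low_degree_sum_eq:
  assumes N: "finite N"
    and Y: "\<And>S. S \<subseteq> N \<Longrightarrow> S \<noteq> {} \<Longrightarrow> card S \<le> t \<Longrightarrow> (\<Sum>s\<in>A. character S (Y s)) = 0"
    and "low_degree N D f" "D \<le> t"
  shows "2 ^ card N * (\<Sum>s\<in>A. f (Y s)) = real (card A) * (\<Sum>X\<in>Pow N. f X)"
  using assms(3,4)
proof (induction D f rule: low_degree.induct)
  case (monomial S D a)
  show ?case
  proof (cases "S = {}")
    case True
    then show ?thesis using N by (simp add: card_Pow)
  next
    case False
    then show ?thesis using Y[of S] sum_character_Pow[OF N, of S] monomial
      by (simp add: sum_distrib_left[symmetric])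
  qed
next
  case (add D f g)
  then show ?case by (simp add: sum.distrib distrib_left)
qed

text \<open>The power \<open>2 * p\<close> of a form of degree \<open>D\<close> has degree
  \<open>2 * p * D\<close>, within reach of \<open>t\<close>, so its mean may be taken over the
  whole cube, where \<open>bonami\<close> applies.\<close>

lemma limited_independence_moment:
  fixes c :: "'i \<Rightarrow> real"
  assumes N: "finite N" and p: "p \<ge> 1" and I: "finite I" "inj_on S I"
    and S: "\<And>i. i \<in> I \<Longrightarrow> S i \<subseteq> N" "\<And>i. i \<in> I \<Longrightarrow> card (S i) = D"
    and Y: "\<And>S. S \<subseteq> N \<Longrightarrow> S \<noteq> {} \<Longrightarrow> card S \<le> t \<Longrightarrow> (\<Sum>s\<in>A. character S (Y s)) = 0"
    and t: "2 * p * D \<le> t"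
  shows "(\<Sum>s\<in>A. (\<Sum>i\<in>I. c i * character (S i) (Y s)) ^ (2 * p)) \<le>
    real (card A) * (real (2 * p - 1) ^ D * (\<Sum>i\<in>I. (c i)\<^sup>2)) ^ p"
proof -
  define f where "f X = (\<Sum>i\<in>I. c i * character (S i) X)" for X
  \<comment> \<open>\<open>bonami\<close> takes coefficients indexed by all subsets of
    \<open>N\<close>; injectivity of \<open>S\<close> allows the given ones to be transported and
    extended by zero.\<close>
  define a where "a T = (if T \<in> S ` I then c (the_inv_into I S T) else 0)" for T
  have aS: "a (S i) = c i" if "i \<in> I" for i
    using that I by (simp add: a_def the_inv_into_f_f)
  have sub: "S ` I \<subseteq> Pow N" using S by auto
  have a: "(\<Sum>T\<in>Pow N. F T (a T)) = (\<Sum>i\<in>I. F (S i) (c i))" if "\<And>T. F T 0 = 0" for F :: "_ \<Rightarrow> _ \<Rightarrow> real"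
  proof -
    have "(\<Sum>T\<in>Pow N. F T (a T)) = (\<Sum>T\<in>S ` I. F T (a T))"
      using N sub that by (intro sum.mono_neutral_right) (auto simp: a_def)
    also have "\<dots> = (\<Sum>i\<in>I. F (S i) (c i))"
      using aS by (simp add: sum.reindex[OF I(2)])
    finally show ?thesis .
  qed
  have f: "f X = (\<Sum>T\<in>Pow N. a T * character T X)" for X
    using a[of "\<lambda>T x. x * character T X"] by (simp add: f_def)
  have "low_degree N D f"
    unfolding f_def using I S by (intro low_degree_sum low_degree.monomial) auto
  then have "low_degree N (D * (2 * p)) (\<lambda>X. f X ^ (2 * p))" by (rule low_degree_power[OF N])
  then have "2 ^ card N * (\<Sum>s\<in>A. f (Y s) ^ (2 * p)) = real (card A) * (\<Sum>X\<in>Pow N. f X ^ (2 * p))"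
    using t by (intro low_degree_sum_eq[OF N Y]) (auto simp: mult_ac)
  also have "\<dots> \<le> real (card A) * (2 ^ card N * (\<Sum>T\<in>Pow N. real (2 * p - 1) ^ card T * (a T)\<^sup>2) ^ p)"
    unfolding f by (intro mult_left_mono bonami N p) simp
  also have "(\<Sum>T\<in>Pow N. real (2 * p - 1) ^ card T * (a T)\<^sup>2) = real (2 * p - 1) ^ D * (\<Sum>i\<in>I. (c i)\<^sup>2)"
    using a[of "\<lambda>T x. real (2 * p - 1) ^ card T * x\<^sup>2"] S(2) by (simp add: sum_distrib_left)
  finally have "2 ^ card N * (\<Sum>s\<in>A. f (Y s) ^ (2 * p)) \<le>
      2 ^ card N * (real (card A) * (real (2 * p - 1) ^ D * (\<Sum>i\<in>I. (c i)\<^sup>2)) ^ p)"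
    by (simp add: mult_ac)
  then show ?thesis unfolding f_def by simp
qed

section \<open>The sketched Gram matrix concentrates\<close>

lemma sum_pairs:
  fixes f :: "nat \<Rightarrow> nat \<Rightarrow> real"
  shows "(\<Sum>r<d. \<Sum>r'<d. f r r') = (\<Sum>r<d. f r r) + (\<Sum>(r, r')\<in>{(r, r'). r < r' \<and> r' < d}. f r r' + f r' r)"
proof (induction d)
  case (Suc d)
  let ?P = "\<lambda>d. {(r, r'). r < r' \<and> r' < (d :: nat)}"
  have P: "?P (Suc d) = ?P d \<union> (\<lambda>r. (r, d)) ` {..<d}" by (auto simp: less_Suc_eq)
  have fin: "finite (?P d)" by (rule finite_subset[of _ "{..<d} \<times> {..<d}"]) auto
  have "(\<Sum>(r, r')\<in>?P (Suc d). f r r' + f r' r) =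
      (\<Sum>(r, r')\<in>?P d. f r r' + f r' r) + (\<Sum>(r, r')\<in>(\<lambda>r. (r, d)) ` {..<d}. f r r' + f r' r)"
    unfolding P using fin by (intro sum.union_disjoint) auto
  also have "(\<Sum>(r, r')\<in>(\<lambda>r. (r, d)) ` {..<d}. f r r' + f r' r) = (\<Sum>r<d. f r d + f d r)"
    by (subst sum.reindex) (auto simp: inj_on_def)
  finally show ?case using Suc by (simp add: sum.distrib)
qed simp

text \<open>With \<open>E\<close> the entries of R and \<open>a\<close>, \<open>b\<close> two rows
  of A, this is an entry of A R R^T A^T - A A^T.\<close>

definition gram_error :: "nat \<Rightarrow> nat \<Rightarrow> (nat \<Rightarrow> nat \<Rightarrow> real) \<Rightarrow> (nat \<Rightarrow> real) \<Rightarrow> (nat \<Rightarrow> real) \<Rightarrow> real" where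
  "gram_error d l E a b =
     (\<Sum>c<l. (\<Sum>r<d. E r c * a r) * (\<Sum>r<d. E r c * b r)) - (\<Sum>r<d. a r * b r)"

text \<open>The sign matrix as a point of the cube in the encoding of
  \<open>character\<close>.\<close>

definition neg_set :: "nat \<Rightarrow> nat \<Rightarrow> (bool list \<Rightarrow> nat \<Rightarrow> nat \<Rightarrow> real) \<Rightarrow> bool list \<Rightarrow> (nat \<times> nat) set" where
  "neg_set d l g s = {(r, c). r < d \<and> c < l \<and> g s r c = -1}"

lemma sign_family_values:
  assumes "sign_family t d l m g" "s \<in> seeds m" "r < d" "j < l"
  shows "g s r j = 1 \<or> g s r j = -1"
proof -
  have "set_pmf (map_pmf (\<lambda>s. g s r j) (pmf_of_set (seeds m))) = {-1, 1}"
    using assms unfolding sign_family_def by simp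
  then have "(\<lambda>s. g s r j) ` seeds m = {-1, 1}" by simp
  then show ?thesis using assms(2) by blast
qed

lemma sign_family_character:
  assumes "sign_family t d l m g" "s \<in> seeds m" "S \<subseteq> {..<d} \<times> {..<l}"
  shows "(\<Prod>(r, j)\<in>S. g s r j) = character S (neg_set d l g s)"
  unfolding character_def
proof (rule prod.cong[OF refl], clarify)
  fix r j assume "(r, j) \<in> S"
  then have "r < d" "j < l" using assms(3) by auto
  then show "g s r j = (if (r, j) \<in> neg_set d l g s then -1 else 1)"
    using sign_family_values[OF assms(1,2)] by (auto simp: neg_set_def)
qed

text \<open>Independence turns the mean of the product into a product of zero means. This converts
  the probabilistic \<open>sign_family\<close> into the counting hypothesis of
  \<open>low_degree_sum_eq\<close>.\<close>

lemma sign_family_sum_character: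
  assumes g: "sign_family t d l m g" and S: "S \<subseteq> {..<d} \<times> {..<l}" "S \<noteq> {}" "card S \<le> t"
  shows "(\<Sum>s\<in>seeds m. character S (neg_set d l g s)) = 0"
proof -
  let ?M = "pmf_of_set (seeds m)"
  have fin: "finite S" using S(1) finite_subset by blast
  have "prob_space.indep_vars (measure_pmf ?M) (\<lambda>_. borel) (\<lambda>(r, j) s. g s r j) S"
    using g S unfolding sign_family_def by blast
  then have "measure_pmf.expectation ?M (\<lambda>s. \<Prod>w\<in>S. (\<lambda>(r, j) s. g s r j) w s) =
      (\<Prod>w\<in>S. measure_pmf.expectation ?M ((\<lambda>(r, j) s. g s r j) w))"
    by (intro prob_space.indep_vars_lebesgue_integral[OF measure_pmf.prob_space_axioms] fin
        integrable_measure_pmf_finite) auto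
  also have "\<dots> = (\<Prod>w\<in>S. 0)"
  proof (rule prod.cong[OF refl], clarify)
    fix r j assume "(r, j) \<in> S"
    then have "map_pmf (\<lambda>s. g s r j) ?M = pmf_of_set {-1, 1}"
      using S(1) g unfolding sign_family_def by blast
    moreover have "measure_pmf.expectation (map_pmf (\<lambda>s. g s r j) ?M) (\<lambda>x. x) =
        measure_pmf.expectation ?M (\<lambda>s. g s r j)"
      by (rule integral_map_pmf)
    ultimately have "measure_pmf.expectation ?M (\<lambda>s. g s r j) =
        measure_pmf.expectation (pmf_of_set {-1, 1}) (\<lambda>x. x :: real)"
      by (simp only:)
    then show "measure_pmf.expectation ?M (\<lambda>s. g s r j) = 0" by (simp add: integral_pmf_of_set)
  qed
  also have "\<dots> = 0" using S(2) fin by (simp add: card_gt_0_iff)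
  finally have "(\<Sum>s\<in>seeds m. \<Prod>(r, j)\<in>S. g s r j) = 0"
    by (simp add: integral_pmf_of_set case_prod_beta')
  then show ?thesis using sign_family_character[OF g _ S(1)] by simp
qed

text \<open>The diagonal terms are not random: squared entries are 1 / l, and the \<open>l\<close>
  columns together reproduce exactly the inner product that is subtracted. What is left is a
  homogeneous form of degree 2, indexed by a column and a pair of rows of the projection
  matrix.\<close>

lemma gram_error_expansion:
  assumes g: "sign_family t d l m g" and s: "s \<in> seeds m" and l: "l > 0"
  shows "gram_error d l (proj_entry l g s) a b =
    (\<Sum>(c, r, r')\<in>{..<l} \<times> {(r, r'). r < r' \<and> r' < d}.
       (a r * b r' + a r' * b r) / real l * character {(r, c), (r', c)} (neg_set d l g s))"
proof -
  have sq: "proj_entry l g s r c * proj_entry l g s r c = 1 / real l" if "r < d" "c < l" for r c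
    using sign_family_values[OF g s that] l by (auto simp: proj_entry_def field_simps)
  have "(\<Sum>c<l. (\<Sum>r<d. proj_entry l g s r c * a r) * (\<Sum>r<d. proj_entry l g s r c * b r)) =
      (\<Sum>c<l. \<Sum>r<d. \<Sum>r'<d. proj_entry l g s r c * proj_entry l g s r' c * (a r * b r'))"
    by (simp add: sum_product mult_ac)
  also have "\<dots> = (\<Sum>c<l. (\<Sum>r<d. 1 / real l * (a r * b r)) +
      (\<Sum>(r, r')\<in>{(r, r'). r < r' \<and> r' < d}.
         (a r * b r' + a r' * b r) / real l * character {(r, c), (r', c)} (neg_set d l g s)))"
  proof (rule sum.cong[OF refl])
    fix c assume "c \<in> {..<l}"
    then have c: "c < l" by simp
    have "(\<Sum>(r, r')\<in>{(r, r'). r < r' \<and> r' < d}.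
          proj_entry l g s r c * proj_entry l g s r' c * (a r * b r') +
          proj_entry l g s r' c * proj_entry l g s r c * (a r' * b r)) =
        (\<Sum>(r, r')\<in>{(r, r'). r < r' \<and> r' < d}.
          (a r * b r' + a r' * b r) / real l * character {(r, c), (r', c)} (neg_set d l g s))"
    proof (rule sum.cong[OF refl], clarify)
      fix r r' assume r: "r < r'" "r' < d"
      have "(\<Prod>(r, j)\<in>{(r, c), (r', c)}. g s r j) = character {(r, c), (r', c)} (neg_set d l g s)"
        by (rule sign_family_character[OF g s]) (use r c in auto)
      moreover define x where "x = g s r c * g s r' c"
      ultimately have 1: "character {(r, c), (r', c)} (neg_set d l g s) = x"
        using r by simp
      have 2: "proj_entry l g s r c * proj_entry l g s r' c = x / real l"
        "proj_entry l g s r' c * proj_entry l g s r c = x / real l"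
        using l by (simp_all add: proj_entry_def x_def)
      show "proj_entry l g s r c * proj_entry l g s r' c * (a r * b r') +
          proj_entry l g s r' c * proj_entry l g s r c * (a r' * b r) =
          (a r * b r' + a r' * b r) / real l * character {(r, c), (r', c)} (neg_set d l g s)"
        unfolding 1 2 by (simp add: algebra_simps add_divide_distrib)
    qed
    moreover have "(\<Sum>r<d. proj_entry l g s r c * proj_entry l g s r c * (a r * b r)) =
        (\<Sum>r<d. 1 / real l * (a r * b r))"
      using sq c by (intro sum.cong refl) simp
    ultimately show "(\<Sum>r<d. \<Sum>r'<d. proj_entry l g s r c * proj_entry l g s r' c * (a r * b r')) =
      (\<Sum>r<d. 1 / real l * (a r * b r)) + (\<Sum>(r, r')\<in>{(r, r'). r < r' \<and> r' < d}.
         (a r * b r' + a r' * b r) / real l * character {(r, c), (r', c)} (neg_set d l g s))"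
      unfolding sum_pairs by simp
  qed
  also have "\<dots> = (\<Sum>r<d. a r * b r) + (\<Sum>c<l. \<Sum>(r, r')\<in>{(r, r'). r < r' \<and> r' < d}.
         (a r * b r' + a r' * b r) / real l * character {(r, c), (r', c)} (neg_set d l g s))"
    using l by (simp add: sum.distrib sum_divide_distrib[symmetric])
  finally show ?thesis
    by (simp add: gram_error_def sum.cartesian_product case_prod_beta')
qed

text \<open>The squared Walsh coefficients of the error. Each of the \<open>l\<close> columns
  carries a factor 1 / l^2, and (x + y)^2 <= 2 (x^2 + y^2) separates the two products, so that the
  sum over pairs can be completed to a product of squared norms.\<close>

lemma gram_error_variance:
  fixes a b :: "nat \<Rightarrow> real"
  assumes "l > 0"
  shows "(\<Sum>(c, r, r')\<in>{..<l} \<times> {(r, r'). r < r' \<and> r' < d}. ((a r * b r' + a r' * b r) / real l)\<^sup>2) \<le>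
    2 / real l * ((\<Sum>r<d. (a r)\<^sup>2) * (\<Sum>r<d. (b r)\<^sup>2))"
proof -
  let ?P = "{(r, r'). r < r' \<and> r' < d}"
  have "(\<Sum>(c, r, r')\<in>{..<l} \<times> ?P. ((a r * b r' + a r' * b r) / real l)\<^sup>2) =
      (\<Sum>c<l. \<Sum>(r, r')\<in>?P. ((a r * b r' + a r' * b r) / real l)\<^sup>2)"
    by (simp only: sum.cartesian_product case_prod_beta' fst_conv snd_conv)
  also have "\<dots> = 1 / real l * (\<Sum>(r, r')\<in>?P. (a r * b r' + a r' * b r)\<^sup>2)"
    using assms by (simp add: power_divide case_prod_beta' sum_divide_distrib[symmetric] power2_eq_square[of "real l"])
  also have "\<dots> \<le> 1 / real l * (2 * (\<Sum>(r, r')\<in>?P. (a r)\<^sup>2 * (b r')\<^sup>2 + (a r')\<^sup>2 * (b r)\<^sup>2))"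
  proof (rule mult_left_mono)
    have "(x + y)\<^sup>2 \<le> 2 * (x\<^sup>2 + y\<^sup>2)" for x y :: real
      using zero_le_power2[of "x - y"] by (simp add: power2_eq_square algebra_simps)
    from this[of "a _ * b _" "a _ * b _"]
    show "(\<Sum>(r, r')\<in>?P. (a r * b r' + a r' * b r)\<^sup>2) \<le>
        2 * (\<Sum>(r, r')\<in>?P. (a r)\<^sup>2 * (b r')\<^sup>2 + (a r')\<^sup>2 * (b r)\<^sup>2)"
      unfolding sum_distrib_left by (intro sum_mono) (auto simp: power_mult_distrib)
  qed simp
  also have "\<dots> \<le> 1 / real l * (2 * (\<Sum>r<d. \<Sum>r'<d. (a r)\<^sup>2 * (b r')\<^sup>2))"
    unfolding sum_pairs[of "\<lambda>r r'. (a r)\<^sup>2 * (b r')\<^sup>2"]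
    by (intro mult_left_mono) (auto intro!: sum_nonneg)
  finally show ?thesis by (simp add: sum_product)
qed

lemma gram_error_moment:
  assumes g: "sign_family t d l m g" and l: "l > 0" and p: "p \<ge> 1" and t: "4 * p \<le> t"
  shows "(\<Sum>s\<in>seeds m. ((gram_error d l (proj_entry l g s) a b)\<^sup>2) ^ p) \<le>
    real (card (seeds m)) * (real (2 * p - 1) ^ 2 * (2 / real l * ((\<Sum>r<d. (a r)\<^sup>2) * (\<Sum>r<d. (b r)\<^sup>2)))) ^ p"
proof -
  let ?P = "{(r, r'). r < r' \<and> r' < d}"
  let ?I = "{..<l} \<times> ?P"
  let ?S = "\<lambda>(c, r, r'). {(r, c), (r', c)}"
  let ?c = "\<lambda>(c, r, r'). (a r * b r' + a r' * b r) / real l"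
  have "finite ?P" by (rule finite_subset[of _ "{..<d} \<times> {..<d}"]) auto
  then have fin: "finite ?I" by simp
  \<comment> \<open>The order r < r' and the common column make the two-element set determine its
    index.\<close>
  have "inj_on ?S ?I"
    by (auto simp: inj_on_def doubleton_eq_iff)
  have "(\<Sum>s\<in>seeds m. ((gram_error d l (proj_entry l g s) a b)\<^sup>2) ^ p) =
      (\<Sum>s\<in>seeds m. (\<Sum>i\<in>?I. ?c i * character (?S i) (neg_set d l g s)) ^ (2 * p))"
    by (intro sum.cong refl) (simp add: gram_error_expansion[OF g _ l] power_mult case_prod_beta')
  also have "\<dots> \<le> real (card (seeds m)) * (real (2 * p - 1) ^ 2 * (\<Sum>i\<in>?I. (?c i)\<^sup>2)) ^ p"
  proof (rule limited_independence_moment[where N = "{..<d} \<times> {..<l}" and t = t])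
    show "(\<Sum>s\<in>seeds m. character S (neg_set d l g s)) = 0"
      if "S \<subseteq> {..<d} \<times> {..<l}" "S \<noteq> {}" "card S \<le> t" for S
      using sign_family_sum_character[OF g that] .
  qed (use fin \<open>inj_on ?S ?I\<close> p t in auto)
  also have "\<dots> \<le> real (card (seeds m)) *
      (real (2 * p - 1) ^ 2 * (2 / real l * ((\<Sum>r<d. (a r)\<^sup>2) * (\<Sum>r<d. (b r)\<^sup>2)))) ^ p"
    using gram_error_variance[OF l, of a b d]
    by (intro mult_left_mono power_mono) (auto simp: case_prod_beta' intro!: sum_nonneg mult_nonneg_nonneg)
  finally show ?thesis .
qed

text \<open>Minkowski adds the entrywise bounds as if they held pointwise, so \<open>n\<close> does
  not enter: the sum of the products of squared row norms factors into \<open>F\<^sup>2\<close>. The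
  8 comes from (2p - 1)^2 <= 4 p^2 and the variance constant 2.\<close>

lemma gram_error_matrix_moment:
  fixes a :: "nat \<Rightarrow> nat \<Rightarrow> real" and n d :: nat
  assumes g: "sign_family t d l m g" and l: "l > 0" and p: "p \<ge> 1" and t: "4 * p \<le> t"
  defines "F \<equiv> \<Sum>i<n. \<Sum>r<d. (a i r)\<^sup>2"
  shows "(\<Sum>s\<in>seeds m. (\<Sum>i<n. \<Sum>j<n. (gram_error d l (proj_entry l g s) (a i) (a j))\<^sup>2) ^ p) \<le>
    real (card (seeds m)) * (8 * real p ^ 2 * F\<^sup>2 / real l) ^ p"
proof -
  define v where "v = (\<lambda>(i, j). real (2 * p - 1) ^ 2 * (2 / real l * ((\<Sum>r<d. (a i r)\<^sup>2) * (\<Sum>r<d. (a j r)\<^sup>2))))"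
  have v0: "v i \<ge> 0" for i 
    unfolding v_def by (auto intro!: mult_nonneg_nonneg divide_nonneg_nonneg sum_nonneg split: prod.split)
  have "(\<Sum>s\<in>seeds m. (\<Sum>i\<in>{..<n} \<times> {..<n}. (gram_error d l (proj_entry l g s) (a (fst i)) (a (snd i)))\<^sup>2) ^ p) \<le>
      real (card (seeds m)) * (\<Sum>i\<in>{..<n} \<times> {..<n}. v i) ^ p"
  proof (rule minkowski_power)
    fix i assume "i \<in> {..<n} \<times> {..<n}"
    show "(\<Sum>s\<in>seeds m. ((gram_error d l (proj_entry l g s) (a (fst i)) (a (snd i)))\<^sup>2) ^ p) \<le>
        real (card (seeds m)) * v i ^ p"
      using gram_error_moment[OF g l p t, of "a (fst i)" "a (snd i)"] by (simp add: v_def case_prod_beta')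
  qed (use p v0 in auto)
  also have "(\<Sum>i\<in>{..<n} \<times> {..<n}. v i) = real (2 * p - 1) ^ 2 * (2 / real l * F\<^sup>2)"
  proof -
    have "(\<Sum>i<n. \<phi> i)\<^sup>2 = (\<Sum>(i, j)\<in>{..<n} \<times> {..<n}. \<phi> i * \<phi> j)" for \<phi> :: "nat \<Rightarrow> real"
      unfolding power2_eq_square sum_product sum.cartesian_product ..
    from this[of "\<lambda>i. \<Sum>r<d. (a i r)\<^sup>2"]
    have "F\<^sup>2 = (\<Sum>(i, j)\<in>{..<n} \<times> {..<n}. (\<Sum>r<d. (a i r)\<^sup>2) * (\<Sum>r<d. (a j r)\<^sup>2))"
      by (simp only: F_def)
    then show ?thesis unfolding v_def by (simp only: sum_distrib_left case_prod_beta')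
  qed
  also have "real (card (seeds m)) * (real (2 * p - 1) ^ 2 * (2 / real l * F\<^sup>2)) ^ p \<le>
      real (card (seeds m)) * ((2 * real p) ^ 2 * (2 / real l * F\<^sup>2)) ^ p"
    by (intro mult_left_mono power_mono mult_right_mono) auto
  finally show ?thesis
    by (simp add: sum.cartesian_product case_prod_beta' power_mult_distrib mult.assoc)
qed

text \<open>Markov's inequality for the moment of order \<open>p\<close>. The requirement on
  \<open>l\<close> makes the base of the moment at most \<theta> / e, which leaves the factor exp (-
  p).\<close>

lemma gram_error_tail:
  fixes a :: "nat \<Rightarrow> nat \<Rightarrow> real"
  assumes g: "sign_family t d l m g" and l: "l > 0" and p: "p \<ge> 1" and t: "4 * p \<le> t"
    and \<theta>: "\<theta> > 0" "8 * exp 1 * real p ^ 2 * (\<Sum>i<n. \<Sum>r<d. (a i r)\<^sup>2)\<^sup>2 \<le> \<theta> * real l"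
  shows "measure_pmf.prob (pmf_of_set (seeds m))
    {s. (\<Sum>i<n. \<Sum>j<n. (gram_error d l (proj_entry l g s) (a i) (a j))\<^sup>2) \<le> \<theta>} \<ge> 1 - exp (- real p)"
proof -
  define Q where "Q s = (\<Sum>i<n. \<Sum>j<n. (gram_error d l (proj_entry l g s) (a i) (a j))\<^sup>2)" for s
  define F where "F = (\<Sum>i<n. \<Sum>r<d. (a i r)\<^sup>2)"
  define bad where "bad = {s \<in> seeds m. Q s > \<theta>}"
  have Q0: "Q s \<ge> 0" for s unfolding Q_def by (intro sum_nonneg) auto
  have "real (card bad) * \<theta> ^ p = (\<Sum>s\<in>bad. \<theta> ^ p)" by simp
  also have "\<dots> \<le> (\<Sum>s\<in>bad. Q s ^ p)"
    using \<theta>(1) by (intro sum_mono power_mono) (auto simp: bad_def)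
  also have "\<dots> \<le> (\<Sum>s\<in>seeds m. Q s ^ p)"
    using Q0 by (intro sum_mono2) (auto simp: bad_def)
  also have "\<dots> \<le> real (card (seeds m)) * (8 * real p ^ 2 * F\<^sup>2 / real l) ^ p"
    unfolding Q_def F_def by (rule gram_error_matrix_moment[OF g l p t])
  also have "\<dots> \<le> real (card (seeds m)) * (\<theta> * exp (- 1)) ^ p"
    using \<theta> l by (intro mult_left_mono power_mono) (auto simp: F_def field_simps exp_minus)
  also have "(\<theta> * exp (- 1)) ^ p = exp (- real p) * \<theta> ^ p"
    by (simp add: power_mult_distrib exp_of_nat_mult[symmetric])
  finally have bad: "real (card bad) \<le> real (card (seeds m)) * exp (- real p)"
    using \<theta>(1) by (simp add: mult.assoc[symmetric])
  have pos: "real (card (seeds m)) > 0" by (simp add: card_gt_0_iff)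
  have "measure_pmf.prob (pmf_of_set (seeds m)) {s. Q s \<le> \<theta>} =
      real (card (seeds m \<inter> {s. Q s \<le> \<theta>})) / real (card (seeds m))"
    by (rule measure_pmf_of_set) simp_all
  also have "seeds m \<inter> {s. Q s \<le> \<theta>} = seeds m - bad" by (auto simp: bad_def)
  also have "real (card (seeds m - bad)) = real (card (seeds m)) - real (card bad)"
    by (subst card_Diff_subset) (auto simp: bad_def of_nat_diff card_mono finite_subset[OF _ finite_seeds(1)])
  also have "\<dots> / real (card (seeds m)) \<ge> 1 - exp (- real p)"
    using bad pos by (simp add: field_simps)
  finally show ?thesis by (simp add: Q_def)
qed

section \<open>Perturbation of spectral projections\<close>

definition ip :: "nat \<Rightarrow> (nat \<Rightarrow> real) \<Rightarrow> (nat \<Rightarrow> real) \<Rightarrow> real" where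
  "ip n x y = (\<Sum>i<n. x i * y i)"

text \<open>The matrix sum of s_a u_a u_a^T. For orthonormal vectors, constant weight 1 gives the
  projection onto the span of the first \<open>m\<close> of them.\<close>

definition outer_sum :: "nat \<Rightarrow> (nat \<Rightarrow> real) \<Rightarrow> (nat \<Rightarrow> nat \<Rightarrow> real) \<Rightarrow> nat \<Rightarrow> nat \<Rightarrow> real" where
  "outer_sum m s u i j = (\<Sum>a<m. s a * u a i * u a j)"

definition hs :: "nat \<Rightarrow> (nat \<Rightarrow> nat \<Rightarrow> real) \<Rightarrow> (nat \<Rightarrow> nat \<Rightarrow> real) \<Rightarrow> real" where
  "hs n M N = (\<Sum>(i, j)\<in>{..<n} \<times> {..<n}. M i j * N i j)"

definition hs_norm :: "nat \<Rightarrow> (nat \<Rightarrow> nat \<Rightarrow> real) \<Rightarrow> real" where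
  "hs_norm n M = L2_set (\<lambda>(i, j). M i j) ({..<n} \<times> {..<n})"

text \<open>
  The zero vectors allowed by \<open>e a = 0\<close> stand for the left singular vectors of a zero singular
  value, so a rank-deficient sketch needs no separate treatment.
\<close>

definition frame :: "nat \<Rightarrow> nat \<Rightarrow> (nat \<Rightarrow> real) \<Rightarrow> (nat \<Rightarrow> nat \<Rightarrow> real) \<Rightarrow> bool" where
  "frame n m e u \<longleftrightarrow> (\<forall>a<m. e a = 0 \<or> e a = 1) \<and>
     (\<forall>a<m. \<forall>b<m. ip n (u a) (u b) = (if a = b then e a else 0))"

lemma ip_commute: "ip n x y = ip n y x"
  by (simp add: ip_def mult.commute)

lemma frame_ip: "frame n m e u \<Longrightarrow> a < m \<Longrightarrow> b < m \<Longrightarrow> ip n (u a) (u b) = (if a = b then e a else 0)"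
  by (simp add: frame_def)

lemma frame_bound: "frame n m e u \<Longrightarrow> a < m \<Longrightarrow> 0 \<le> e a \<and> e a \<le> 1"
  unfolding frame_def by fastforce

lemma frame_mono: "frame n m e u \<Longrightarrow> k \<le> m \<Longrightarrow> frame n k e u"
  unfolding frame_def by auto

lemma frame_scale:
  assumes "frame n m e u" "a < m" "i < n"
  shows "e a * u a i = u a i"
proof (cases "e a = 1")
  case False
  then have "e a = 0" using assms unfolding frame_def by blast
  then have "(\<Sum>i<n. u a i * u a i) = 0" using frame_ip[OF assms(1,2,2)] by (simp add: ip_def)
  then have "\<forall>i\<in>{..<n}. u a i * u a i = 0" by (subst (asm) sum_nonneg_eq_0_iff) auto
  then show ?thesis using assms(3) by simp
qed simp

lemma hs_norm_square: "(hs_norm n M)\<^sup>2 = hs n M M"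
  by (simp add: hs_norm_def hs_def L2_set_def sum_nonneg case_prod_beta' power2_eq_square)

lemma hs_norm_nonneg: "hs_norm n M \<ge> 0"
  by (simp add: hs_norm_def L2_set_nonneg)

lemma sum_abs_le_hs_norm:
  "(\<Sum>i<n. \<Sum>j<n. \<bar>M i j\<bar> * \<bar>N i j\<bar>) \<le> hs_norm n M * hs_norm n N"
  unfolding sum.cartesian_product hs_norm_def
  using L2_set_mult_ineq[of "\<lambda>(i, j). M i j" "\<lambda>(i, j). N i j" "{..<n} \<times> {..<n}"]
  by (simp add: case_prod_beta')

lemma hs_le: "hs n M N \<le> hs_norm n M * hs_norm n N"
proof -
  have "hs n M N \<le> (\<Sum>i<n. \<Sum>j<n. \<bar>M i j\<bar> * \<bar>N i j\<bar>)"
    unfolding hs_def sum.cartesian_product[symmetric]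
    by (intro sum_mono) (metis abs_ge_self abs_mult)
  then show ?thesis using sum_abs_le_hs_norm order_trans by blast
qed

lemma hs_norm_triangle:
  "hs_norm n (\<lambda>i j. M i j + N i j) \<le> hs_norm n M + hs_norm n N"
  unfolding hs_norm_def
  using L2_set_triangle_ineq[of "\<lambda>(i, j). M i j" "\<lambda>(i, j). N i j" "{..<n} \<times> {..<n}"]
  by (simp add: case_prod_beta')

lemma hs_diff:
  "hs n (\<lambda>i j. M i j - M' i j) (\<lambda>i j. N i j - N' i j) = hs n M N - hs n M N' - hs n M' N + hs n M' N'"
  unfolding hs_def sum_subtractf[symmetric] sum.distrib[symmetric]
  by (rule sum.cong) (auto simp: algebra_simps)

lemma sum_rotate:
  fixes f :: "'a \<Rightarrow> 'b \<Rightarrow> 'c \<Rightarrow> real"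
  shows "(\<Sum>i\<in>A. \<Sum>a\<in>B. \<Sum>b\<in>C. f i a b) = (\<Sum>a\<in>B. \<Sum>b\<in>C. \<Sum>i\<in>A. f i a b)"
proof -
  have "(\<Sum>i\<in>A. \<Sum>a\<in>B. \<Sum>b\<in>C. f i a b) = (\<Sum>a\<in>B. \<Sum>i\<in>A. \<Sum>b\<in>C. f i a b)"
    by (rule sum.swap)
  also have "\<dots> = (\<Sum>a\<in>B. \<Sum>b\<in>C. \<Sum>i\<in>A. f i a b)"
    by (intro sum.cong refl sum.swap)
  finally show ?thesis .
qed

text \<open>Traces of products become weighted squared overlaps, the form in which Bessel's
  inequality can be used.\<close>

lemma hs_outer_sum:
  "hs n (outer_sum m s u) (outer_sum m' s' w) =
   (\<Sum>a<m. \<Sum>b<m'. s a * s' b * (ip n (u a) (w b))\<^sup>2)"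
proof -
  have "hs n (outer_sum m s u) (outer_sum m' s' w) =
      (\<Sum>i<n. \<Sum>j<n. \<Sum>a<m. \<Sum>b<m'. s a * s' b * ((u a i * w b i) * (u a j * w b j)))"
    unfolding hs_def outer_sum_def sum.cartesian_product[symmetric] sum_product
    by (intro sum.cong refl) (simp add: mult_ac)
  also have "\<dots> = (\<Sum>i<n. \<Sum>a<m. \<Sum>b<m'. \<Sum>j<n. s a * s' b * ((u a i * w b i) * (u a j * w b j)))"
    by (intro sum.cong refl sum_rotate)
  also have "\<dots> = (\<Sum>a<m. \<Sum>b<m'. \<Sum>i<n. \<Sum>j<n. s a * s' b * ((u a i * w b i) * (u a j * w b j)))"
    by (rule sum_rotate)
  also have "\<dots> = (\<Sum>a<m. \<Sum>b<m'. s a * s' b * (ip n (u a) (w b))\<^sup>2)"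
    unfolding ip_def power2_eq_square sum_product by (simp add: sum_distrib_left)
  finally show ?thesis .
qed

text \<open>Nonnegativity of the squared distance from \<open>x\<close> to the combination
  \<open>y\<close> with coefficients \<open>c a\<close>. As \<open>e a\<close> is at most 1, zero
  vectors included, the squared norm of \<open>y\<close> is at most the sum of the squared
  coefficients.\<close>

lemma bessel:
  assumes "frame n m e u"
  shows "(\<Sum>a<m. (ip n x (u a))\<^sup>2) \<le> ip n x x"
proof -
  define c where "c a = ip n x (u a)" for a
  define y where "y i = (\<Sum>a<m. c a * u a i)" for i
  have xy: "ip n x y = (\<Sum>a<m. (c a)\<^sup>2)"
    unfolding ip_def y_def sum_distrib_left
    by (subst sum.swap) (simp add: power2_eq_square c_def ip_def sum_distrib_left mult_ac)
  have "ip n y y = (\<Sum>a<m. \<Sum>b<m. c a * c b * ip n (u a) (u b))"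
  proof -
    have "ip n y y = (\<Sum>i<n. \<Sum>a<m. \<Sum>b<m. c a * c b * (u a i * u b i))"
      unfolding ip_def y_def sum_product by (simp add: mult_ac)
    also have "\<dots> = (\<Sum>a<m. \<Sum>b<m. \<Sum>i<n. c a * c b * (u a i * u b i))"
      by (rule sum_rotate)
    finally show ?thesis by (simp add: ip_def sum_distrib_left)
  qed
  also have "\<dots> = (\<Sum>a<m. \<Sum>b<m. if a = b then c a * c a * e a else 0)"
    by (intro sum.cong refl) (simp add: frame_ip[OF assms])
  also have "\<dots> = (\<Sum>a<m. c a * c a * e a)" by simp
  also have "\<dots> \<le> (\<Sum>a<m. (c a)\<^sup>2)"
    using frame_bound[OF assms] by (intro sum_mono) (simp add: power2_eq_square mult_left_le)
  finally have yy: "ip n y y \<le> (\<Sum>a<m. (c a)\<^sup>2)" .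
  have "0 \<le> (\<Sum>i<n. (x i - y i)\<^sup>2)" by (intro sum_nonneg) simp
  also have "\<dots> = ip n x x - 2 * ip n x y + ip n y y"
    unfolding ip_def sum_distrib_left sum_subtractf[symmetric] sum.distrib[symmetric]
    by (intro sum.cong refl) (simp add: power2_eq_square algebra_simps)
  finally show ?thesis using xy yy by (simp add: c_def)
qed

text \<open>The quantitative Ky Fan principle behind the \<open>sin \<Theta>\<close> theorem.\<close>

lemma top_weights:
  fixes s p :: "nat \<Rightarrow> real"
  assumes s: "antimono s" "\<And>a. s a \<ge> 0" and p: "\<And>a. a < m \<Longrightarrow> 0 \<le> p a \<and> p a \<le> 1"
    and sum: "(\<Sum>a<m. p a) \<le> real k" and k: "1 \<le> k" "k \<le> m"
  shows "(\<Sum>a<k. s a) - (\<Sum>a<m. s a * p a) \<ge> (s (k - 1) - s k) * (real k - (\<Sum>a<k. p a))"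
proof -
  have split: "(\<Sum>a<m. f a) = (\<Sum>a<k. f a) + (\<Sum>a=k..<m. f a)" for f :: "nat \<Rightarrow> real"
    using k(2) by (metis atLeast0LessThan le0 sum.atLeastLessThan_concat)
  \<comment> \<open>The weight missing from the first \<open>k\<close> positions is worth at least
    \<open>s (k - 1)\<close> per unit. The weight from position \<open>k\<close> on is at most that
    amount, by \<open>sum\<close>, and worth at most \<open>s k\<close> per unit.\<close>
  have 1: "(\<Sum>a<k. s (k - 1) * (1 - p a)) \<le> (\<Sum>a<k. s a * (1 - p a))"
    using p k antimonoD[OF s(1)] by (intro sum_mono mult_right_mono) auto
  have 2: "(\<Sum>a=k..<m. s a * p a) \<le> (\<Sum>a=k..<m. s k * p a)"
    using p antimonoD[OF s(1)] by (intro sum_mono mult_right_mono) auto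
  have "(\<Sum>a=k..<m. s k * p a) \<le> s k * (real k - (\<Sum>a<k. p a))"
    unfolding sum_distrib_left[symmetric] using sum split[of p] s(2) by (intro mult_left_mono) auto
  moreover have "(\<Sum>a<k. s (k - 1) * (1 - p a)) = s (k - 1) * (real k - (\<Sum>a<k. p a))"
    unfolding sum_distrib_left[symmetric] by (simp add: sum_subtractf)
  moreover have "(\<Sum>a<k. s a * (1 - p a)) = (\<Sum>a<k. s a) - (\<Sum>a<k. s a * p a)"
    by (simp add: right_diff_distrib sum_subtractf)
  ultimately show ?thesis using 1 2 split[of "\<lambda>a. s a * p a"]
    by (simp add: left_diff_distrib)
qed

lemma hs_projection_self:
  assumes "frame n m e u" "k \<le> m" "\<And>a. a < m \<Longrightarrow> e a = 0 \<Longrightarrow> s a = 0"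
  shows "hs n (outer_sum k (\<lambda>_. 1) u) (outer_sum m s u) = (\<Sum>a<k. s a)"
proof -
  have "hs n (outer_sum k (\<lambda>_. 1) u) (outer_sum m s u) =
      (\<Sum>a<k. \<Sum>b<m. if a = b then s a * (e a)\<^sup>2 else 0)"
    unfolding hs_outer_sum using assms(2) by (intro sum.cong refl) (simp add: frame_ip[OF assms(1)])
  also have "\<dots> = (\<Sum>a<k. s a * (e a)\<^sup>2)" using assms(2) by (intro sum.cong refl) simp
  also have "\<dots> = (\<Sum>a<k. s a)"
  proof (rule sum.cong[OF refl])
    fix a assume "a \<in> {..<k}"
    then have "a < m" using assms(2) by simp
    then have "e a = 0 \<or> e a = 1" using assms(1) unfolding frame_def by blast
    then show "s a * (e a)\<^sup>2 = s a" using assms(3)[OF \<open>a < m\<close>] by auto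
  qed
  finally show ?thesis .
qed

text \<open>The weight \<open>p b\<close> is the squared length of the projection of
  \<open>u b\<close> onto the span of the \<open>w a\<close>. Bessel in one direction bounds each
  weight by 1, in the other their total by \<open>k\<close>, so \<open>top_weights\<close>
  applies.\<close>

lemma hs_projection_other:
  assumes u: "frame n m e u" and w: "frame n m' e' w" and s: "antimono s" "\<And>a. s a \<ge> 0"
    and k: "1 \<le> k" "k \<le> m" "k \<le> m'"
  shows "(\<Sum>a<k. s a) - hs n (outer_sum k (\<lambda>_. 1) w) (outer_sum m s u) \<ge>
    (s (k - 1) - s k) * (real k - hs n (outer_sum k (\<lambda>_. 1) u) (outer_sum k (\<lambda>_. 1) w))"
proof -
  define p where "p b = (\<Sum>a<k. (ip n (u b) (w a))\<^sup>2)" for b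
  have wk: "frame n k e' w" using frame_mono[OF w k(3)] .
  have p1: "0 \<le> p b \<and> p b \<le> 1" if "b < m" for b
  proof -
    have "p b \<le> ip n (u b) (u b)" unfolding p_def by (rule bessel[OF wk])
    also have "\<dots> \<le> 1" using frame_ip[OF u that that] frame_bound[OF u that] by simp
    finally show ?thesis by (simp add: p_def sum_nonneg)
  qed
  have "(\<Sum>b<m. p b) = (\<Sum>a<k. \<Sum>b<m. (ip n (w a) (u b))\<^sup>2)"
    unfolding p_def by (subst sum.swap) (simp add: ip_commute)
  also have "\<dots> \<le> (\<Sum>a<k. ip n (w a) (w a))" by (intro sum_mono bessel[OF u])
  also have "\<dots> \<le> (\<Sum>a<k. 1)"
    using frame_ip[OF wk] frame_bound[OF wk] by (intro sum_mono) auto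
  finally have p2: "(\<Sum>b<m. p b) \<le> real k" by simp
  have "hs n (outer_sum k (\<lambda>_. 1) w) (outer_sum m s u) = (\<Sum>b<m. s b * p b)"
    unfolding hs_outer_sum p_def by (subst sum.swap) (simp add: ip_commute sum_distrib_left)
  moreover have "hs n (outer_sum k (\<lambda>_. 1) u) (outer_sum k (\<lambda>_. 1) w) = (\<Sum>b<k. p b)"
    unfolding hs_outer_sum p_def by simp
  ultimately show ?thesis using top_weights[OF s p1 p2 k(1,2)] by simp
qed

lemma hs_projection_norm:
  assumes "frame n m e u" "k \<le> m"
  shows "hs n (outer_sum k (\<lambda>_. 1) u) (outer_sum k (\<lambda>_. 1) u) \<le> real k"
proof -
  have fk: "frame n k e u" using frame_mono[OF assms] .
  have "hs n (outer_sum k (\<lambda>_. 1) u) (outer_sum k (\<lambda>_. 1) u) =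
      (\<Sum>a<k. \<Sum>b<k. if a = b then e a else 0)"
    unfolding hs_outer_sum
    using fk by (intro sum.cong refl) (auto simp: frame_def)
  also have "\<dots> = (\<Sum>a<k. e a)" by simp
  also have "\<dots> \<le> (\<Sum>a<k. 1)" using frame_bound[OF fk] by (intro sum_mono) auto
  finally show ?thesis by simp
qed

text \<open>By symmetry of both matrices the left side is a diagonal entry of P B; with unit weights
  and m = k it expresses that P is idempotent.\<close>

lemma outer_sum_diag_mult:
  assumes "frame n m e u" "k \<le> m" "i < n"
  shows "(\<Sum>j<n. outer_sum k (\<lambda>_. 1) u i j * outer_sum m s u i j) = outer_sum k s u i i"
proof -
  have "(\<Sum>j<n. outer_sum k (\<lambda>_. 1) u i j * outer_sum m s u i j) =
      (\<Sum>j<n. \<Sum>a<k. \<Sum>b<m. s b * u a i * u b i * (u a j * u b j))"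
    unfolding outer_sum_def sum_product by (simp add: mult_ac)
  also have "\<dots> = (\<Sum>a<k. \<Sum>b<m. \<Sum>j<n. s b * u a i * u b i * (u a j * u b j))"
    by (rule sum_rotate)
  also have "\<dots> = (\<Sum>a<k. \<Sum>b<m. s b * u a i * u b i * ip n (u a) (u b))"
    by (simp add: ip_def sum_distrib_left)
  also have "\<dots> = (\<Sum>a<k. \<Sum>b<m. if a = b then s a * u a i * u a i * e a else 0)"
    using assms(2) by (intro sum.cong refl) (simp add: frame_ip[OF assms(1)])
  also have "\<dots> = (\<Sum>a<k. s a * u a i * u a i * e a)"
    using assms(2) by (intro sum.cong refl) simp
  also have "\<dots> = (\<Sum>a<k. s a * u a i * u a i)"
    using assms(2) frame_scale[OF assms(1) _ assms(3)] by (intro sum.cong refl) (simp add: mult_ac)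
  finally show ?thesis by (simp add: outer_sum_def)
qed

text \<open>Adding the Ky Fan inequalities of both matrices bounds gap * (k - <P, P'>) by <P - P', B
  - B'>, and k - <P, P'> is at least half the squared norm of P - P'. One factor of that norm then
  cancels against Cauchy--Schwarz.\<close>

lemma projection_perturbation:
  fixes s \<mu> :: "nat \<Rightarrow> real"
  assumes u: "frame n m (\<lambda>_. 1) u" and w: "frame n m' e w"
    and s: "antimono s" "\<And>a. s a \<ge> 0" and \<mu>: "antimono \<mu>" "\<And>a. \<mu> a \<ge> 0"
    and e: "\<And>a. a < m' \<Longrightarrow> e a = 0 \<Longrightarrow> \<mu> a = 0"
    and k: "1 \<le> k" "k \<le> m" "k \<le> m'"
    and gap: "s (k - 1) - s k > 0"
    and \<eta>: "hs_norm n (\<lambda>i j. outer_sum m s u i j - outer_sum m' \<mu> w i j) \<le> \<eta>"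
  defines "\<pi> \<equiv> 2 * \<eta> / (s (k - 1) - s k)"
  shows "(\<Sum>i<n. \<bar>outer_sum k (\<lambda>_. 1) u i i - outer_sum k (\<lambda>_. 1) w i i\<bar>) \<le> 2 * sqrt k * \<pi>"
    and "(\<Sum>i<n. \<bar>outer_sum k s u i i - outer_sum k \<mu> w i i\<bar>) \<le>
      sqrt k * \<eta> + \<pi> * (hs_norm n (outer_sum m s u) + \<eta>)"
proof -
  define B where "B = outer_sum m s u"
  define B' where "B' = outer_sum m' \<mu> w"
  define P where "P = outer_sum k (\<lambda>_. 1) u"
  define P' where "P' = outer_sum k (\<lambda>_. 1) w"
  define E where "E = (\<lambda>i j. B i j - B' i j)"
  define Q where "Q = (\<lambda>i j. P i j - P' i j)"
  define g where "g = s (k - 1) - s k"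
  have E\<eta>: "hs_norm n E \<le> \<eta>" using \<eta> by (simp add: E_def B_def B'_def)
  have PB: "hs n P B = (\<Sum>a<k. s a)"
    unfolding P_def B_def by (rule hs_projection_self[OF u k(2)]) simp
  have PB': "hs n P' B' = (\<Sum>a<k. \<mu> a)"
    unfolding P'_def B'_def by (rule hs_projection_self[OF w k(3) e])
  have 1: "(\<Sum>a<k. s a) - hs n P' B \<ge> g * (real k - hs n P P')"
    unfolding P_def P'_def B_def g_def by (rule hs_projection_other[OF u w s k])
  have PP: "hs n P P \<le> real k" "hs n P' P' \<le> real k"
    unfolding P_def P'_def using hs_projection_norm u w k by blast+
  have sym: "hs n M N = hs n N M" for M N by (simp add: hs_def mult.commute)
  have PP'k: "hs n P P' \<le> real k"
  proof -
    have "0 \<le> (hs_norm n Q)\<^sup>2" by simp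
    also have "\<dots> = hs n P P - hs n P P' - hs n P' P + hs n P' P'"
      unfolding hs_norm_square Q_def by (rule hs_diff)
    finally show ?thesis using PP sym[of P P'] by linarith
  qed
  \<comment> \<open>For the sketch the maximum principle alone is enough: of its own gap only
    nonnegativity is known.\<close>
  have 2: "(\<Sum>a<k. \<mu> a) - hs n P B' \<ge> 0"
  proof -
    have "(\<mu> (k - 1) - \<mu> k) * (real k - hs n P' P) \<ge> 0"
      using PP'k antimonoD[OF \<mu>(1), of "k - 1" k] sym[of P P'] by simp
    moreover have "(\<Sum>a<k. \<mu> a) - hs n P B' \<ge> (\<mu> (k - 1) - \<mu> k) * (real k - hs n P' P)"
      unfolding P_def P'_def B'_def by (rule hs_projection_other[OF w u \<mu> k(1) k(3) k(2)])
    ultimately show ?thesis by linarith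
  qed
  have "g / 2 * (hs_norm n Q)\<^sup>2 \<le> g * (real k - hs n P P')"
  proof -
    have "(hs_norm n Q)\<^sup>2 = hs n P P - hs n P P' - hs n P' P + hs n P' P'"
      unfolding hs_norm_square Q_def by (rule hs_diff)
    also have "\<dots> \<le> 2 * (real k - hs n P P')" using PP sym[of P P'] by simp
    finally have "g / 2 * (hs_norm n Q)\<^sup>2 \<le> g / 2 * (2 * (real k - hs n P P'))"
      using gap by (intro mult_left_mono) (auto simp: g_def)
    then show ?thesis by (simp add: algebra_simps)
  qed
  \<comment> \<open>Expanding the inner product gives precisely the sum of the left sides of 1 and
    2.\<close>
  also have "\<dots> \<le> hs n Q E"
    using 1 2 PB PB' unfolding Q_def E_def hs_diff by linarith
  also have "\<dots> \<le> hs_norm n Q * \<eta>"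
    using hs_le[of n Q E] mult_left_mono[OF E\<eta> hs_norm_nonneg[of n Q]] by linarith
  finally have "hs_norm n Q * (g / 2 * hs_norm n Q) \<le> hs_norm n Q * \<eta>"
    by (simp add: power2_eq_square mult_ac)
  moreover have \<eta>0: "\<eta> \<ge> 0" using E\<eta> hs_norm_nonneg[of n E] by linarith
  ultimately have "g / 2 * hs_norm n Q \<le> \<eta>"
    using hs_norm_nonneg[of n Q] by (cases "hs_norm n Q = 0") auto
  then have Q: "hs_norm n Q \<le> \<pi>" using gap by (simp add: \<pi>_def g_def field_simps)
  have P0: "hs_norm n P \<le> sqrt k" "hs_norm n P' \<le> sqrt k"
    using PP unfolding hs_norm_square[symmetric] by (auto intro: real_le_rsqrt)
  \<comment> \<open>By idempotency a diagonal entry is the sum of the squares of its row, and a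
    difference of squares factors.\<close>
  have diag: "P i i - P' i i = (\<Sum>j<n. Q i j * (P i j + P' i j))" if "i < n" for i
  proof -
    have "P i i = (\<Sum>j<n. P i j * P i j)"
      unfolding P_def using outer_sum_diag_mult[OF frame_mono[OF u k(2)] _ that, of k "\<lambda>_. 1"] by simp
    moreover have "P' i i = (\<Sum>j<n. P' i j * P' i j)"
      unfolding P'_def using outer_sum_diag_mult[OF frame_mono[OF w k(3)] _ that, of k "\<lambda>_. 1"] by simp
    ultimately show ?thesis
      by (simp add: Q_def sum_subtractf[symmetric] algebra_simps)
  qed
  have "(\<Sum>i<n. \<bar>P i i - P' i i\<bar>) \<le> (\<Sum>i<n. \<Sum>j<n. \<bar>Q i j\<bar> * \<bar>P i j + P' i j\<bar>)"
    using diag by (intro sum_mono) (simp add: sum_abs abs_mult[symmetric])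
  also have "\<dots> \<le> hs_norm n Q * hs_norm n (\<lambda>i j. P i j + P' i j)" by (rule sum_abs_le_hs_norm)
  also have "\<dots> \<le> \<pi> * (2 * sqrt k)"
    using Q hs_norm_triangle[of n P P'] P0 hs_norm_nonneg order_trans[OF hs_norm_nonneg Q]
    by (intro mult_mono) auto
  finally show "(\<Sum>i<n. \<bar>outer_sum k (\<lambda>_. 1) u i i - outer_sum k (\<lambda>_. 1) w i i\<bar>) \<le> 2 * sqrt k * \<pi>"
    by (simp add: P_def P'_def mult_ac)
  \<comment> \<open>The splitting P B - P' B' = P (B - B') + (P - P') B' keeps one small factor in
    each product.\<close>
  have diag2: "outer_sum k s u i i - outer_sum k \<mu> w i i = (\<Sum>j<n. P i j * E i j + Q i j * B' i j)"
    if "i < n" for i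
  proof -
    have "outer_sum k s u i i = (\<Sum>j<n. P i j * B i j)"
      unfolding P_def B_def using outer_sum_diag_mult[OF u k(2) that, of s] by simp
    moreover have "outer_sum k \<mu> w i i = (\<Sum>j<n. P' i j * B' i j)"
      unfolding P'_def B'_def using outer_sum_diag_mult[OF w k(3) that, of \<mu>] by simp
    ultimately show ?thesis
      by (simp add: Q_def E_def sum_subtractf[symmetric] algebra_simps)
  qed
  have "(\<Sum>i<n. \<bar>outer_sum k s u i i - outer_sum k \<mu> w i i\<bar>) \<le>
      (\<Sum>i<n. \<Sum>j<n. \<bar>P i j\<bar> * \<bar>E i j\<bar> + \<bar>Q i j\<bar> * \<bar>B' i j\<bar>)"
  proof (rule sum_mono)
    fix i assume "i \<in> {..<n}"
    then show "\<bar>outer_sum k s u i i - outer_sum k \<mu> w i i\<bar> \<le> (\<Sum>j<n. \<bar>P i j\<bar> * \<bar>E i j\<bar> + \<bar>Q i j\<bar> * \<bar>B' i j\<bar>)"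
      unfolding abs_mult[symmetric]
      by (simp add: diag2) (rule order_trans[OF sum_abs], intro sum_mono abs_triangle_ineq)
  qed
  also have "\<dots> \<le> hs_norm n P * hs_norm n E + hs_norm n Q * hs_norm n B'"
    unfolding sum.distrib by (intro add_mono sum_abs_le_hs_norm)
  also have "\<dots> \<le> sqrt k * \<eta> + \<pi> * (hs_norm n B + \<eta>)"
  proof (intro add_mono mult_mono)
    have "B' = (\<lambda>i j. B i j + (- 1) * E i j)" by (simp add: E_def)
    then have "hs_norm n B' \<le> hs_norm n B + hs_norm n (\<lambda>i j. (- 1) * E i j)"
      using hs_norm_triangle[of n B "\<lambda>i j. (- 1) * E i j"] by simp
    also have "hs_norm n (\<lambda>i j. (- 1) * E i j) = hs_norm n E"
      unfolding hs_norm_def L2_set_def by (simp add: case_prod_beta')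
    finally show "hs_norm n B' \<le> hs_norm n B + \<eta>" using E\<eta> by linarith
  qed (use P0 E\<eta> Q hs_norm_nonneg order_trans[OF hs_norm_nonneg Q] in auto)
  finally show "(\<Sum>i<n. \<bar>outer_sum k s u i i - outer_sum k \<mu> w i i\<bar>) \<le>
      sqrt k * \<eta> + \<pi> * (hs_norm n (outer_sum m s u) + \<eta>)"
    by (simp add: B_def)
qed

section \<open>From singular value decompositions to frames\<close>

lemma orthogonal_cols:
  fixes U :: "real mat"
  assumes "U \<in> carrier_mat n d" "transpose_mat U * U = 1\<^sub>m d" "a < d" "b < d"
  shows "(\<Sum>i<n. U $$ (i, a) * U $$ (i, b)) = (if a = b then 1 else 0)"
proof -
  have "(transpose_mat U * U) $$ (a, b) = (\<Sum>i<n. U $$ (i, a) * U $$ (i, b))"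
    using assms(1,3,4) by (simp add: scalar_prod_def atLeast0LessThan)
  then show ?thesis using assms(3,4) unfolding assms(2) by simp
qed

lemma orthogonal_rows:
  fixes V :: "real mat"
  assumes "V \<in> carrier_mat d d" "transpose_mat V * V = 1\<^sub>m d" "a < d" "b < d"
  shows "(\<Sum>j<d. V $$ (a, j) * V $$ (b, j)) = (if a = b then 1 else 0)"
proof -
  have "V * transpose_mat V = 1\<^sub>m d"
    by (rule mat_mult_left_right_inverse[of "transpose_mat V" d V]) (use assms(1,2) in simp_all)
  moreover have "(V * transpose_mat V) $$ (a, b) = (\<Sum>j<d. V $$ (a, j) * V $$ (b, j))"
    using assms(1,3,4) by (simp add: scalar_prod_def atLeast0LessThan)
  ultimately show ?thesis using assms(3,4) by simp
qed

lemma is_svdD: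
  assumes "is_svd A U \<sigma> V" "A \<in> carrier_mat n d"
  shows "U \<in> carrier_mat n d" "V \<in> carrier_mat d d"
    and "transpose_mat U * U = 1\<^sub>m d" "transpose_mat V * V = 1\<^sub>m d"
    and "A = U * mat_diag d \<sigma> * transpose_mat V"
proof -
  have dim: "dim_row A = n" "dim_col A = d" using assms(2) by auto
  show "U \<in> carrier_mat n d" "V \<in> carrier_mat d d"
    "transpose_mat U * U = 1\<^sub>m d" "transpose_mat V * V = 1\<^sub>m d"
    "A = U * mat_diag d \<sigma> * transpose_mat V"
    using assms(1) unfolding is_svd_def dim by blast+
qed

lemma svd_entry:
  assumes "is_svd A U \<sigma> V" "A \<in> carrier_mat n d" "i < n" "r < d"
  shows "A $$ (i, r) = (\<Sum>j<d. U $$ (i, j) * \<sigma> j * V $$ (r, j))"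
proof -
  note c = is_svdD(1,2)[OF assms(1,2)]
  have "A = mat n d (\<lambda>(i, j). U $$ (i, j) * \<sigma> j) * transpose_mat V"
    using is_svdD(5)[OF assms(1,2)] mat_diag_mult_right[OF c(1), of \<sigma>] by argo
  then have "A $$ (i, r) = (mat n d (\<lambda>(i, j). U $$ (i, j) * \<sigma> j) * transpose_mat V) $$ (i, r)"
    by (rule arg_cong)
  also have "\<dots> = (\<Sum>j<d. U $$ (i, j) * \<sigma> j * V $$ (r, j))"
    using assms(3,4) c by (simp add: scalar_prod_def atLeast0LessThan)
  finally show ?thesis .
qed

lemma svd_values:
  assumes "is_svd A U \<sigma> V"
  shows "antimono \<sigma>" "\<sigma> j \<ge> 0"
proof -
  show *: "antimono \<sigma>" using assms unfolding is_svd_def by blast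
  have "\<forall>j\<ge>dim_col A. \<sigma> j = 0" using assms unfolding is_svd_def by blast
  then have "\<sigma> (max j (dim_col A)) = 0" by simp
  then show "\<sigma> j \<ge> 0" using antimonoD[OF *, of j "max j (dim_col A)"] by simp
qed

lemma svd_right_mult:
  assumes "is_svd A U \<sigma> V" "A \<in> carrier_mat n d" "i < n" "a < d"
  shows "(\<Sum>r<d. A $$ (i, r) * V $$ (r, a)) = \<sigma> a * U $$ (i, a)"
proof -
  note c = is_svdD(2,4)[OF assms(1,2)]
  have "(\<Sum>r<d. A $$ (i, r) * V $$ (r, a)) =
      (\<Sum>r<d. \<Sum>j<d. U $$ (i, j) * \<sigma> j * (V $$ (r, j) * V $$ (r, a)))"
    using svd_entry[OF assms(1-3)] by (simp add: sum_distrib_right sum_distrib_left mult_ac)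
  also have "\<dots> = (\<Sum>j<d. U $$ (i, j) * \<sigma> j * (\<Sum>r<d. V $$ (r, j) * V $$ (r, a)))"
    by (subst sum.swap) (simp add: sum_distrib_left)
  also have "\<dots> = (\<Sum>j<d. if j = a then \<sigma> a * U $$ (i, a) else 0)"
    using assms(4) by (intro sum.cong refl) (simp add: orthogonal_cols[OF c])
  finally show ?thesis using assms(4) by simp
qed

lemma svd_left_mult:
  assumes "is_svd A U \<sigma> V" "A \<in> carrier_mat n d" "r < d" "a < d"
  shows "(\<Sum>i<n. A $$ (i, r) * U $$ (i, a)) = \<sigma> a * V $$ (r, a)"
proof -
  note c = is_svdD(1,3)[OF assms(1,2)]
  have "(\<Sum>i<n. A $$ (i, r) * U $$ (i, a)) =
      (\<Sum>i<n. \<Sum>j<d. V $$ (r, j) * \<sigma> j * (U $$ (i, j) * U $$ (i, a)))"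
    using svd_entry[OF assms(1,2) _ assms(3)] by (simp add: sum_distrib_right sum_distrib_left mult_ac)
  also have "\<dots> = (\<Sum>j<d. V $$ (r, j) * \<sigma> j * (\<Sum>i<n. U $$ (i, j) * U $$ (i, a)))"
    by (subst sum.swap) (simp add: sum_distrib_left)
  also have "\<dots> = (\<Sum>j<d. if j = a then \<sigma> a * V $$ (r, a) else 0)"
    using assms(4) by (intro sum.cong refl) (simp add: orthogonal_cols[OF c])
  finally show ?thesis using assms(4) by simp
qed

lemma svd_frame:
  assumes "is_svd A U \<sigma> V" "A \<in> carrier_mat n d"
  shows "frame n d (\<lambda>_. 1) (\<lambda>a i. U $$ (i, a))"
  using orthogonal_cols[OF is_svdD(1,3)[OF assms]] by (simp add: frame_def ip_def)

lemma svd_gram: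
  assumes "is_svd A U \<sigma> V" "A \<in> carrier_mat n d" "i < n" "j < n"
  shows "(\<Sum>r<d. A $$ (i, r) * A $$ (j, r)) = outer_sum d (\<lambda>a. (\<sigma> a)\<^sup>2) (\<lambda>a i. U $$ (i, a)) i j"
proof -
  have "(\<Sum>r<d. A $$ (i, r) * A $$ (j, r)) =
      (\<Sum>r<d. \<Sum>a<d. \<sigma> a * U $$ (j, a) * (A $$ (i, r) * V $$ (r, a)))"
    using svd_entry[OF assms(1,2,4)] by (simp add: sum_distrib_left mult_ac)
  also have "\<dots> = (\<Sum>a<d. \<sigma> a * U $$ (j, a) * (\<Sum>r<d. A $$ (i, r) * V $$ (r, a)))"
    by (subst sum.swap) (simp add: sum_distrib_left)
  also have "\<dots> = (\<Sum>a<d. \<sigma> a * U $$ (j, a) * (\<sigma> a * U $$ (i, a)))"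
    using svd_right_mult[OF assms(1-3)] by simp
  finally show ?thesis by (simp add: outer_sum_def power2_eq_square mult_ac)
qed

text \<open>The trace of a spectral sum. Weights \<open>(\<sigma> a)\<^sup>2\<close> give the
  squared Frobenius norm, weights 1 give \<open>k\<close> as the total leverage.\<close>

lemma frame_sum_diag:
  assumes "frame n m (\<lambda>_. 1) u" "k \<le> m"
  shows "(\<Sum>i<n. outer_sum k s u i i) = (\<Sum>a<k. s a)"
proof -
  have "(\<Sum>i<n. outer_sum k s u i i) = (\<Sum>a<k. s a * ip n (u a) (u a))"
    unfolding outer_sum_def ip_def sum_distrib_left by (subst sum.swap) (simp add: mult.assoc)
  also have "\<dots> = (\<Sum>a<k. s a)"
    using frame_ip[OF assms(1)] assms(2) by (intro sum.cong refl) simp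
  finally show ?thesis .
qed

text \<open>The projection onto the frame has diagonal entries at most 1 and trace \<open>m\<close>.
  For a thin left factor this yields d <= n, which the running time relies on.\<close>

lemma frame_dim_le:
  assumes "frame n m (\<lambda>_. 1) u"
  shows "m \<le> n"
proof -
  have "outer_sum m (\<lambda>_. 1) u i i \<le> 1" if i: "i < n" for i
  proof -
    have x: "ip n (\<lambda>j. if j = i then 1 else 0) y = y i" for y
      using i by (simp add: ip_def if_distrib[of "\<lambda>x. x * _"] cong: if_cong)
    show ?thesis
      using bessel[OF assms, of "\<lambda>j. if j = i then 1 else 0"]
      by (simp add: x outer_sum_def power2_eq_square)
  qed
  then have "(\<Sum>i<n. outer_sum m (\<lambda>_. 1) u i i) \<le> (\<Sum>i<n. 1)" by (intro sum_mono) auto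
  then show ?thesis using frame_sum_diag[OF assms order_refl, of "\<lambda>_. 1"] by simp
qed

text \<open>Orthonormality reduces the left side to the l2 norm of the weights, which is at most
  their l1 norm.\<close>

lemma hs_norm_outer_sum_le:
  assumes "frame n m (\<lambda>_. 1) u" "\<And>a. s a \<ge> 0"
  shows "hs_norm n (outer_sum m s u) \<le> (\<Sum>a<m. s a)"
proof -
  have "hs n (outer_sum m s u) (outer_sum m s u) = (\<Sum>a<m. \<Sum>b<m. if a = b then s a * s a else 0)"
    unfolding hs_outer_sum by (intro sum.cong refl) (simp add: frame_ip[OF assms(1)])
  also have "\<dots> = (\<Sum>a<m. s a * s a)" by simp
  also have "\<dots> \<le> (\<Sum>a<m. s a * (\<Sum>b<m. s b))"
    using assms(2) by (intro sum_mono mult_left_mono member_le_sum) auto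
  also have "\<dots> = (\<Sum>a<m. s a)\<^sup>2" by (simp add: sum_distrib_right power2_eq_square)
  finally show ?thesis
    unfolding hs_norm_square[symmetric] by (rule power2_le_imp_le) (simp add: sum_nonneg assms(2))
qed

lemma frob_norm_svd:
  assumes "is_svd A U \<sigma> V" "A \<in> carrier_mat n d"
  shows "(frob_norm A)\<^sup>2 = (\<Sum>j<d. (\<sigma> j)\<^sup>2)"
    and "(frob_norm A)\<^sup>2 = (\<Sum>i<n. \<Sum>r<d. (A $$ (i, r))\<^sup>2)"
proof -
  show 1: "(frob_norm A)\<^sup>2 = (\<Sum>i<n. \<Sum>r<d. (A $$ (i, r))\<^sup>2)"
    using assms(2) by (simp add: frob_norm_def sum_nonneg)
  also have "\<dots> = (\<Sum>i<n. outer_sum d (\<lambda>a. (\<sigma> a)\<^sup>2) (\<lambda>a i. U $$ (i, a)) i i)"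
    using svd_gram[OF assms] by (simp add: power2_eq_square)
  also have "\<dots> = (\<Sum>j<d. (\<sigma> j)\<^sup>2)" by (rule frame_sum_diag[OF svd_frame[OF assms] order_refl])
  finally show "(frob_norm A)\<^sup>2 = (\<Sum>j<d. (\<sigma> j)\<^sup>2)" .
qed

text \<open>
  For \<open>x\<close> and \<open>y\<close> the right and left singular vectors, \<open>G x = D y\<close> and \<open>G y = D x\<close>, so
  \<open>x - y\<close> belongs to the eigenvalue \<open>- D\<close> of the positive semidefinite \<open>G\<close>.
\<close>

lemma svd_psd_eigenvector:
  assumes G: "is_svd G U D W" "G \<in> carrier_mat l l"
    and GM: "\<And>c c'. c < l \<Longrightarrow> c' < l \<Longrightarrow> G $$ (c, c') = (\<Sum>i<n. M i c * M i c' :: real)"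
    and c: "c < l" "a < l"
  shows "(\<Sum>c'<l. G $$ (c, c') * W $$ (c', a)) = D a * W $$ (c, a)"
proof -
  define z where "z c = W $$ (c, a) - U $$ (c, a)" for c
  have 1: "(\<Sum>c'<l. G $$ (c, c') * W $$ (c', a)) = D a * U $$ (c, a)" if "c < l" for c
    by (rule svd_right_mult[OF G that c(2)])
  have 2: "(\<Sum>c'<l. G $$ (c, c') * U $$ (c', a)) = D a * W $$ (c, a)" if "c < l" for c
  proof -
    have "(\<Sum>c'<l. G $$ (c, c') * U $$ (c', a)) = (\<Sum>c'<l. G $$ (c', c) * U $$ (c', a))"
      using GM that by (intro sum.cong refl) (simp add: mult.commute)
    then show ?thesis using svd_left_mult[OF G that c(2)] by simp
  qed
  have Gz: "(\<Sum>c'<l. G $$ (c, c') * z c') = - D a * z c" if "c < l" for c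
    using 1[OF that] 2[OF that]
    by (simp add: z_def right_diff_distrib sum_subtractf algebra_simps)
  \<comment> \<open>The quadratic form of \<open>G\<close> at \<open>z\<close> is a sum of squares
    and equals minus \<open>D a\<close> times the squared norm of \<open>z\<close>, so both
    vanish.\<close>
  have "0 \<le> (\<Sum>i<n. (\<Sum>c<l. M i c * z c)\<^sup>2)" by (intro sum_nonneg) simp
  also have "\<dots> = (\<Sum>i<n. \<Sum>c<l. \<Sum>c'<l. z c * z c' * (M i c * M i c'))"
    by (simp add: power2_eq_square sum_product mult_ac)
  also have "\<dots> = (\<Sum>c<l. \<Sum>c'<l. \<Sum>i<n. z c * z c' * (M i c * M i c'))" by (rule sum_rotate)
  also have "\<dots> = (\<Sum>c<l. \<Sum>c'<l. z c * z c' * G $$ (c, c'))"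
    by (intro sum.cong refl) (simp add: sum_distrib_left[symmetric] GM)
  also have "\<dots> = (\<Sum>c<l. z c * (\<Sum>c'<l. G $$ (c, c') * z c'))"
    by (simp add: sum_distrib_left mult_ac)
  also have "\<dots> = (\<Sum>c<l. - D a * (z c)\<^sup>2)" by (simp add: Gz power2_eq_square) (simp add: mult_ac)
  also have "\<dots> = - (\<Sum>c<l. D a * (z c)\<^sup>2)" by (simp add: sum_negf)
  finally have "(\<Sum>c<l. D a * (z c)\<^sup>2) = 0"
    using svd_values(2)[OF G(1), of a] by (intro antisym sum_nonneg) auto
  then have "D a * (z c)\<^sup>2 = 0"
    using svd_values(2)[OF G(1), of a] c(1) by (subst (asm) sum_nonneg_eq_0_iff) auto
  then have "D a * W $$ (c, a) = D a * U $$ (c, a)" by (auto simp: z_def)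
  then show ?thesis unfolding 1[OF c(1)] by (rule sym)
qed

section \<open>The SVD of the sketch as a frame\<close>

locale sketch =
  fixes A :: "real mat" and R :: "real mat" and n d l k :: nat and svd :: svd_routine
  assumes A: "A \<in> carrier_mat n d" and R: "R \<in> carrier_mat d l" and svd: "valid_svd_routine svd"
    and kl: "k \<le> l"
begin

definition "M = A * R"
definition "D = fst (snd (svd (transpose_mat M * M)))"
definition "W = snd (snd (svd (transpose_mat M * M)))"
definition "e a = (if D a = 0 then 0 else 1 :: real)"
definition "Mw a i = (\<Sum>c<l. M $$ (i, c) * W $$ (c, a))"
text \<open>The left singular vectors of \<open>M\<close>, recovered from the right ones. Since
  division by 0 gives 0, \<open>w a\<close> is the zero vector where \<open>D a = 0\<close>,
  matching \<open>e a = 0\<close>.\<close>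

definition "w a i = Mw a i / sqrt (D a)"

lemma M: "M \<in> carrier_mat n l" using A R by (simp add: M_def)

lemma M_entry: "i < n \<Longrightarrow> c < l \<Longrightarrow> M $$ (i, c) = (\<Sum>r<d. R $$ (r, c) * A $$ (i, r))"
  using A R by (simp add: M_def scalar_prod_def atLeast0LessThan mult.commute)

lemma gram_carrier: "transpose_mat M * M \<in> carrier_mat l l" using M by simp

lemma gram_svd: "is_svd (transpose_mat M * M) (fst (svd (transpose_mat M * M))) D W"
  using svd gram_carrier unfolding valid_svd_routine_def D_def W_def
  by (metis (no_types, lifting) case_prod_beta' )

lemma gram_entry: "c < l \<Longrightarrow> c' < l \<Longrightarrow> (transpose_mat M * M) $$ (c, c') = (\<Sum>i<n. M $$ (i, c) * M $$ (i, c'))"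
  using M by (simp add: scalar_prod_def atLeast0LessThan)

lemma D_nonneg: "D a \<ge> 0" and D_antimono: "antimono D"
  using svd_values[OF gram_svd] by auto

text \<open>(M W)^T (M W) = W^T (M^T M) W = diag D. The last equality needs the columns of
  \<open>W\<close> to be eigenvectors and not merely right singular vectors, hence
  \<open>svd_psd_eigenvector\<close>.\<close>

lemma Mw_ip:
  assumes "a < l" "b < l"
  shows "ip n (Mw a) (Mw b) = (if a = b then D a else 0)"
proof -
  note W = is_svdD(2,4)[OF gram_svd gram_carrier]
  have "ip n (Mw a) (Mw b) = (\<Sum>i<n. \<Sum>c<l. \<Sum>c'<l. W $$ (c, a) * W $$ (c', b) * (M $$ (i, c) * M $$ (i, c')))"
    by (simp add: ip_def Mw_def sum_product mult_ac)
  also have "\<dots> = (\<Sum>c<l. \<Sum>c'<l. \<Sum>i<n. W $$ (c, a) * W $$ (c', b) * (M $$ (i, c) * M $$ (i, c')))"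
    by (rule sum_rotate)
  also have "\<dots> = (\<Sum>c<l. \<Sum>c'<l. W $$ (c, a) * W $$ (c', b) * (transpose_mat M * M) $$ (c, c'))"
    by (intro sum.cong refl) (simp add: sum_distrib_left[symmetric] gram_entry del: index_mult_mat)
  also have "\<dots> = (\<Sum>c<l. W $$ (c, a) * (\<Sum>c'<l. (transpose_mat M * M) $$ (c, c') * W $$ (c', b)))"
    by (simp add: sum_distrib_left mult_ac del: index_mult_mat)
  also have "\<dots> = (\<Sum>c<l. D b * (W $$ (c, a) * W $$ (c, b)))"
    using svd_psd_eigenvector[OF gram_svd gram_carrier gram_entry _ assms(2)]
    by (simp add: mult_ac del: index_mult_mat)
  also have "\<dots> = D b * (if a = b then 1 else 0)"
    unfolding sum_distrib_left[symmetric] orthogonal_cols[OF W assms] ..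
  finally show ?thesis by simp
qed

lemma Mw_zero:
  assumes "a < l" "i < n" "D a = 0"
  shows "Mw a i = 0"
proof -
  have "(\<Sum>i<n. Mw a i * Mw a i) = 0" using Mw_ip[OF assms(1,1)] assms(3) by (simp add: ip_def)
  then have "\<forall>i\<in>{..<n}. Mw a i * Mw a i = 0" by (subst (asm) sum_nonneg_eq_0_iff) auto
  then show ?thesis using assms(2) by simp
qed

lemma w_frame: "frame n l e w"
  unfolding frame_def
proof (intro conjI allI impI)
  fix a b assume ab: "a < l" "b < l"
  have "ip n (w a) (w b) = ip n (Mw a) (Mw b) / (sqrt (D a) * sqrt (D b))"
    by (simp add: ip_def w_def sum_divide_distrib)
  then show "ip n (w a) (w b) = (if a = b then e a else 0)"
    using D_nonneg[of b] by (simp add: Mw_ip[OF ab] e_def)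
qed (simp add: e_def)

text \<open>The square roots cancel; where \<open>D a = 0\<close> both sides vanish by
  \<open>Mw_zero\<close>.\<close>

lemma w_scaled: "a < l \<Longrightarrow> i < n \<Longrightarrow> D a * w a i * w a j = Mw a i * Mw a j"
  using D_nonneg[of a] Mw_zero[of a i] by (cases "D a = 0") (auto simp: w_def)

text \<open>\<open>W\<close> is square and orthogonal, so M W W^T M^T = M M^T.\<close>

lemma sketched_gram:
  assumes "i < n" "j < n"
  shows "outer_sum l D w i j = (\<Sum>c<l. M $$ (i, c) * M $$ (j, c))"
proof -
  note W = is_svdD(2,4)[OF gram_svd gram_carrier]
  have "outer_sum l D w i j = (\<Sum>a<l. Mw a i * Mw a j)"
    unfolding outer_sum_def using w_scaled assms by (intro sum.cong refl) auto
  also have "\<dots> = (\<Sum>a<l. \<Sum>c<l. \<Sum>c'<l. M $$ (i, c) * M $$ (j, c') * (W $$ (c, a) * W $$ (c', a)))"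
    by (simp add: Mw_def sum_product mult_ac)
  also have "\<dots> = (\<Sum>c<l. \<Sum>c'<l. \<Sum>a<l. M $$ (i, c) * M $$ (j, c') * (W $$ (c, a) * W $$ (c', a)))"
    by (rule sum_rotate)
  also have "\<dots> = (\<Sum>c<l. \<Sum>c'<l. if c = c' then M $$ (i, c) * M $$ (j, c) else 0)"
    unfolding sum_distrib_left[symmetric]
    by (intro sum.cong refl) (simp add: orthogonal_rows[OF W])
  finally show ?thesis by simp
qed

lemma sketch_vec_entry:
  assumes "i < n" "a < k"
  shows "(transpose_mat (sketch_vecs svd k M) *\<^sub>v (transpose_mat R *\<^sub>v row A i)) $ a = Mw a i"
proof -
  have S: "sketch_vecs svd k M = mat l k (\<lambda>(i, j). W $$ (i, j))"
    using M by (simp add: sketch_vecs_def W_def case_prod_beta')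
  have y: "(transpose_mat R *\<^sub>v row A i) $ c = M $$ (i, c)" if "c < l" for c
    using A R that assms by (simp add: M_def scalar_prod_def mult.commute)
  have "(transpose_mat (mat l k (\<lambda>(i, j). W $$ (i, j))) *\<^sub>v x) $ a = (\<Sum>c<l. W $$ (c, a) * x $ c)"
    if "dim_vec x = l" for x
    using assms(2) that by (simp add: scalar_prod_def atLeast0LessThan)
  moreover have "dim_vec (transpose_mat R *\<^sub>v row A i) = l" using R by simp
  ultimately have "(transpose_mat (mat l k (\<lambda>(i, j). W $$ (i, j))) *\<^sub>v (transpose_mat R *\<^sub>v row A i)) $ a =
      (\<Sum>c<l. W $$ (c, a) * (transpose_mat R *\<^sub>v row A i) $ c)" by blast
  also have "\<dots> = Mw a i" unfolding Mw_def using y by (intro sum.cong refl) (simp add: mult.commute)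
  finally show ?thesis unfolding S .
qed

lemma sketch_vec_dim:
  "dim_vec (transpose_mat (sketch_vecs svd k M) *\<^sub>v (transpose_mat R *\<^sub>v row A i)) = k"
  by (simp add: sketch_vecs_def case_prod_beta')

lemma est_lev_eq:
  assumes "i < n"
  shows "est_lev svd k A R i = outer_sum k (\<lambda>_. 1) w i i"
proof -
  let ?y = "transpose_mat (sketch_vecs svd k M) *\<^sub>v (transpose_mat R *\<^sub>v row A i)"
  let ?z = "mat_diag k (\<lambda>j. 1 / sketch_sv svd M j) *\<^sub>v ?y"
  have sv: "sketch_sv svd M a = sqrt (D a)" for a
    by (simp add: sketch_sv_def D_def case_prod_beta')
  have z: "?z $ a = w a i" if a: "a < k" for a
  proof -
    have "?z $ a = (\<Sum>b<k. (if a = b then 1 / sqrt (D b) else 0) * ?y $ b)"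
      using a sketch_vec_dim[of i]
      by (simp add: mat_diag_def scalar_prod_def atLeast0LessThan sv del: index_mult_mat_vec)
        (simp add: scalar_prod_def atLeast0LessThan)
    also have "\<dots> = (\<Sum>b<k. if a = b then 1 / sqrt (D b) * ?y $ b else 0)"
      by (intro sum.cong refl) (simp del: index_mult_mat_vec)
    finally show ?thesis using a sketch_vec_entry[OF assms a] by (simp add: w_def del: index_mult_mat_vec)
  qed
  have dz: "dim_vec ?z = k" by (simp add: mat_diag_def)
  have "est_lev svd k A R i = (\<Sum>a<k. ?z $ a * ?z $ a)"
    unfolding est_lev_def sq_norm2_def M_def[symmetric] scalar_prod_def atLeast0LessThan dz ..
  then show ?thesis using z by (simp add: outer_sum_def del: index_mult_mat_vec)
qed

lemma est_dist_eq:
  assumes "i < n"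
  shows "est_dist svd k A R i = (\<Sum>r<d. (A $$ (i, r))\<^sup>2) - outer_sum k D w i i"
proof -
  let ?y = "transpose_mat (sketch_vecs svd k M) *\<^sub>v (transpose_mat R *\<^sub>v row A i)"
  have "sq_norm2 ?y = (\<Sum>a<k. ?y $ a * ?y $ a)"
    unfolding sq_norm2_def scalar_prod_def atLeast0LessThan sketch_vec_dim ..
  also have "\<dots> = (\<Sum>a<k. Mw a i * Mw a i)"
    using sketch_vec_entry[OF assms] by simp
  also have "\<dots> = outer_sum k D w i i"
    unfolding outer_sum_def using w_scaled assms kl by (intro sum.cong refl) simp
  finally have "sq_norm2 ?y = outer_sum k D w i i" .
  moreover have "sq_norm2 (row A i) = (\<Sum>r<d. (A $$ (i, r))\<^sup>2)"
    using A assms by (simp add: sq_norm2_def scalar_prod_def atLeast0LessThan power2_eq_square)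
  ultimately show ?thesis by (simp add: est_dist_def M_def)
qed

end

section \<open>Deterministic accuracy of the estimates\<close>

lemma lev_score_eq:
  assumes "is_svd A U \<sigma> V" "A \<in> carrier_mat n d" "i < n" "k \<le> d" "\<And>j. j < d \<Longrightarrow> \<sigma> j > 0"
  shows "lev_score A \<sigma> V k i = outer_sum k (\<lambda>_. 1) (\<lambda>a i. U $$ (i, a)) i i"
  unfolding lev_score_def outer_sum_def
proof (rule sum.cong[OF refl])
  fix j assume "j \<in> {..<k}"
  then have j: "j < d" using assms(4) by simp
  note V = is_svdD(2)[OF assms(1,2)]
  have "scalar_prod (row A i) (col V j) = \<sigma> j * U $$ (i, j)"
    using svd_right_mult[OF assms(1-3) j] assms(2,3) V j by (simp add: scalar_prod_def atLeast0LessThan)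
  then show "(row A i \<bullet> col V j)\<^sup>2 / (\<sigma> j)\<^sup>2 = 1 * U $$ (i, j) * U $$ (i, j)"
    using assms(5)[OF j] by (simp add: power2_eq_square)
qed

text \<open>The squared row norm is the sum over all \<open>d\<close> directions. Written this way
  it cancels against the exact row norm in the estimate, and only the top \<open>k\<close>
  directions have to be compared.\<close>

lemma proj_dist_eq:
  assumes "is_svd A U \<sigma> V" "A \<in> carrier_mat n d" "i < n" "k \<le> d"
  shows "proj_dist A V k i = (\<Sum>r<d. (A $$ (i, r))\<^sup>2) - outer_sum k (\<lambda>a. (\<sigma> a)\<^sup>2) (\<lambda>a i. U $$ (i, a)) i i"
proof -
  note V = is_svdD(2)[OF assms(1,2)]
  have "proj_dist A V k i = (\<Sum>j=k..<d. (\<sigma> j)\<^sup>2 * U $$ (i, j) * U $$ (i, j))"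
    unfolding proj_dist_def
  proof (intro sum.cong)
    fix j assume "j \<in> {k..<d}"
    then have j: "j < d" by simp
    have "scalar_prod (row A i) (col V j) = \<sigma> j * U $$ (i, j)"
      using svd_right_mult[OF assms(1-3) j] assms(2,3) V j by (simp add: scalar_prod_def atLeast0LessThan)
    then show "(row A i \<bullet> col V j)\<^sup>2 = (\<sigma> j)\<^sup>2 * U $$ (i, j) * U $$ (i, j)"
      by (simp add: power2_eq_square)
  qed (use assms(2) in simp)
  moreover have "(\<Sum>r<d. (A $$ (i, r))\<^sup>2) = (\<Sum>j<d. (\<sigma> j)\<^sup>2 * U $$ (i, j) * U $$ (i, j))"
    using svd_gram[OF assms(1-3,3)] by (simp add: power2_eq_square outer_sum_def)
  moreover have "(\<Sum>j<d. f j) = (\<Sum>j<k. f j) + (\<Sum>j=k..<d. f j)" for f :: "nat \<Rightarrow> real"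
    using assms(4) by (metis atLeast0LessThan le0 sum.atLeastLessThan_concat)
  ultimately show ?thesis by (simp add: outer_sum_def)
qed

text \<open>The 8 in the error bound \<eta> makes \<pi> at most \<epsilon> / 4. The factor sqrt k is
  absorbed on the right: the leverage scores sum to \<open>k\<close>, and k * \<eta> is at most
  \<epsilon> / 8 times the squared Frobenius norm.\<close>

lemma estimates_accurate:
  assumes A: "A \<in> carrier_mat n d" and A_svd: "is_svd A U \<sigma> V" and R: "R \<in> carrier_mat d l"
    and svd: "valid_svd_routine svd" and k: "1 \<le> k" "k \<le> d" "k \<le> l"
    and pos: "\<sigma> (d - 1) > 0" and sep: "separated \<sigma> k \<Delta>"
    and \<epsilon>: "0 < \<epsilon>" "\<epsilon> \<le> 1" and \<Delta>: "\<Delta> > 0"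
    and err: "(\<Sum>i<n. \<Sum>j<n. ((\<Sum>c<l. (\<Sum>r<d. R $$ (r, c) * A $$ (i, r)) * (\<Sum>r<d. R $$ (r, c) * A $$ (j, r)))
        - (\<Sum>r<d. A $$ (i, r) * A $$ (j, r)))\<^sup>2) \<le> (\<epsilon> * \<Delta> / 8 * (\<sigma> 0)\<^sup>2)\<^sup>2"
  shows "(\<Sum>i<n. \<bar>proj_dist A V k i - est_dist svd k A R i\<bar>) \<le> \<epsilon> * (frob_norm A)\<^sup>2"
    and "(\<Sum>i<n. \<bar>lev_score A \<sigma> V k i - est_lev svd k A R i\<bar>) \<le> \<epsilon> * (\<Sum>i<n. lev_score A \<sigma> V k i)"
proof -
  interpret sketch A R n d l k svd by unfold_locales (use A R svd k in auto)
  define u where "u = (\<lambda>a i. U $$ (i, a))"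
  define s where "s = (\<lambda>a. (\<sigma> a)\<^sup>2)"
  define \<eta> where "\<eta> = \<epsilon> * \<Delta> / 8 * (\<sigma> 0)\<^sup>2"
  define \<pi> where "\<pi> = 2 * \<eta> / (s (k - 1) - s k)"
  define F where "F = (frob_norm A)\<^sup>2"
  have u: "frame n d (\<lambda>_. 1) u" unfolding u_def by (rule svd_frame[OF A_svd A])
  have \<sigma>: "\<sigma> j > 0" if "j < d" for j
  proof -
    have "j \<le> d - 1" using that by simp
    then show ?thesis using antimonoD[OF svd_values(1)[OF A_svd], of j "d - 1"] pos by linarith
  qed
  have s: "antimono s" "\<And>a. s a \<ge> 0"
    using svd_values[OF A_svd] by (auto simp: s_def antimono_def intro!: power_mono)
  have \<sigma>0: "(\<sigma> 0)\<^sup>2 > 0" using \<sigma>[of 0] k by simp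
  have gap: "s (k - 1) - s k \<ge> \<Delta> * (\<sigma> 0)\<^sup>2" using sep by (simp add: separated_def s_def)
  then have gap0: "s (k - 1) - s k > 0" using mult_pos_pos[OF \<Delta> \<sigma>0] by linarith
  have \<eta>0: "\<eta> \<ge> 0" using \<epsilon> \<Delta> by (simp add: \<eta>_def)
  have E: "hs_norm n (\<lambda>i j. outer_sum d s u i j - outer_sum l D w i j) \<le> \<eta>"
  proof (rule power2_le_imp_le)
    have "(hs_norm n (\<lambda>i j. outer_sum d s u i j - outer_sum l D w i j))\<^sup>2 =
        (\<Sum>i<n. \<Sum>j<n. (outer_sum d s u i j - outer_sum l D w i j)\<^sup>2)"
      unfolding hs_norm_square hs_def sum.cartesian_product by (simp add: power2_eq_square case_prod_beta')
    also have "\<dots> = (\<Sum>i<n. \<Sum>j<n. ((\<Sum>c<l. (\<Sum>r<d. R $$ (r, c) * A $$ (i, r)) * (\<Sum>r<d. R $$ (r, c) * A $$ (j, r)))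
        - (\<Sum>r<d. A $$ (i, r) * A $$ (j, r)))\<^sup>2)"
      using svd_gram[OF A_svd A]
      by (intro sum.cong refl) (simp add: sketched_gram M_entry u_def s_def power2_commute)
    finally show "(hs_norm n (\<lambda>i j. outer_sum d s u i j - outer_sum l D w i j))\<^sup>2 \<le> \<eta>\<^sup>2"
      using err by (simp add: \<eta>_def)
  qed (rule \<eta>0)
  have pert: "(\<Sum>i<n. \<bar>outer_sum k (\<lambda>_. 1) u i i - outer_sum k (\<lambda>_. 1) w i i\<bar>) \<le> 2 * sqrt k * \<pi>"
    "(\<Sum>i<n. \<bar>outer_sum k s u i i - outer_sum k D w i i\<bar>) \<le>
      sqrt k * \<eta> + \<pi> * (hs_norm n (outer_sum d s u) + \<eta>)"
    using projection_perturbation[OF u w_frame s D_antimono D_nonneg _ k gap0 E]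
    unfolding \<pi>_def by (auto simp: e_def split: if_splits)
  have \<pi>: "\<pi> \<le> \<epsilon> / 4" "\<pi> \<ge> 0"
  proof -
    have "2 * \<eta> = \<epsilon> / 4 * (\<Delta> * (\<sigma> 0)\<^sup>2)" by (simp add: \<eta>_def)
    also have "\<dots> \<le> \<epsilon> / 4 * (s (k - 1) - s k)" using gap \<epsilon> by (intro mult_left_mono) auto
    finally show "\<pi> \<le> \<epsilon> / 4" using gap0 by (simp add: \<pi>_def pos_divide_le_eq)
    show "\<pi> \<ge> 0" using \<eta>0 gap0 by (simp add: \<pi>_def)
  qed
  have sqrtk: "sqrt (real k) \<le> real k"
    using k(1) by (intro real_le_lsqrt) (auto simp: power2_eq_square)
  \<comment> \<open>Separation bounds \<open>\<Delta> * (\<sigma> 0)\<^sup>2\<close> by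
    \<open>s (k - 1)\<close>, and each of the top \<open>k\<close> eigenvalues is at least
    \<open>s (k - 1)\<close>.\<close>
  have FkD: "real k * (\<Delta> * (\<sigma> 0)\<^sup>2) \<le> F"
  proof -
    have "s k \<ge> 0" using s(2) .
    then have "real k * (\<Delta> * (\<sigma> 0)\<^sup>2) \<le> real k * s (k - 1)" using gap by (intro mult_left_mono) auto
    also have "\<dots> = (\<Sum>j<k. s (k - 1))" by simp
    also have "\<dots> \<le> (\<Sum>j<k. s j)" using antimonoD[OF s(1)] by (intro sum_mono) auto
    also have "\<dots> \<le> (\<Sum>j<d. s j)" using k s(2) by (intro sum_mono2) auto
    also have "\<dots> = F" by (simp add: F_def frob_norm_svd(1)[OF A_svd A] s_def)
    finally show ?thesis .
  qed
  have B: "hs_norm n (outer_sum d s u) \<le> F"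
    using hs_norm_outer_sum_le[OF u s(2)] by (simp add: F_def frob_norm_svd(1)[OF A_svd A] s_def)
  have k\<eta>: "real k * \<eta> \<le> \<epsilon> / 8 * F"
    using mult_left_mono[OF FkD, of "\<epsilon> / 8"] \<epsilon> by (simp add: \<eta>_def mult_ac)
  have \<eta>F: "\<eta> \<le> F / 8"
  proof -
    have "\<eta> \<le> real k * \<eta>" using k(1) \<eta>0 by (simp add: mult_le_cancel_right1)
    also have "\<dots> \<le> F / 8" using k\<eta> mult_right_mono[OF \<epsilon>(2), of F] by (simp add: F_def)
    finally show ?thesis .
  qed
  have "(\<Sum>i<n. \<bar>proj_dist A V k i - est_dist svd k A R i\<bar>) =
      (\<Sum>i<n. \<bar>outer_sum k s u i i - outer_sum k D w i i\<bar>)"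
    using k by (intro sum.cong refl)
      (simp add: proj_dist_eq[OF A_svd A] est_dist_eq u_def s_def abs_minus_commute)
  also have "\<dots> \<le> sqrt k * \<eta> + \<pi> * (hs_norm n (outer_sum d s u) + \<eta>)" by (rule pert(2))
  \<comment> \<open>In units of \<epsilon> * F the total is at most 1/8 + 9/32, below 1.\<close>
  also have "\<dots> \<le> real k * \<eta> + \<epsilon> / 4 * (F + F / 8)"
    using sqrtk \<eta>0 \<pi> B \<eta>F hs_norm_nonneg[of n "outer_sum d s u"] \<epsilon>
    by (intro add_mono mult_mono) auto
  also have "\<dots> \<le> \<epsilon> * F"
  proof -
    have "0 \<le> \<epsilon> * F" using \<epsilon> by (simp add: F_def)
    then show ?thesis using k\<eta> by (simp add: algebra_simps)
  qed
  finally show "(\<Sum>i<n. \<bar>proj_dist A V k i - est_dist svd k A R i\<bar>) \<le> \<epsilon> * (frob_norm A)\<^sup>2"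
    by (simp add: F_def)
  have "(\<Sum>i<n. \<bar>lev_score A \<sigma> V k i - est_lev svd k A R i\<bar>) =
      (\<Sum>i<n. \<bar>outer_sum k (\<lambda>_. 1) u i i - outer_sum k (\<lambda>_. 1) w i i\<bar>)"
    using k \<sigma> by (intro sum.cong refl) (simp add: lev_score_eq[OF A_svd A] est_lev_eq u_def)
  also have "\<dots> \<le> 2 * sqrt k * \<pi>" by (rule pert(1))
  also have "\<dots> \<le> 2 * real k * (\<epsilon> / 4)"
    using sqrtk \<pi> by (intro mult_mono) auto
  also have "\<dots> \<le> \<epsilon> * real k" using \<epsilon> by simp
  also have "real k = (\<Sum>i<n. lev_score A \<sigma> V k i)"
    using k \<sigma> frame_sum_diag[OF u k(2), of "\<lambda>_. 1"] by (simp add: lev_score_eq[OF A_svd A] u_def)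
  finally show "(\<Sum>i<n. \<bar>lev_score A \<sigma> V k i - est_lev svd k A R i\<bar>) \<le>
    \<epsilon> * (\<Sum>i<n. lev_score A \<sigma> V k i)" .
qed

section \<open>Correctness and cost of the streaming algorithm\<close>

lemma prog_simps [simp]:
  "result_of (ret x) = x" "time_of (ret x) = 0" "space_of (ret x) = 0"
  "result_of (bind_prog p f) = result_of (f (result_of p))"
  "time_of (bind_prog p f) = time_of p + time_of (f (result_of p))"
  "space_of (bind_prog p f) = max (space_of p) (space_of (f (result_of p)))"
  "result_of (hold c p) = result_of p" "time_of (hold c p) = time_of p"
  "space_of (hold c p) = c + space_of p"
  "result_of tick = ()" "time_of tick = 1" "space_of tick = 0"
  "result_of (elem y) = y" "time_of (elem y) = 1" "space_of (elem y) = 1"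
  "result_of (query \<tau> y) = y" "time_of (query \<tau> y) = \<tau>" "space_of (query \<tau> y) = \<tau>"
  "result_of (zeros c) = replicate c 0" "time_of (zeros c) = c" "space_of (zeros c) = c"
  by (simp_all add: ret_def bind_prog_def hold_def tick_def elem_def query_def zeros_def Let_def)

lemma result_collect [simp]: "result_of (collect c f xs) = map (\<lambda>x. result_of (f x)) xs"
  by (induction xs) auto

lemma time_collect:
  assumes "\<And>x. x \<in> set xs \<Longrightarrow> time_of (f x) \<le> T"
  shows "time_of (collect c f xs) \<le> length xs * (T + 1)"
  using assms
proof (induction xs)
  case (Cons x xs)
  have "time_of (f x) \<le> T" "time_of (collect c f xs) \<le> length xs * (T + 1)"
    using Cons by auto
  then show ?case by simp
qed simp

text \<open>Stored results account for \<open>c\<close> cells each, while only one call of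
  \<open>f\<close> is live at a time.\<close>

lemma space_collect:
  assumes "\<And>x. x \<in> set xs \<Longrightarrow> space_of (f x) \<le> S"
  shows "space_of (collect c f xs) \<le> length xs * c + S"
  using assms
proof (induction xs)
  case (Cons x xs)
  have "space_of (f x) \<le> S" "space_of (collect c f xs) \<le> length xs * c + S"
    using Cons by auto
  then show ?case by simp
qed simp

text \<open>\<open>I\<close> is an invariant of the loop state, typically its length, on which the
  cost of the body depends. Time adds up over the iterations, with one tick each; space is a maximum
  over them.\<close>

lemma loop_cost:
  assumes "\<And>x s. x \<in> set xs \<Longrightarrow> I s \<Longrightarrow>
      I (result_of (f x s)) \<and> time_of (f x s) \<le> T \<and> sz s + space_of (f x s) \<le> S"
    and "I s"
  shows "I (result_of (loop sz f xs s)) \<and> time_of (loop sz f xs s) \<le> length xs * (T + 1) \<and>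
    space_of (loop sz f xs s) \<le> S"
  using assms
proof (induction xs arbitrary: s)
  case (Cons x xs)
  have x: "I (result_of (f x s))" "time_of (f x s) \<le> T" "sz s + space_of (f x s) \<le> S"
    using Cons.prems by auto
  have "I (result_of (loop sz f xs (result_of (f x s)))) \<and>
    time_of (loop sz f xs (result_of (f x s))) \<le> length xs * (T + 1) \<and>
    space_of (loop sz f xs (result_of (f x s))) \<le> S"
    using Cons.prems x(1) by (intro Cons.IH) auto
  then show ?case using x by simp
qed simp

lemma enumerate_conv_map: "List.enumerate 0 xs = map (\<lambda>j. (j, xs ! j)) [0..<length xs]"
  by (rule nth_equalityI) (auto simp: nth_enumerate_eq)

lemma add_entry_result:
  "result_of (add_entry \<tau> E r x y) = map (\<lambda>j. y ! j + E r j * x) [0..<length y]"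
  by (simp add: add_entry_def enumerate_conv_map case_prod_beta')

lemma add_entry_cost:
  "time_of (add_entry \<tau> E r x y) \<le> length y * (\<tau> + 3)"
  "space_of (add_entry \<tau> E r x y) \<le> length y + \<tau> + 2"
proof -
  have "time_of (add_entry \<tau> E r x y) \<le> length (List.enumerate 0 y) * ((\<tau> + 2) + 1)"
    unfolding add_entry_def by (rule time_collect) (auto simp: case_prod_beta')
  then show "time_of (add_entry \<tau> E r x y) \<le> length y * (\<tau> + 3)" by (simp add: algebra_simps)
  have "space_of (add_entry \<tau> E r x y) \<le> length (List.enumerate 0 y) * 1 + (\<tau> + 2)"
    unfolding add_entry_def by (rule space_collect) (auto simp: case_prod_beta')
  then show "space_of (add_entry \<tau> E r x y) \<le> length y + \<tau> + 2" by simp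
qed

text \<open>Stated for enumeration from any \<open>m\<close> and any start \<open>y\<close>, since
  the induction consumes the row from the front.\<close>

lemma sketch_loop_result:
  "result_of (loop length (\<lambda>(r, x) y. hold 1 (add_entry \<tau> E r x y)) (List.enumerate m a) y) =
   map (\<lambda>j. y ! j + (\<Sum>r<length a. E (m + r) j * a ! r)) [0..<length y]"
proof (induction a arbitrary: m y)
  case Nil
  then show ?case by (simp add: map_nth)
next
  case (Cons x a)
  then show ?case by (simp add: add_entry_result sum.lessThan_Suc_shift del: sum.lessThan_Suc)
qed

lemma sketch_row_result:
  "result_of (sketch_row \<tau> l E a) = map (\<lambda>j. \<Sum>r<length a. E r j * a ! r) [0..<l]"
  by (simp add: sketch_row_def sketch_loop_result del: One_nat_def)

lemma sketch_row_cost: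
  "time_of (sketch_row \<tau> l E a) \<le> l + length a * (l * (\<tau> + 3) + 1)"
  "space_of (sketch_row \<tau> l E a) \<le> 2 * l + \<tau> + 3"
proof -
  let ?f = "\<lambda>(r, x) y. hold 1 (add_entry \<tau> E r x y)"
  have "length (result_of (loop length ?f (List.enumerate 0 a) (replicate l 0))) = l \<and>
    time_of (loop length ?f (List.enumerate 0 a) (replicate l 0)) \<le>
      length (List.enumerate 0 a) * (l * (\<tau> + 3) + 1) \<and>
    space_of (loop length ?f (List.enumerate 0 a) (replicate l 0)) \<le> 2 * l + \<tau> + 3"
  proof (rule loop_cost)
    fix x and y :: "real list" assume "length y = l"
    then show "length (result_of (?f x y)) = l \<and> time_of (?f x y) \<le> l * (\<tau> + 3) \<and>
        length y + space_of (?f x y) \<le> 2 * l + \<tau> + 3"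
      using add_entry_cost[of \<tau> E "fst x" "snd x" y]
      by (simp add: case_prod_beta' add_entry_result)
  qed simp
  then show "time_of (sketch_row \<tau> l E a) \<le> l + length a * (l * (\<tau> + 3) + 1)"
    "space_of (sketch_row \<tau> l E a) \<le> 2 * l + \<tau> + 3"
    by (simp_all add: sketch_row_def)
qed

lemma sketch_norm_loop_result:
  "result_of (loop (\<lambda>(y, q). length y + 1) (\<lambda>(r, x) (y, q). hold 1 (do {
          y' \<leftarrow> add_entry \<tau> E r x y;
          hold (length y') (do {
            z \<leftarrow> elem (x * x);
            q' \<leftarrow> hold 1 (elem (q + z));
            ret (y', q') }) })) (List.enumerate m a) (y, q)) =
   (map (\<lambda>j. y ! j + (\<Sum>r<length a. E (m + r) j * a ! r)) [0..<length y],
    q + (\<Sum>r<length a. (a ! r)\<^sup>2))"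
proof (induction a arbitrary: m y q)
  case Nil
  then show ?case by (simp add: map_nth)
next
  case (Cons x a)
  then show ?case
    by (simp add: add_entry_result sum.lessThan_Suc_shift power2_eq_square del: sum.lessThan_Suc)
qed

lemma sketch_row_norm_result:
  "result_of (sketch_row_norm \<tau> l E a) =
    (map (\<lambda>j. \<Sum>r<length a. E r j * a ! r) [0..<l], \<Sum>r<length a. (a ! r)\<^sup>2)"
  by (simp add: sketch_row_norm_def sketch_norm_loop_result del: One_nat_def)

lemma sketch_row_norm_cost:
  "time_of (sketch_row_norm \<tau> l E a) \<le> l + length a * (l * (\<tau> + 3) + 3)"
  "space_of (sketch_row_norm \<tau> l E a) \<le> 2 * l + \<tau> + 6"
proof -
  let ?f = "\<lambda>(r, x) (y, q). hold 1 (do {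
          y' \<leftarrow> add_entry \<tau> E r x y;
          hold (length y') (do {
            z \<leftarrow> elem (x * x);
            q' \<leftarrow> hold 1 (elem (q + z));
            ret (y', q') }) })"
  let ?L = "loop (\<lambda>(y, q). length y + 1) ?f (List.enumerate 0 a) (replicate l 0, 0)"
  have "length (fst (result_of ?L)) = l \<and>
    time_of ?L \<le> length (List.enumerate 0 a) * ((l * (\<tau> + 3) + 2) + 1) \<and>
    space_of ?L \<le> 2 * l + \<tau> + 6"
  proof (rule loop_cost[where I = "\<lambda>yq. length (fst yq) = l"])
    fix x and yq :: "real list \<times> real" assume "length (fst yq) = l"
    then show "length (fst (result_of (?f x yq))) = l \<and> time_of (?f x yq) \<le> l * (\<tau> + 3) + 2 \<and>
        (case yq of (y, q) \<Rightarrow> length y + 1) + space_of (?f x yq) \<le> 2 * l + \<tau> + 6"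
      using add_entry_cost[of \<tau> E "fst x" "snd x" "fst yq"]
      by (simp add: case_prod_beta' add_entry_result)
  qed simp
  moreover have "l * (\<tau> + 3) + 2 + 1 = l * (\<tau> + 3) + 3" by simp
  ultimately have "time_of ?L \<le> length (List.enumerate 0 a) * (l * (\<tau> + 3) + 3) \<and> space_of ?L \<le> 2 * l + \<tau> + 6"
    by metis
  then show "time_of (sketch_row_norm \<tau> l E a) \<le> l + length a * (l * (\<tau> + 3) + 3)"
    "space_of (sketch_row_norm \<tau> l E a) \<le> 2 * l + \<tau> + 6"
    by (simp_all add: sketch_row_norm_def)
qed

text \<open>\<open>List.product y y\<close> lists the pairs in row-major order, so position
  \<open>p\<close> belongs to row \<open>p div l\<close> and column \<open>p mod l\<close>.\<close>

lemma rank_one_update_result: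
  assumes "length y = l" "length G = l * l"
  shows "result_of (rank_one_update y G) =
    map (\<lambda>p. G ! p + y ! (p div l) * y ! (p mod l)) [0..<l * l]"
  unfolding rank_one_update_def
  by (rule nth_equalityI) (use assms in \<open>auto simp: product_nth case_prod_beta'\<close>)

lemma rank_one_update_cost:
  assumes "length y = l" "length G = l * l"
  shows "time_of (rank_one_update y G) \<le> l * l * 3"
    "space_of (rank_one_update y G) \<le> l * l + 2"
proof -
  have len: "length (zip (List.product y y) G) = l * l" using assms by simp
  have "time_of (rank_one_update y G) \<le> length (zip (List.product y y) G) * (2 + 1)"
    unfolding rank_one_update_def by (rule time_collect) (auto simp: case_prod_beta')
  then show "time_of (rank_one_update y G) \<le> l * l * 3" unfolding len by simp
  have "space_of (rank_one_update y G) \<le> length (zip (List.product y y) G) * 1 + 2"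
    unfolding rank_one_update_def by (rule space_collect) (auto simp: case_prod_beta')
  then show "space_of (rank_one_update y G) \<le> l * l + 2" unfolding len by simp
qed

lemma first_pass_loop_result:
  assumes "length G = l * l"
  shows "result_of (loop length (\<lambda>a G. do {
          y \<leftarrow> sketch_row \<tau> l E a;
          hold (length y) (rank_one_update y G) }) As G) =
    map (\<lambda>p. G ! p + (\<Sum>i<length As. (\<Sum>r<length (As ! i). E r (p div l) * As ! i ! r) *
      (\<Sum>r<length (As ! i). E r (p mod l) * As ! i ! r))) [0..<l * l]"
  using assms
proof (induction As arbitrary: G)
  case Nil
  then show ?case by (simp add: list_eq_iff_nth_eq)
next
  case (Cons a As)
  have dm: "p div l < l" "p mod l < l" if "p < l * l" for p
    using that by (auto simp: less_mult_imp_div_less intro!: mod_less_divisor gr0I)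
  have "result_of (rank_one_update (result_of (sketch_row \<tau> l E a)) G) =
    map (\<lambda>p. G ! p + (\<Sum>r<length a. E r (p div l) * a ! r) * (\<Sum>r<length a. E r (p mod l) * a ! r)) [0..<l * l]"
    using Cons.prems dm by (subst rank_one_update_result[where l = l]) (auto simp: sketch_row_result)
  then show ?case
    using Cons.IH by (simp add: sum.lessThan_Suc_shift add.assoc del: sum.lessThan_Suc)
qed

lemma first_pass_result:
  "result_of (first_pass \<tau> l E As) =
    map (\<lambda>p. \<Sum>i<length As. (\<Sum>r<length (As ! i). E r (p div l) * As ! i ! r) *
      (\<Sum>r<length (As ! i). E r (p mod l) * As ! i ! r)) [0..<l * l]"
  unfolding first_pass_def by (simp add: first_pass_loop_result)

lemma first_pass_cost:
  assumes "\<And>a. a \<in> set As \<Longrightarrow> length a = d"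
  shows "time_of (first_pass \<tau> l E As) \<le>
      l * l + length As * (l + d * (l * (\<tau> + 3) + 1) + l * l * 3 + 1)"
    "space_of (first_pass \<tau> l E As) \<le> 2 * (l * l) + 2 * l + \<tau> + 3"
proof -
  let ?f = "\<lambda>a G. do {
          y \<leftarrow> sketch_row \<tau> l E a;
          hold (length y) (rank_one_update y G) }"
  let ?L = "loop length ?f As (replicate (l * l) 0)"
  have "length (result_of ?L) = l * l \<and>
    time_of ?L \<le> length As * ((l + d * (l * (\<tau> + 3) + 1) + l * l * 3) + 1) \<and>
    space_of ?L \<le> 2 * (l * l) + 2 * l + \<tau> + 3"
  proof (rule loop_cost)
    fix a and G :: "real list" assume a: "a \<in> set As" and G: "length G = l * l"
    have len: "length (result_of (sketch_row \<tau> l E a)) = l" by (simp add: sketch_row_result)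
    show "length (result_of (?f a G)) = l * l \<and>
        time_of (?f a G) \<le> l + d * (l * (\<tau> + 3) + 1) + l * l * 3 \<and>
        length G + space_of (?f a G) \<le> 2 * (l * l) + 2 * l + \<tau> + 3"
      using sketch_row_cost[of \<tau> l E a] rank_one_update_cost[OF len G]
        rank_one_update_result[OF len G] assms[OF a] len G
      by simp
  qed simp
  then show "time_of (first_pass \<tau> l E As) \<le>
      l * l + length As * (l + d * (l * (\<tau> + 3) + 1) + l * l * 3 + 1)"
    "space_of (first_pass \<tau> l E As) \<le> 2 * (l * l) + 2 * l + \<tau> + 3"
    by (simp_all add: first_pass_def)
qed

lemma top_singular_result:
  "result_of (top_singular \<kappa> svd k l G) =
    (let B = mat l l (\<lambda>(i, j). G ! (i * l + j))
     in map (\<lambda>j. (sqrt (fst (snd (svd B)) j), map (\<lambda>i. snd (snd (svd B)) $$ (i, j)) [0..<l])) [0..<k])"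
  by (simp add: top_singular_def call_svd_def case_prod_beta' Let_def)

lemma top_singular_cost:
  "time_of (top_singular \<kappa> svd k l G) \<le> \<kappa> * l ^ 3 + k * (2 * l + 2)"
  "space_of (top_singular \<kappa> svd k l G) \<le> \<kappa> * l ^ 2 + (l + l * l) + k * (l + 1) + (l + 2)"
proof -
  define B where "B = mat l l (\<lambda>(i, j). G ! (i * l + j))"
  define D where "D = fst (snd (svd B))"
  define W where "W = snd (snd (svd B))"
  define f where "f = (\<lambda>j. do {
          \<sigma> \<leftarrow> elem (sqrt (D j));
          w \<leftarrow> hold 1 (collect 1 (\<lambda>i. elem (W $$ (i, j))) [0..<l]);
          ret (\<sigma>, w) })"
  have eq: "time_of (top_singular \<kappa> svd k l G) = \<kappa> * l ^ 3 + time_of (collect (l + 1) f [0..<k])"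
    "space_of (top_singular \<kappa> svd k l G) = max (\<kappa> * l ^ 2) (l + l * l + space_of (collect (l + 1) f [0..<k]))"
    unfolding top_singular_def f_def D_def W_def B_def
    by (simp_all add: call_svd_def case_prod_beta')
  have inner: "time_of (collect 1 (\<lambda>i. elem (W $$ (i, j))) [0..<l]) \<le> length [0..<l] * (1 + 1)"
    "space_of (collect 1 (\<lambda>i. elem (W $$ (i, j))) [0..<l]) \<le> length [0..<l] * 1 + 1" for j
    by (rule time_collect, simp) (rule space_collect, simp)
  have "time_of (collect (l + 1) f [0..<k]) \<le> length [0..<k] * ((2 * l + 1) + 1)"
    by (rule time_collect) (use inner in \<open>simp add: f_def mult_2\<close>)
  then show "time_of (top_singular \<kappa> svd k l G) \<le> \<kappa> * l ^ 3 + k * (2 * l + 2)"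
    using eq by simp
  have "space_of (collect (l + 1) f [0..<k]) \<le> length [0..<k] * (l + 1) + (l + 2)"
    by (rule space_collect) (use inner in \<open>simp add: f_def\<close>)
  then show "space_of (top_singular \<kappa> svd k l G) \<le> \<kappa> * l ^ 2 + (l + l * l) + k * (l + 1) + (l + 2)"
    using eq by simp
qed

lemma dot_loop_result:
  "result_of (loop (\<lambda>_. 1) (\<lambda>(u, v) q. hold 1 (do {
      z \<leftarrow> elem (u * v);
      hold 1 (elem (q + z)) })) xs q) = q + (\<Sum>(u, v)\<leftarrow>xs. u * v)"
  by (induction xs arbitrary: q) (auto simp: case_prod_beta')

lemma dot_result:
  assumes "length w = l" "length y = l"
  shows "result_of (dot w y) = (\<Sum>c<l. w ! c * y ! c)"
  unfolding dot_def dot_loop_result using assms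
  by (simp add: sum_list_sum_nth atLeast0LessThan)

lemma dot_cost: "time_of (dot w y) \<le> length y * 3" "space_of (dot w y) \<le> 4"
proof -
  let ?f = "\<lambda>(u, v) q. hold 1 (do {
      z \<leftarrow> elem (u * v);
      hold 1 (elem (q + z)) }) :: real prog"
  let ?L = "loop (\<lambda>_. 1) ?f (zip w y) 0"
  have "True \<and> time_of ?L \<le> length (zip w y) * (2 + 1) \<and> space_of ?L \<le> 4"
    by (rule loop_cost) (auto simp: case_prod_beta')
  then show "time_of (dot w y) \<le> length y * 3" "space_of (dot w y) \<le> 4"
    by (auto simp: dot_def intro: order_trans)
qed

lemma estimate_loop_result:
  "result_of (loop (\<lambda>_. 2) (\<lambda>(\<sigma>, w) (L, S). do {
            z \<leftarrow> dot w y;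
            hold 4 (do {
              x \<leftarrow> elem (z / \<sigma>);
              x2 \<leftarrow> elem (x * x);
              L' \<leftarrow> elem (L + x2);
              z2 \<leftarrow> elem (z * z);
              S' \<leftarrow> elem (S + z2);
              ret (L', S') }) }) tops (L, S)) =
   (L + (\<Sum>(\<sigma>, w)\<leftarrow>tops. (result_of (dot w y) / \<sigma>)\<^sup>2), S + (\<Sum>(\<sigma>, w)\<leftarrow>tops. (result_of (dot w y))\<^sup>2))"
  by (induction tops arbitrary: L S) (auto simp: case_prod_beta' power2_eq_square)

lemma estimate_row_result:
  fixes E :: "nat \<Rightarrow> nat \<Rightarrow> real" and a :: "real list" and l :: nat
  defines "y \<equiv> map (\<lambda>j. \<Sum>r<length a. E r j * a ! r) [0..<l]"
  shows "result_of (estimate_row \<tau> l E tops a) =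
    (\<Sum>(\<sigma>, w)\<leftarrow>tops. (result_of (dot w y) / \<sigma>)\<^sup>2,
     (\<Sum>r<length a. (a ! r)\<^sup>2) - (\<Sum>(\<sigma>, w)\<leftarrow>tops. (result_of (dot w y))\<^sup>2))"
  unfolding estimate_row_def y_def
  by (simp add: sketch_row_norm_result estimate_loop_result)

lemma estimate_row_cost:
  "time_of (estimate_row \<tau> l E tops a) \<le>
    l + length a * (l * (\<tau> + 3) + 3) + length tops * (3 * l + 6) + 1"
  "space_of (estimate_row \<tau> l E tops a) \<le> 2 * l + \<tau> + 8"
proof -
  define y where "y = map (\<lambda>j. \<Sum>r<length a. E r j * a ! r) [0..<l]"
  define f where "f = (\<lambda>(\<sigma>, w) (L, S). do {
            z \<leftarrow> dot w y;
            hold 4 (do {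
              x \<leftarrow> elem (z / \<sigma>);
              x2 \<leftarrow> elem (x * x);
              L' \<leftarrow> elem (L + x2);
              z2 \<leftarrow> elem (z * z);
              S' \<leftarrow> elem (S + z2);
              ret (L', S') }) })"
  let ?L = "loop (\<lambda>_. 2) f tops (0, 0)"
  have "True \<and> time_of ?L \<le> length tops * ((3 * l + 5) + 1) \<and> space_of ?L \<le> 7"
  proof (rule loop_cost)
    fix x and s :: "real \<times> real"
    have "length y = l" by (simp add: y_def)
    then show "True \<and> time_of (f x s) \<le> 3 * l + 5 \<and> 2 + space_of (f x s) \<le> 7"
      using dot_cost[of "snd x" y] by (simp add: f_def case_prod_beta' mult.commute)
  qed simp
  then have L: "time_of ?L \<le> length tops * (3 * l + 6)" "space_of ?L \<le> 7"
    by (simp_all add: add.commute)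
  have eq: "time_of (estimate_row \<tau> l E tops a) = time_of (sketch_row_norm \<tau> l E a) + (time_of ?L + 1)"
    "space_of (estimate_row \<tau> l E tops a) \<le>
      max (space_of (sketch_row_norm \<tau> l E a)) (l + 1 + max (space_of ?L) 3)"
    unfolding estimate_row_def f_def y_def by (simp_all add: sketch_row_norm_result case_prod_beta')
  show "time_of (estimate_row \<tau> l E tops a) \<le>
      l + length a * (l * (\<tau> + 3) + 3) + length tops * (3 * l + 6) + 1"
    using eq(1) L(1) sketch_row_norm_cost(1)[of \<tau> l E a] by linarith
  show "space_of (estimate_row \<tau> l E tops a) \<le> 2 * l + \<tau> + 8"
    using eq(2) L(2) sketch_row_norm_cost(2)[of \<tau> l E a] by linarith
qed

text \<open>With k <= l every space term apart from the seed is at most a multiple of l^2. For time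
  the common unit is n * d * l: terms such as l^3 (the SVD) and n * l^2 (the rank-one updates) fit
  under it by l <= d <= n.\<close>

lemma two_pass_cost:
  assumes len: "\<And>a. a \<in> set As \<Longrightarrow> length a = d" "length As = n"
    and kl: "1 \<le> k" "k \<le> l"
  shows "space_of (two_pass \<tau> \<kappa> svd g k l s As) \<le> length s + (\<tau> + \<kappa> + 12) * l\<^sup>2"
    and "l \<le> d \<Longrightarrow> d \<le> n \<Longrightarrow>
      time_of (two_pass \<tau> \<kappa> svd g k l s As) \<le> (2 * \<tau> + \<kappa> + 32) * (n * d * l)"
proof -
  define E where "E = proj_entry l g s"
  define fp where "fp = first_pass \<tau> l E As"
  define G where "G = result_of fp"
  define ts where "ts = top_singular \<kappa> svd k l G"
  define tops where "tops = result_of ts"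
  define sp where "sp = second_pass \<tau> l E tops As"
  have lenG: "length G = l * l" by (simp add: G_def fp_def first_pass_result)
  have tops: "tops = map (\<lambda>j. (sqrt (fst (snd (svd (mat l l (\<lambda>(i, j). G ! (i * l + j))))) j),
      map (\<lambda>i. snd (snd (svd (mat l l (\<lambda>(i, j). G ! (i * l + j))))) $$ (i, j)) [0..<l])) [0..<k]"
    by (simp add: tops_def ts_def top_singular_result Let_def)
  have size: "(\<Sum>(\<sigma>, w)\<leftarrow>tops. 1 + length w) = k * (l + 1)"
    by (simp add: tops o_def sum_list_triv)
  have lentops: "length tops = k" by (simp add: tops)
  have time: "time_of (two_pass \<tau> \<kappa> svd g k l s As) = time_of fp + (time_of ts + time_of sp)"
    by (simp add: two_pass_def fp_def ts_def sp_def tops_def G_def E_def)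
  have space: "space_of (two_pass \<tau> \<kappa> svd g k l s As) =
      length s + max (space_of fp) (max (l * l + space_of ts) (k * (l + 1) + space_of sp))"
    unfolding size[symmetric] lenG[symmetric]
    by (simp add: two_pass_def fp_def ts_def sp_def tops_def G_def E_def)
  have sp_time: "time_of sp \<le> n * ((l + d * (l * (\<tau> + 3) + 3) + k * (3 * l + 6) + 1) + 1)"
    unfolding sp_def second_pass_def len(2)[symmetric]
    by (rule time_collect) (use estimate_row_cost(1)[of \<tau> l E tops] len(1) lentops in auto)
  have sp_space: "space_of sp \<le> length As * 0 + (2 * l + \<tau> + 8)"
    unfolding sp_def second_pass_def by (rule space_collect) (rule estimate_row_cost(2))
  have fp_cost: "time_of fp \<le> l * l + n * (l + d * (l * (\<tau> + 3) + 1) + l * l * 3 + 1)"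
    "space_of fp \<le> 2 * (l * l) + 2 * l + \<tau> + 3"
    using first_pass_cost[OF len(1), of As \<tau> l E] len(2) by (auto simp: fp_def)
  note ts_cost = top_singular_cost[of \<kappa> svd k l G, folded ts_def]
  have l1: "1 \<le> l" using kl by simp
  have L: "1 \<le> l * l" "l \<le> l * l" "k * l \<le> l * l" "k \<le> l * l"
    using l1 kl by (auto intro: le_trans[OF kl(2)] mult_le_mono1)
  have \<tau>L: "\<tau> \<le> \<tau> * (l * l)" using L(1) by simp
  have "max (space_of fp) (max (l * l + space_of ts) (k * (l + 1) + space_of sp)) \<le> (\<tau> + \<kappa> + 12) * (l * l)"
  proof (intro max.boundedI)
    show "space_of fp \<le> (\<tau> + \<kappa> + 12) * (l * l)"
      using fp_cost(2) L \<tau>L unfolding distrib_right by linarith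
    show "l * l + space_of ts \<le> (\<tau> + \<kappa> + 12) * (l * l)"
      using ts_cost(2) L unfolding distrib_right distrib_left power2_eq_square mult_1_right by linarith
    show "k * (l + 1) + space_of sp \<le> (\<tau> + \<kappa> + 12) * (l * l)"
      using sp_space L \<tau>L unfolding distrib_right distrib_left mult_1_right mult_0_right by linarith
  qed
  then show "space_of (two_pass \<tau> \<kappa> svd g k l s As) \<le> length s + (\<tau> + \<kappa> + 12) * l\<^sup>2"
    unfolding space power2_eq_square by simp
  assume ld: "l \<le> d" and dn: "d \<le> n"
  define X where "X = n * d * l"
  have d1: "1 \<le> d" "1 \<le> n" using l1 ld dn by auto
  have mono3: "a * b * c \<le> X" if "a \<le> n" "b \<le> d" "c \<le> l" for a b c
    unfolding X_def using that by (intro mult_le_mono)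
  have X: "l * l \<le> X" "n * l \<le> X" "n * d \<le> X" "n \<le> X" "n * (l * l) \<le> X" "l * l * l \<le> X" "k * l \<le> X" "k \<le> X"
      "n * (k * l) \<le> X" "n * k \<le> X" "n * (d * l) \<le> X"
    using mono3[of 1 l l] mono3[of n 1 l] mono3[of n d 1] mono3[of n 1 1] mono3[of n l l] mono3[of l l l]
      mono3[of 1 k l] mono3[of 1 k 1] mono3[of n k l] mono3[of n k 1] mono3[of n d l] l1 d1 ld dn kl
    by (auto simp: mult.assoc)
  have \<tau>X: "\<tau> * (n * (d * l)) = \<tau> * X" "\<kappa> * (l * l * l) \<le> \<kappa> * X"
    using X(6) by (auto simp: X_def mult.assoc)
  have 1: "time_of fp \<le> (\<tau> + 10) * X"
  proof -
    have "l * l + n * (l + d * (l * (\<tau> + 3) + 1) + l * l * 3 + 1) =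
        l * l + n * l + \<tau> * (n * (d * l)) + 3 * (n * (d * l)) + n * d + 3 * (n * (l * l)) + n"
      by (simp add: algebra_simps)
    then show ?thesis using fp_cost(1) X unfolding \<tau>X(1) by (simp add: distrib_right)
  qed
  have 2: "time_of ts \<le> (\<kappa> + 4) * X"
  proof -
    have "\<kappa> * l ^ 3 + k * (2 * l + 2) = \<kappa> * (l * l * l) + 2 * (k * l) + 2 * k"
      by (simp add: power3_eq_cube algebra_simps)
    then show ?thesis using ts_cost(1) X \<tau>X(2) unfolding distrib_right by linarith
  qed
  have 3: "time_of sp \<le> (\<tau> + 18) * X"
  proof -
    have "n * ((l + d * (l * (\<tau> + 3) + 3) + k * (3 * l + 6) + 1) + 1) =
        n * l + \<tau> * (n * (d * l)) + 3 * (n * (d * l)) + 3 * (n * d) + 3 * (n * (k * l)) + 6 * (n * k) + 2 * n"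
      by (simp add: algebra_simps)
    then show ?thesis using sp_time X unfolding \<tau>X(1) by (simp add: distrib_right)
  qed
  have "time_of fp + (time_of ts + time_of sp) \<le> (\<tau> + 10) * X + ((\<kappa> + 4) * X + (\<tau> + 18) * X)"
    using 1 2 3 by (intro add_mono)
  also have "\<dots> = (2 * \<tau> + \<kappa> + 32) * X" by (simp add: algebra_simps)
  finally show "time_of (two_pass \<tau> \<kappa> svd g k l s As) \<le> (2 * \<tau> + \<kappa> + 32) * (n * d * l)"
    unfolding time X_def .
qed

text \<open>The list \<open>G\<close> is the row-major form of M^T M, so the program and the closed
  form call \<open>svd\<close> on the same matrix and get the same vectors, whichever decomposition
  \<open>svd\<close> picks.\<close>

lemma two_pass_result:
  assumes A: "A \<in> carrier_mat n d" and svd: "valid_svd_routine svd" and kl: "k \<le> l"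
  shows "result_of (two_pass \<tau> \<kappa> svd g k l s (mat_to_list A)) =
    map (\<lambda>i. (est_lev svd k A (proj_mat d l g s) i, est_dist svd k A (proj_mat d l g s) i)) [0..<n]"
proof -
  define R where "R = proj_mat d l g s"
  have R: "R \<in> carrier_mat d l" by (simp add: R_def proj_mat_def)
  interpret sketch A R n d l k svd by unfold_locales (fact A R svd kl)+
  define E where "E = proj_entry l g s"
  define As where "As = mat_to_list A"
  define G where "G = result_of (first_pass \<tau> l E As)"
  define tops where "tops = result_of (top_singular \<kappa> svd k l G)"
  have As: "length As = n" "\<And>i. i < n \<Longrightarrow> length (As ! i) = d"
    "\<And>i r. i < n \<Longrightarrow> r < d \<Longrightarrow> As ! i ! r = A $$ (i, r)"
    using A by (auto simp: As_def mat_to_list_def)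
  have R_entry: "R $$ (r, c) = E r c" if "r < d" "c < l" for r c
    using that by (simp add: R_def proj_mat_def E_def)
  have row: "(\<Sum>r<length (As ! i). E r c * As ! i ! r) = M $$ (i, c)" if "i < n" "c < l" for i c
    using that As by (simp add: M_entry R_entry)
  have pos: "i * l + j < l * l" if "i < l" "j < l" for i j
  proof -
    have "i * l + j < (i + 1) * l" using that by simp
    also have "\<dots> \<le> l * l" using that by (intro mult_right_mono) auto
    finally show ?thesis .
  qed
  have G: "mat l l (\<lambda>(i, j). G ! (i * l + j)) = transpose_mat M * M"
  proof (rule eq_matI)
    fix i j assume "i < dim_row (transpose_mat M * M)" "j < dim_col (transpose_mat M * M)"
    then have ij: "i < l" "j < l" using M by auto
    then show "mat l l (\<lambda>(i, j). G ! (i * l + j)) $$ (i, j) = (transpose_mat M * M) $$ (i, j)"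
      using pos[OF ij] row As(1)
      by (simp add: G_def first_pass_result gram_entry del: index_mult_mat)
  qed (use M in auto)
  have tops: "tops = map (\<lambda>a. (sqrt (D a), map (\<lambda>c. W $$ (c, a)) [0..<l])) [0..<k]"
    by (simp add: tops_def top_singular_result G D_def W_def Let_def)
  have est: "result_of (estimate_row \<tau> l E tops (As ! i)) = (est_lev svd k A R i, est_dist svd k A R i)"
    if i: "i < n" for i
  proof -
    define y where "y = map (\<lambda>j. \<Sum>r<length (As ! i). E r j * As ! i ! r) [0..<l]"
    have y: "length y = l" "\<And>c. c < l \<Longrightarrow> y ! c = M $$ (i, c)"
      using row[OF i] by (auto simp: y_def)
    have dot: "result_of (dot (map (\<lambda>c. W $$ (c, a)) [0..<l]) y) = Mw a i" for a
      using y by (simp add: dot_result[of _ l] Mw_def mult.commute)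
    \<comment> \<open>A zero singular value causes no mismatch: division by zero yields 0 in the
      program just as in \<open>w\<close>.\<close>
    have 1: "(\<Sum>(\<sigma>, w)\<leftarrow>tops. (result_of (dot w y) / \<sigma>)\<^sup>2) = (\<Sum>a<k. (w a i)\<^sup>2)"
      by (simp add: tops o_def dot w_def sum_list_distinct_conv_sum_set atLeast0LessThan)
    have 2: "(\<Sum>(\<sigma>, w)\<leftarrow>tops. (result_of (dot w y))\<^sup>2) = (\<Sum>a<k. (Mw a i)\<^sup>2)"
      by (simp add: tops o_def dot sum_list_distinct_conv_sum_set atLeast0LessThan)
    have 3: "(\<Sum>r<length (As ! i). (As ! i ! r)\<^sup>2) = (\<Sum>r<d. (A $$ (i, r))\<^sup>2)"
      using As i by simp
    have 4: "(\<Sum>a<k. (Mw a i)\<^sup>2) = outer_sum k D w i i"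
      unfolding outer_sum_def using w_scaled i kl by (intro sum.cong refl) (simp add: power2_eq_square)
    show ?thesis
      unfolding estimate_row_result y_def[symmetric] 1 2 3 4 est_lev_eq[OF i] est_dist_eq[OF i]
      by (simp add: outer_sum_def power2_eq_square)
  qed
  have "result_of (two_pass \<tau> \<kappa> svd g k l s As) = map (\<lambda>a. result_of (estimate_row \<tau> l E tops a)) As"
    by (simp add: two_pass_def second_pass_def tops_def G_def E_def)
  also have "\<dots> = map (\<lambda>i. result_of (estimate_row \<tau> l E tops (As ! i))) [0..<n]"
    using As(1) by (intro nth_equalityI) auto
  also have "\<dots> = map (\<lambda>i. (est_lev svd k A R i, est_dist svd k A R i)) [0..<n]"
    using est by simp
  finally show ?thesis by (simp add: As_def R_def)
qed

section \<open>Choice of the parameters\<close>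

text \<open>The top \<open>k\<close> squares sum to at most k * \<sigma>_1^2, and by the approximate
  rank assumption they make up at least a tenth of the squared Frobenius norm.\<close>

lemma stable_rank_bounds:
  assumes A: "is_svd A U \<sigma> V" "A \<in> carrier_mat n d" and k: "1 \<le> k" "k \<le> d"
    and pos: "\<sigma> (d - 1) > 0" and rank: "approx_rank \<sigma> d k"
  shows "\<sigma> 0 > 0" "(frob_norm A)\<^sup>2 \<le> 10 * real k * (\<sigma> 0)\<^sup>2"
    "1 \<le> stable_rank A \<sigma>" "stable_rank A \<sigma> \<le> 10 * real k"
proof -
  have "\<sigma> (d - 1) \<le> \<sigma> 0" by (rule antimonoD[OF svd_values(1)[OF A(1)]]) simp
  then show \<sigma>0: "\<sigma> 0 > 0" using pos by linarith
  have "(\<Sum>j<k. (\<sigma> j)\<^sup>2) \<le> (\<Sum>j<k. (\<sigma> 0)\<^sup>2)"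
    using antimonoD[OF svd_values(1)[OF A(1)], of 0] svd_values(2)[OF A(1)]
    by (intro sum_mono power_mono) auto
  then show F: "(frob_norm A)\<^sup>2 \<le> 10 * real k * (\<sigma> 0)\<^sup>2"
    using rank by (simp add: approx_rank_def frob_norm_svd(1)[OF A])
  have "(\<sigma> 0)\<^sup>2 \<le> (\<Sum>j<d. (\<sigma> j)\<^sup>2)" by (rule member_le_sum) (use k in auto)
  then show "1 \<le> stable_rank A \<sigma>" using \<sigma>0
    by (simp add: stable_rank_def frob_norm_svd(1)[OF A] pos_le_divide_eq)
  show "stable_rank A \<sigma> \<le> 10 * real k" using F \<sigma>0
    by (simp add: stable_rank_def pos_divide_le_eq)
qed

text \<open>The moment order grows like a logarithm in \<open>k\<close> and enters \<open>l\<close>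
  squared; this bound lets the square cost a single factor \<open>k\<close>.\<close>

lemma ln_le_two_sqrt:
  assumes "x \<ge> 1"
  shows "ln x \<le> 2 * sqrt x"
proof -
  have "ln x = 2 * ln (sqrt x)" using assms by (simp add: ln_sqrt)
  also have "ln (sqrt x) \<le> sqrt x" using assms ln_le_minus_one[of "sqrt x"] by simp
  finally show ?thesis by simp
qed

text \<open>With \<delta>0 at most 1/2 the logarithm is at least 1/2, so that rounding it up costs
  at most a factor 3; its upper bound keeps the dependence on \<open>k\<close> at sqrt k.\<close>

lemma failure_probability:
  fixes \<delta>0 c :: real and k :: nat
  assumes \<delta>0: "0 < \<delta>0" "\<delta>0 \<le> 1 / 2" and c: "c \<ge> 0" and k: "1 \<le> k"
  defines "\<delta> \<equiv> \<delta>0 * real k powr (- c)"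
  shows "\<delta> > 0" "ln (1 / \<delta>) = ln (1 / \<delta>0) + c * ln (real k)" "ln (1 / \<delta>) \<ge> 1 / 2"
    "ln (1 / \<delta>) \<le> (ln (1 / \<delta>0) + 2 * c) * sqrt (real k)" "ln (1 / \<delta>0) \<ge> 1 / 2"
proof -
  show "\<delta> > 0" using \<delta>0 k by (simp add: \<delta>_def)
  show eq: "ln (1 / \<delta>) = ln (1 / \<delta>0) + c * ln (real k)"
    using \<delta>0 k by (simp add: \<delta>_def ln_div ln_mult ln_powr)
  have "ln 2 \<le> ln (1 / \<delta>0)" using \<delta>0 by (simp add: field_simps)
  then show half: "ln (1 / \<delta>0) \<ge> 1 / 2" using ln2_ge_two_thirds by linarith
  moreover have "0 \<le> c * ln (real k)" using c k by simp
  ultimately show "ln (1 / \<delta>) \<ge> 1 / 2" using eq by linarith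
  have s1: "1 \<le> sqrt (real k)" using k by simp
  have "c * ln (real k) \<le> c * (2 * sqrt (real k))"
    using k c by (intro mult_left_mono ln_le_two_sqrt) auto
  moreover have "ln (1 / \<delta>0) * 1 \<le> ln (1 / \<delta>0) * sqrt (real k)"
    using half s1 by (intro mult_left_mono) auto
  ultimately show "ln (1 / \<delta>) \<le> (ln (1 / \<delta>0) + 2 * c) * sqrt (real k)"
    unfolding eq by (simp add: algebra_simps)
qed

lemma sketch_dim_bounds:
  fixes C \<epsilon> \<Delta> :: real and k :: nat
  assumes "C > 0" "\<epsilon> > 0" "\<Delta> > 0" "1 \<le> k"
  defines "l \<equiv> k ^ 3 * nat \<lceil>C * (1 / \<epsilon>) ^ 2 * (1 / \<Delta>) ^ 2\<rceil>"
  shows "k \<le> l" "real l \<ge> real k ^ 3 * (C / (\<epsilon>\<^sup>2 * \<Delta>\<^sup>2))"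
proof -
  have pos: "C * (1 / \<epsilon>) ^ 2 * (1 / \<Delta>) ^ 2 > 0" using assms by simp
  then have "nat \<lceil>C * (1 / \<epsilon>) ^ 2 * (1 / \<Delta>) ^ 2\<rceil> \<ge> 1" by linarith
  moreover have "k * 1 \<le> k * k ^ 2" using assms by (intro mult_le_mono2) simp
  then have "k \<le> k ^ 3" by (simp add: power3_eq_cube power2_eq_square)
  ultimately show "k \<le> l" unfolding l_def using mult_le_mono[of k "k ^ 3" 1] by simp
  have "real (nat \<lceil>C * (1 / \<epsilon>) ^ 2 * (1 / \<Delta>) ^ 2\<rceil>) \<ge> C / (\<epsilon>\<^sup>2 * \<Delta>\<^sup>2)"
    using real_nat_ceiling_ge[of "C * (1 / \<epsilon>) ^ 2 * (1 / \<Delta>) ^ 2"] by (simp add: power_one_over field_simps)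
  then show "real l \<ge> real k ^ 3 * (C / (\<epsilon>\<^sup>2 * \<Delta>\<^sup>2))"
    unfolding l_def of_nat_mult of_nat_power by (intro mult_left_mono) auto
qed

text \<open>Origin of 1382400 = 24 * 9 * 100 * 64: 24 bounds 8 e, 9 comes from p <= 3 x, 100 from
  the square of the bound 10 k \<sigma>_1^2 on the squared Frobenius norm, and 64 from the 8 in
  \<theta>. The 12 is 4 * 3: the moment needs 4 p signs, and p is at most 3 ln (1 /
  \<delta>).\<close>

lemma estimates_whp:
  fixes \<delta>0 c \<epsilon> \<Delta> :: real
  assumes A: "A \<in> carrier_mat n d" and A_svd: "is_svd A U \<sigma> V"
    and svd: "valid_svd_routine svd" and k: "1 \<le> k" "k \<le> d" "k \<le> l"
    and pos: "\<sigma> (d - 1) > 0" and sep: "separated \<sigma> k \<Delta>" and rank: "approx_rank \<sigma> d k"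
    and \<epsilon>: "0 < \<epsilon>" "\<epsilon> \<le> 1" and \<Delta>: "\<Delta> > 0"
    and \<delta>0: "0 < \<delta>0" "\<delta>0 \<le> 1 / 2" and c: "c \<ge> 0"
    and l: "real l \<ge> real k ^ 3 * (1382400 * (ln (1 / \<delta>0) + 2 * c)\<^sup>2 / (\<epsilon>\<^sup>2 * \<Delta>\<^sup>2))"
    and g: "sign_family (nat \<lceil>12 * ln (stable_rank A \<sigma> / (\<delta>0 * real k powr (- c)))\<rceil>) d l m g"
  shows "measure_pmf.prob (pmf_of_set (seeds m))
      {s. (\<Sum>i<n. \<bar>proj_dist A V k i - est_dist svd k A (proj_mat d l g s) i\<bar>) \<le> \<epsilon> * (frob_norm A)\<^sup>2 \<and>
          (\<Sum>i<n. \<bar>lev_score A \<sigma> V k i - est_lev svd k A (proj_mat d l g s) i\<bar>)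
            \<le> \<epsilon> * (\<Sum>i<n. lev_score A \<sigma> V k i)} \<ge> 1 - \<delta>0 * real k powr (- c)"
proof -
  define \<delta> where "\<delta> = \<delta>0 * real k powr (- c)"
  define x where "x = ln (1 / \<delta>)"
  define p where "p = nat \<lceil>x\<rceil>"
  define \<theta> where "\<theta> = (\<epsilon> * \<Delta> / 8 * (\<sigma> 0)\<^sup>2)\<^sup>2"
  define Q where "Q s = (\<Sum>i<n. \<Sum>j<n. (gram_error d l (proj_entry l g s) (\<lambda>r. A $$ (i, r)) (\<lambda>r. A $$ (j, r)))\<^sup>2)" for s
  define L where "L = ln (1 / \<delta>0) + 2 * c"
  note \<delta> = failure_probability[OF \<delta>0 c k(1), folded \<delta>_def x_def L_def]
  note sr = stable_rank_bounds[OF A_svd A k(1,2) pos rank]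
  have p: "real p \<le> 3 * x" "real p \<ge> x" "p \<ge> 1" using \<delta>(3) unfolding p_def by linarith+
  \<comment> \<open>The independence is prescribed through the stable rank; as this is at least 1,
    the prescription covers what ln (1 / \<delta>) demands.\<close>
  have "x \<le> ln (stable_rank A \<sigma> / \<delta>)"
    unfolding x_def using sr(3) \<delta>(1) by (simp add: divide_right_mono)
  then have "real (4 * p) \<le> 12 * ln (stable_rank A \<sigma> / \<delta>)" using p(1) by simp
  then have t: "4 * p \<le> nat \<lceil>12 * ln (stable_rank A \<sigma> / \<delta>)\<rceil>" by linarith
  have F: "(\<Sum>i<n. \<Sum>r<d. (A $$ (i, r))\<^sup>2) = (frob_norm A)\<^sup>2" by (simp add: frob_norm_svd(2)[OF A_svd A])
  have "(real p)\<^sup>2 \<le> (3 * (L * sqrt (real k)))\<^sup>2" using p(1) \<delta>(4) by (intro power_mono) auto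
  then have p2: "(real p)\<^sup>2 \<le> 9 * L\<^sup>2 * real k" by (simp add: power_mult_distrib)
  have F2: "((frob_norm A)\<^sup>2)\<^sup>2 \<le> (10 * real k * (\<sigma> 0)\<^sup>2)\<^sup>2" using sr(2) by (intro power_mono) auto
  have "8 * exp 1 * (real p)\<^sup>2 * ((frob_norm A)\<^sup>2)\<^sup>2 \<le> 8 * 3 * (9 * L\<^sup>2 * real k) * (10 * real k * (\<sigma> 0)\<^sup>2)\<^sup>2"
    using exp_le p2 F2 by (intro mult_mono) auto
  also have "\<dots> = (\<epsilon> * \<Delta> / 8 * (\<sigma> 0)\<^sup>2)\<^sup>2 * (real k ^ 3 * (1382400 * L\<^sup>2 / (\<epsilon>\<^sup>2 * \<Delta>\<^sup>2)))"
    using \<epsilon> \<Delta> by (simp add: power_mult_distrib power_divide power3_eq_cube power2_eq_square[of "real k"] field_simps)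
  also have "\<dots> \<le> \<theta> * real l" unfolding \<theta>_def using l by (intro mult_left_mono) (auto simp: L_def)
  finally have tail: "8 * exp 1 * (real p)\<^sup>2 * (\<Sum>i<n. \<Sum>r<d. (A $$ (i, r))\<^sup>2)\<^sup>2 \<le> \<theta> * real l"
    unfolding F .
  have \<theta>0: "\<theta> > 0" using \<epsilon> \<Delta> sr(1) by (simp add: \<theta>_def)
  have "1 - exp (- real p) \<le> measure_pmf.prob (pmf_of_set (seeds m)) {s. Q s \<le> \<theta>}"
    unfolding Q_def using k by (intro gram_error_tail[OF g[folded \<delta>_def] _ p(3) t \<theta>0 tail]) simp
  moreover have "exp (- real p) \<le> exp (- x)" using p(2) by simp
  moreover have "exp (- x) = \<delta>" using \<delta>(1) by (simp add: x_def ln_div)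
  moreover have "measure_pmf.prob (pmf_of_set (seeds m)) {s. Q s \<le> \<theta>} \<le>
      measure_pmf.prob (pmf_of_set (seeds m))
      {s. (\<Sum>i<n. \<bar>proj_dist A V k i - est_dist svd k A (proj_mat d l g s) i\<bar>) \<le> \<epsilon> * (frob_norm A)\<^sup>2 \<and>
          (\<Sum>i<n. \<bar>lev_score A \<sigma> V k i - est_lev svd k A (proj_mat d l g s) i\<bar>)
            \<le> \<epsilon> * (\<Sum>i<n. lev_score A \<sigma> V k i)}"
  proof (rule measure_pmf.finite_measure_mono)
    show "{s. Q s \<le> \<theta>} \<subseteq>
      {s. (\<Sum>i<n. \<bar>proj_dist A V k i - est_dist svd k A (proj_mat d l g s) i\<bar>) \<le> \<epsilon> * (frob_norm A)\<^sup>2 \<and>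
          (\<Sum>i<n. \<bar>lev_score A \<sigma> V k i - est_lev svd k A (proj_mat d l g s) i\<bar>)
            \<le> \<epsilon> * (\<Sum>i<n. lev_score A \<sigma> V k i)}"
    proof safe
      fix s assume Q: "Q s \<le> \<theta>"
      have R: "proj_mat d l g s \<in> carrier_mat d l" by (simp add: proj_mat_def)
      have entry: "proj_mat d l g s $$ (r, c) = proj_entry l g s r c" if "r < d" "c < l" for r c
        using that by (simp add: proj_mat_def)
      have err: "(\<Sum>i<n. \<Sum>j<n. ((\<Sum>c<l. (\<Sum>r<d. proj_mat d l g s $$ (r, c) * A $$ (i, r)) *
          (\<Sum>r<d. proj_mat d l g s $$ (r, c) * A $$ (j, r))) - (\<Sum>r<d. A $$ (i, r) * A $$ (j, r)))\<^sup>2)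
          \<le> (\<epsilon> * \<Delta> / 8 * (\<sigma> 0)\<^sup>2)\<^sup>2"
        using Q by (simp add: Q_def gram_error_def \<theta>_def entry)
      note acc = estimates_accurate[OF A A_svd R svd k pos sep \<epsilon> \<Delta> err]
      show "(\<Sum>i<n. \<bar>proj_dist A V k i - est_dist svd k A (proj_mat d l g s) i\<bar>) \<le> \<epsilon> * (frob_norm A)\<^sup>2"
        by (rule acc(1))
      show "(\<Sum>i<n. \<bar>lev_score A \<sigma> V k i - est_lev svd k A (proj_mat d l g s) i\<bar>)
            \<le> \<epsilon> * (\<Sum>i<n. lev_score A \<sigma> V k i)"
        by (rule acc(2))
    qed
  qed simp
  ultimately show ?thesis unfolding \<delta>_def[symmetric] by linarith
qed

text \<open>ln (d l + 1) splits into at most ln (d + 1) + ln (l + 1). Multiplied by ln (k + 1), the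
  first part is the announced term and the second is at most l^2, so the seed fits into the space of
  the Gram matrix plus a logarithmic term.\<close>

lemma seed_length_bound:
  fixes \<delta>0 c c0 sr :: real and k d l m :: nat
  assumes \<delta>0: "0 < \<delta>0" "\<delta>0 \<le> 1 / 2" and c: "c \<ge> 0" and k: "1 \<le> k" "k \<le> l"
    and sr: "1 \<le> sr" "sr \<le> 10 * real k"
    and m: "real m \<le> c0 * ln (real (d * l + 1)) * ln (sr / (\<delta>0 * real k powr (- c)))"
  shows "real m \<le> \<bar>c0\<bar> * (2 * (ln 10 + ln (1 / \<delta>0)) + 1 + c) *
    (real l ^ 2 + ln (real d + 1) * ln (real k + 1))"
proof -
  define \<delta> where "\<delta> = \<delta>0 * real k powr (- c)"
  define H where "H = 2 * (ln 10 + ln (1 / \<delta>0)) + 1 + c"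
  note \<delta> = failure_probability[OF \<delta>0 c k(1), folded \<delta>_def]
  have lnk: "ln (real k + 1) \<ge> 1 / 2" "0 \<le> ln (real k)" "ln (real k) \<le> ln (real k + 1)"
  proof -
    have "ln 2 \<le> ln (real k + 1)" using k by simp
    then show "ln (real k + 1) \<ge> 1 / 2" using ln2_ge_two_thirds by linarith
  qed (use k in auto)
  have H0: "H \<ge> 0" using \<delta>(5) c by (simp add: H_def)
  have "ln (sr / \<delta>) = ln sr + ln (1 / \<delta>)" using sr \<delta>(1) by (simp add: ln_div)
  moreover have "ln sr \<le> ln (10 * real k)" using sr by simp
  moreover have "ln (10 * real k) = ln 10 + ln (real k)" using k by (simp add: ln_mult)
  ultimately have "ln (sr / \<delta>) \<le> (ln 10 + ln (1 / \<delta>0)) * 1 + (1 + c) * ln (real k)"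
    using \<delta>(2) by (simp add: algebra_simps)
  \<comment> \<open>Constants are absorbed by \<open>2 * ln (real k + 1) \<ge> 1\<close>, which also
    covers k = 1, where ln k vanishes.\<close>
  also have "\<dots> \<le> (ln 10 + ln (1 / \<delta>0)) * (2 * ln (real k + 1)) + (1 + c) * ln (real k + 1)"
    using lnk c \<delta>(5) by (intro add_mono mult_left_mono) auto
  also have "\<dots> = H * ln (real k + 1)" by (simp add: H_def algebra_simps)
  finally have log_sr: "ln (sr / \<delta>) \<le> H * ln (real k + 1)" .
  have log_sr0: "0 \<le> ln (sr / \<delta>)"
    using \<open>ln (sr / \<delta>) = ln sr + ln (1 / \<delta>)\<close> \<delta>(3) sr by simp
  have "real (d * l + 1) \<le> (real d + 1) * (real l + 1)" by (simp add: algebra_simps)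
  then have "ln (real (d * l + 1)) \<le> ln ((real d + 1) * (real l + 1))"
    by (subst ln_le_cancel_iff) (auto simp: add_pos_nonneg)
  also have "\<dots> = ln (real d + 1) + ln (real l + 1)" by (simp add: ln_mult)
  finally have log_dl: "ln (real (d * l + 1)) \<le> ln (real d + 1) + ln (real l + 1)" .
  have log_dl0: "0 \<le> ln (real (d * l + 1))" by simp
  have ll: "ln (real l + 1) * ln (real k + 1) \<le> real l * real l"
  proof (rule mult_mono)
    show "ln (real l + 1) \<le> real l" using ln_le_minus_one[of "real l + 1"] by simp
    show "ln (real k + 1) \<le> real l" using ln_le_minus_one[of "real k + 1"] k by simp
  qed (use lnk in auto)
  have "real m \<le> \<bar>c0\<bar> * (ln (real (d * l + 1)) * ln (sr / \<delta>))"
    using m mult_right_mono[OF abs_ge_self[of c0] mult_nonneg_nonneg[OF log_dl0 log_sr0]]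
    unfolding \<delta>_def by (simp add: mult.assoc)
  also have "\<dots> \<le> \<bar>c0\<bar> * ((ln (real d + 1) + ln (real l + 1)) * (H * ln (real k + 1)))"
    using log_dl log_sr log_sr0 by (intro mult_left_mono mult_mono) auto
  also have "\<dots> = \<bar>c0\<bar> * H * (ln (real l + 1) * ln (real k + 1) + ln (real d + 1) * ln (real k + 1))"
    by (simp add: algebra_simps)
  also have "\<dots> \<le> \<bar>c0\<bar> * H * (real l ^ 2 + ln (real d + 1) * ln (real k + 1))"
    using ll H0 by (intro mult_left_mono add_mono) (auto simp: power2_eq_square)
  finally show ?thesis by (simp add: H_def)
qed

text \<open>The clause on \<open>c_seed\<close> provides families of every order with short seeds,
  to which the accuracy clause can be applied. \<open>C\<close> is fixed before \<open>c0\<close>,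
  \<tau> and \<kappa>, so the sketch size does not depend on the costs; \<open>K\<close> absorbs
  them. The time clause asks for l <= d because the rank-one updates take order l^2 steps per
  row.\<close>

theorem theorem3:
  shows
  "\<exists>(c_ind::real) (c_seed::real) (\<epsilon>0::real) (a::nat) (b::nat).
     c_ind > 0 \<and> c_seed > 0 \<and> \<epsilon>0 > 0 \<and>
     (\<forall>t d l. t > 0 \<and> d > 0 \<and> l > 0 \<longrightarrow>
        (\<exists>m g. sign_family t d l m g \<and> real m \<le> c_seed * real t * ln (real (d * l + 1)))) \<and>
     (\<forall>(\<delta>0::real) (c::real). 0 < \<delta>0 \<and> \<delta>0 \<le> 1 / 2 \<and> c \<ge> 0 \<longrightarrow>
      (\<exists>(C::real) > 0. \<forall>(c0::real) (\<tau>::nat) (\<kappa>::nat). \<exists>(K::real) > 0.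
       \<forall>(k::nat) (\<epsilon>::real) (\<Delta>::real). k \<ge> 1 \<and> 0 < \<epsilon> \<and> \<epsilon> \<le> \<epsilon>0 \<and> \<Delta> > 0 \<longrightarrow>
        (let l = k ^ 3 * nat \<lceil>C * (1 / \<epsilon>) ^ a * (1 / \<Delta>) ^ b\<rceil>;
             \<delta> = \<delta>0 * real k powr (- c)
         in \<forall>(n::nat) (d::nat) (A::real mat) U \<sigma> V svd m g.
              A \<in> carrier_mat n d \<and> is_svd A U \<sigma> V \<and> k \<le> d \<and> \<sigma> (d - 1) > 0 \<and>
              separated \<sigma> k \<Delta> \<and> approx_rank \<sigma> d k \<and> valid_svd_routine svd \<and>
              sign_family (nat \<lceil>c_ind * ln (stable_rank A \<sigma> / \<delta>)\<rceil>) d l m g \<longrightarrow>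
              measure_pmf.prob (pmf_of_set (seeds m))
                {s. (\<Sum>i<n. \<bar>proj_dist A V k i - est_dist svd k A (proj_mat d l g s) i\<bar>)
                      \<le> \<epsilon> * (frob_norm A)\<^sup>2 \<and>
                    (\<Sum>i<n. \<bar>lev_score A \<sigma> V k i - est_lev svd k A (proj_mat d l g s) i\<bar>)
                      \<le> \<epsilon> * (\<Sum>i<n. lev_score A \<sigma> V k i)} \<ge> 1 - \<delta> \<and>
              (\<forall>s \<in> seeds m.
                 let run = two_pass \<tau> \<kappa> svd g k l s (mat_to_list A)
                 in result_of run =
                      map (\<lambda>i. (est_lev svd k A (proj_mat d l g s) i,
                                est_dist svd k A (proj_mat d l g s) i)) [0..<n] \<and>
                    (real m \<le> c0 * ln (real (d * l + 1)) * ln (stable_rank A \<sigma> / \<delta>) \<longrightarrow>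
                       real (space_of run) \<le> K * (real l ^ 2 + ln (real d + 1) * ln (real k + 1))) \<and>
                    (l \<le> d \<longrightarrow> real (time_of run) \<le> K * real n * real d * real l)))))"
\<comment> \<open>The 12 and the two exponents 2 come from \<open>estimates_whp\<close>, the
  \<open>2 / ln 2\<close> from \<open>ex_sign_family_log_seed\<close>; every \<epsilon> up to 1 is
  small enough.\<close>
proof (rule exI[of _ 12], rule exI[of _ "2 / ln 2"], rule exI[of _ 1], rule exI[of _ 2], rule exI[of _ 2],
    intro conjI allI impI, goal_cases)
  case (4 t d l)
  then show ?case by (intro ex_sign_family_log_seed) auto
next
  case (5 \<delta>0 c)
  then have \<delta>0: "0 < \<delta>0" "\<delta>0 \<le> 1 / 2" and c: "c \<ge> 0" by auto
  define C where "C = 1382400 * (ln (1 / \<delta>0) + 2 * c)\<^sup>2"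
  define H where "H = 2 * (ln 10 + ln (1 / \<delta>0)) + 1 + c"
  have ln\<delta>0: "ln (1 / \<delta>0) \<ge> 1 / 2" by (rule failure_probability(5)[OF \<delta>0 c order_refl])
  have C: "C > 0" using ln\<delta>0 c by (simp add: C_def)
  have H: "H \<ge> 0" using ln\<delta>0 c by (simp add: H_def)
  show ?case
  proof (rule exI[of _ C], intro conjI C allI, goal_cases)
    case (1 c0 \<tau> \<kappa>)
    \<comment> \<open>The first summand pays for the seed bits, the second for the steps and cells
      of the program. The absolute value allows any real \<open>c0\<close>.\<close>
    define K where "K = \<bar>c0\<bar> * H + real (2 * \<tau> + \<kappa> + 32)"
    have cH: "0 \<le> \<bar>c0\<bar> * H" using H by simp
    then have K: "K > 0" by (simp add: K_def)
    show ?case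
      unfolding Let_def
    proof (rule exI[of _ K], intro conjI K allI impI ballI; elim conjE)
      fix k :: nat and \<epsilon> \<Delta> :: real and n d :: nat and A :: "real mat" and U \<sigma> V svd m g
      let ?l = "k ^ 3 * nat \<lceil>C * (1 / \<epsilon>) ^ 2 * (1 / \<Delta>) ^ 2\<rceil>"
      assume k: "k \<ge> 1" and \<epsilon>: "0 < \<epsilon>" "\<epsilon> \<le> 1" and \<Delta>: "\<Delta> > 0"
        and A: "A \<in> carrier_mat n d" "is_svd A U \<sigma> V" "k \<le> d" "\<sigma> (d - 1) > 0"
          "separated \<sigma> k \<Delta>" "approx_rank \<sigma> d k" and svd: "valid_svd_routine svd"
        and g: "sign_family (nat \<lceil>12 * ln (stable_rank A \<sigma> / (\<delta>0 * real k powr (- c)))\<rceil>) d ?l m g"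
      note l = sketch_dim_bounds[OF C \<epsilon>(1) \<Delta> k]
      show "measure_pmf.prob (pmf_of_set (seeds m))
          {s. (\<Sum>i<n. \<bar>proj_dist A V k i - est_dist svd k A (proj_mat d ?l g s) i\<bar>)
                \<le> \<epsilon> * (frob_norm A)\<^sup>2 \<and>
              (\<Sum>i<n. \<bar>lev_score A \<sigma> V k i - est_lev svd k A (proj_mat d ?l g s) i\<bar>)
                \<le> \<epsilon> * (\<Sum>i<n. lev_score A \<sigma> V k i)} \<ge> 1 - \<delta>0 * real k powr (- c)"
      proof (rule estimates_whp[OF A(1,2) svd k A(3) l(1) A(4-6) \<epsilon> \<Delta> \<delta>0 c _ g])
        show "real k ^ 3 * (1382400 * (ln (1 / \<delta>0) + 2 * c)\<^sup>2 / (\<epsilon>\<^sup>2 * \<Delta>\<^sup>2)) \<le> real ?l"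
          using l(2) by (simp only: C_def)
      qed
      fix s assume s: "s \<in> seeds m"
      show "result_of (two_pass \<tau> \<kappa> svd g k ?l s (mat_to_list A)) =
          map (\<lambda>i. (est_lev svd k A (proj_mat d ?l g s) i, est_dist svd k A (proj_mat d ?l g s) i)) [0..<n]"
        by (rule two_pass_result[OF A(1) svd l(1)])
      have rows: "length a = d" if "a \<in> set (mat_to_list A)" for a
        using that A(1) by (auto simp: mat_to_list_def)
      have len: "length (mat_to_list A) = n" using A(1) by (simp add: mat_to_list_def)
      have cost: "space_of (two_pass \<tau> \<kappa> svd g k ?l s (mat_to_list A)) \<le> length s + (\<tau> + \<kappa> + 12) * ?l\<^sup>2"
        by (rule two_pass_cost(1)[OF _ len k l(1)]) (rule rows)
      have cost_time: "time_of (two_pass \<tau> \<kappa> svd g k ?l s (mat_to_list A)) \<le> (2 * \<tau> + \<kappa> + 32) * (n * d * ?l)"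
        if "?l \<le> d" "d \<le> n"
        using that by (intro two_pass_cost(2)[OF _ len k l(1)] rows)
      have slen: "length s = m" using s by (simp add: seeds_def)
      {
        assume m: "real m \<le> c0 * ln (real (d * ?l + 1)) * ln (stable_rank A \<sigma> / (\<delta>0 * real k powr (- c)))"
        define Y where "Y = ln (real d + 1) * ln (real k + 1)"
        have Y: "Y \<ge> 0" unfolding Y_def by (intro mult_nonneg_nonneg) auto
        note sr = stable_rank_bounds(3,4)[OF A(2,1) k A(3,4,6)]
        have 1: "real m \<le> \<bar>c0\<bar> * H * (real ?l ^ 2 + Y)"
          unfolding H_def Y_def by (rule seed_length_bound[OF \<delta>0 c k l(1) sr m])
        have "real (space_of (two_pass \<tau> \<kappa> svd g k ?l s (mat_to_list A))) \<le>
            real (m + (\<tau> + \<kappa> + 12) * ?l\<^sup>2)"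
          using cost unfolding slen by (rule of_nat_mono)
        also have "\<dots> = real m + real (\<tau> + \<kappa> + 12) * real ?l ^ 2" by simp
        also have "\<dots> \<le> \<bar>c0\<bar> * H * (real ?l ^ 2 + Y) + real (2 * \<tau> + \<kappa> + 32) * (real ?l ^ 2 + Y)"
          using 1 Y by (intro add_mono mult_mono) auto
        also have "\<dots> = K * (real ?l ^ 2 + Y)" by (simp add: K_def distrib_right)
        finally show "real (space_of (two_pass \<tau> \<kappa> svd g k ?l s (mat_to_list A))) \<le>
            K * (real ?l ^ 2 + ln (real d + 1) * ln (real k + 1))"
          by (simp add: Y_def)
      }
      {
        assume ld: "?l \<le> d"
        have "d \<le> n" by (rule frame_dim_le[OF svd_frame[OF A(2,1)]])
        then have "real (time_of (two_pass \<tau> \<kappa> svd g k ?l s (mat_to_list A))) \<le>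
            real ((2 * \<tau> + \<kappa> + 32) * (n * d * ?l))"
          using cost_time[OF ld] by (intro of_nat_mono)
        also have "\<dots> = real (2 * \<tau> + \<kappa> + 32) * (real n * real d * real ?l)" by simp
        also have "\<dots> \<le> K * (real n * real d * real ?l)"
          using cH by (intro mult_right_mono) (auto simp: K_def)
        finally show "real (time_of (two_pass \<tau> \<kappa> svd g k ?l s (mat_to_list A))) \<le>
            K * real n * real d * real ?l"
          by (simp add: mult.assoc)
      }
    qed
  qed
qed auto

end
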